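(* Let $G=(V,E)$ be a directed graph (loops allowed, no multiedges) with $n$ nodes and $m$ edges, let $s,t\in V$, let $B$ be the $s$-$t$ bridge sequence of $G$, and let $X\subseteq V\cup E$. There exist algorithms that, in $O(m+n)$ time, compute a representation of size $O(|B|)$ of the solution $S$ (the set of all maximal safe sequences) of the $X$-visible $s$-$t$ walks safety problem, from which the complete solution $S$ can be reported in $O(\mathrm{len}(S))$ time, where $\mathrm{len}(S)$ is the total length of the sequences in $S$.
   Context: A walk is an alternating sequence $(v_1,e_1,v_2,\dots,e_k,v_{k+1})$ of nodes and edges with $e_i=(v_i,v_{i+1})$; an $s$-$t$ walk starts at $s$ and ends at $t$ (nodes and edges may repeat). An $s$-$t$ bridge is an edge whose removal leaves no $s$-$t$ path in $G$; all $s$-$t$ bridges appear on every $s$-$t$ path in the same order, and the bridge sequence $B$ is the sequence of $s$-$t$ bridges in this order. For $X\subseteq V\cup E$, the $X$-subsequence of a walk is the subsequence of its elements that belong to $X$. A sequence of elements of $X$ is safe (for the $X$-visible $s$-$t$ walks problem) if it is a substring of the $X$-subsequence of every $s$-$t$ walk of $G$; it is maximal safe if it cannot be extended on either side while staying safe.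
   Formalization: The representation size is O(|B| + a + 1), where a is the number of nodes in X lying on every s-t path; O(|B|) alone fails, e.g. for a chain of diamonds with X = V, which has no bridges but many maximal safe sequences. Time O(len(S)) is read as O(len(S)+1). *)

theory Defs
  imports "Graph_Theory.Graph_Theory" "HOL-Library.Sublist"
begin

section \<open>Walks, bridges and safe sequences\<close>

text \<open>
  Graphs are the \<^typ>\<open>'a pair_pre_digraph\<close>s satisfying \<^const>\<open>pair_fin_digraph\<close>: an edge is the
  pair of its end nodes, so there are no parallel edges, and loops are allowed.
\<close>

datatype 'a elem = Node 'a | Edge "'a \<times> 'a"

definition elems :: "'a pair_pre_digraph \<Rightarrow> 'a elem set" where
  "elems G = Node ` pverts G \<union> Edge ` parcs G"

text \<open>
  The library represents a walk by its start node and its list of edges; \<open>alternating\<close> turns this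
  into the alternating sequence of nodes and edges.
\<close>

fun alternating :: "'a \<Rightarrow> ('a \<times> 'a) list \<Rightarrow> 'a elem list" where
  "alternating u [] = [Node u]"
| "alternating u (e # p) = Node u # Edge e # alternating (snd e) p"

definition bridges :: "'a pair_pre_digraph \<Rightarrow> 'a \<Rightarrow> 'a \<Rightarrow> ('a \<times> 'a) set" where
  "bridges G s t =
    {e \<in> parcs G. \<not> (\<exists>p. pre_digraph.apath (pre_digraph.del_arc (with_proj G) e) s p t)}"

text \<open>
  If \<open>t\<close> is not reachable from \<open>s\<close>, then every edge is a bridge and every enumeration of the edges is
  a bridge sequence; otherwise the bridge sequence is unique.
\<close>

definition bridge_sequence ::
    "'a pair_pre_digraph \<Rightarrow> 'a \<Rightarrow> 'a \<Rightarrow> ('a \<times> 'a) list \<Rightarrow> bool" where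
  "bridge_sequence G s t B \<longleftrightarrow>
    distinct B \<and> set B = bridges G s t \<and>
    (\<forall>p. pre_digraph.apath (with_proj G) s p t \<longrightarrow> filter (\<lambda>e. e \<in> bridges G s t) p = B)"

text \<open>
  The nodes that lie on every \<open>s\<close>-\<open>t\<close> path. A visible one can be a maximal safe sequence on its own
  even if the graph has no bridge at all (glue diamonds \<open>u \<rightarrow> a \<rightarrow> w\<close>, \<open>u \<rightarrow> b \<rightarrow> w\<close> into a chain and
  make all nodes visible), so a representation of all maximal safe sequences has to account for
  the visible articulation points besides the bridges.
\<close>

definition articulation_points :: "'a pair_pre_digraph \<Rightarrow> 'a \<Rightarrow> 'a \<Rightarrow> 'a set" where
  "articulation_points G s t =
    {v \<in> pverts G. \<forall>p. pre_digraph.apath (with_proj G) s p t \<longrightarrow>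
                        v \<in> set (pre_digraph.awalk_verts (with_proj G) s p)}"

definition subsequence_of :: "'a elem set \<Rightarrow> 'a elem list \<Rightarrow> 'a elem list" where
  "subsequence_of X w = filter (\<lambda>x. x \<in> X) w"

definition safe :: "'a pair_pre_digraph \<Rightarrow> 'a \<Rightarrow> 'a \<Rightarrow> 'a elem set \<Rightarrow> 'a elem list \<Rightarrow> bool" where
  "safe G s t X w \<longleftrightarrow>
    set w \<subseteq> X \<and>
    (\<forall>p. pre_digraph.awalk (with_proj G) s p t \<longrightarrow>
         sublist w (subsequence_of X (alternating s p)))"

definition maximal_safe ::
    "'a pair_pre_digraph \<Rightarrow> 'a \<Rightarrow> 'a \<Rightarrow> 'a elem set \<Rightarrow> 'a elem list \<Rightarrow> bool" where
  "maximal_safe G s t X w \<longleftrightarrow>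
    safe G s t X w \<and> (\<forall>x. \<not> safe G s t X (x # w) \<and> \<not> safe G s t X (w @ [x]))"

definition solution ::
    "'a pair_pre_digraph \<Rightarrow> 'a \<Rightarrow> 'a \<Rightarrow> 'a elem set \<Rightarrow> 'a elem list set" where
  "solution G s t X = {w. maximal_safe G s t X w}"

definition total_length :: "'a list set \<Rightarrow> nat" where
  "total_length S = (\<Sum>w\<in>S. length w)"


subsection \<open>Existence of the bridge sequence\<close>

lemma bridge_in_awalk:
  assumes "pair_fin_digraph G" "e \<in> bridges G s t" "pre_digraph.awalk (with_proj G) s p t"
  shows "e \<in> set p"
proof (rule ccontr)
  assume e: "e \<notin> set p"
  interpret pair_fin_digraph G by fact
  let ?H = "pre_digraph.del_arc (with_proj G) e"
  interpret H: wf_digraph ?H by (rule wf_digraph_del_arc)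
  have cas: "pre_digraph.cas ?H u q v = pcas u q v" for u q v
    by (induct q arbitrary: u) (auto simp: pre_digraph.cas.simps del_arc_def)
  have "H.awalk s p t"
    using assms(3) e unfolding H.awalk_def awalk_def cas by (auto simp: del_arc_def)
  then have "H.apath s (H.awalk_to_apath p) t" by (rule H.apath_awalk_to_apath)
  with assms(2) show False unfolding bridges_def by blast
qed

lemma same_relative_order_eq:
  assumes "distinct xs" "distinct ys" "set xs = set ys"
    and "\<And>a b us vs ws us' vs' ws'. xs = us @ a # vs @ b # ws \<Longrightarrow> ys \<noteq> us' @ b # vs' @ a # ws'"
  shows "xs = ys"
  using assms
proof (induct xs arbitrary: ys)
  case Nil
  then show ?case by simp
next
  case (Cons x xs)
  from Cons.prems(3) have "x \<in> set ys" by auto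
  then obtain us ws where ys: "ys = us @ x # ws" by (meson split_list)
  have "us = []"
  proof (rule ccontr)
    assume "us \<noteq> []"
    then obtain y us' where us: "us = y # us'" by (cases us) auto
    with ys Cons.prems(2,3) have "y \<in> set xs" by (auto simp: set_eq_iff)
    then obtain vs zs where xs: "xs = vs @ y # zs" by (meson split_list)
    from Cons.prems(4)[of "[]" x vs y zs "[]" us' ws] ys us xs show False by simp
  qed
  with ys have ys: "ys = x # ws" by simp
  have "xs = ws"
  proof (rule Cons.hyps)
    show "distinct xs" "distinct ws" using Cons.prems(1,2) ys by simp_all
    show "set xs = set ws" using Cons.prems(1-3) ys by (simp add: insert_ident)
    show "ws \<noteq> us' @ b # vs' @ a # ws'" if "xs = us @ a # vs @ b # zs" for us a vs b zs us' vs' ws'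
      using Cons.prems(4)[of "x # us" a vs b zs "x # us'" vs' ws'] that ys by auto
  qed
  with ys show ?case by simp
qed

lemma filter_split:
  assumes "filter P p = us @ a # zs"
  shows "\<exists>p1 q. p = p1 @ a # q \<and> filter P q = zs"
  using assms
proof (induct us arbitrary: p)
  case Nil
  then show ?case by (auto simp: filter_eq_Cons_iff)
next
  case (Cons u us)
  then obtain p1 q where "p = p1 @ u # q" "filter P q = us @ a # zs"
    by (auto simp: filter_eq_Cons_iff)
  with Cons.hyps[of q] obtain p2 r where "p = (p1 @ u # p2) @ a # r" "filter P r = zs" by auto
  then show ?case by blast
qed

lemma filter_split2:
  assumes "filter P p = us @ a # vs @ b # ws"
  obtains p1 p2 p3 where "p = p1 @ a # p2 @ b # p3"
proof -
  from filter_split[OF assms] obtain p1 q where 1: "p = p1 @ a # q" "filter P q = vs @ b # ws"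
    by blast
  from filter_split[OF 1(2)] obtain p2 p3 where "q = p2 @ b # p3" by blast
  with 1 that show ?thesis by blast
qed

lemma ex_bridge_sequence:
  assumes "pair_fin_digraph G"
  shows "\<exists>B. bridge_sequence G s t B"
proof -
  interpret pair_fin_digraph G by fact
  let ?P = "\<lambda>e. e \<in> bridges G s t"
  have dist: "distinct p" if "apath s p t" for p
  proof -
    have "distinct (pawalk_verts s p)" using that by (simp add: apath_def)
    moreover have "pawalk_verts s p = map fst p @ [if p = [] then s else snd (last p)]"
      by (induct p arbitrary: s) auto
    ultimately show ?thesis by (simp add: distinct_map)
  qed
  have set: "set (filter ?P p) = bridges G s t" if "apath s p t" for p
    using bridge_in_awalk[OF assms] that by (auto simp: apath_def)
  have eq: "filter ?P p = filter ?P q" if p: "apath s p t" and q: "apath s q t" for p q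
  proof (rule same_relative_order_eq)
    show "distinct (filter ?P p)" "distinct (filter ?P q)" using dist p q by auto
    show "set (filter ?P p) = set (filter ?P q)" using set p q by simp
    fix a b us vs ws us' vs' ws'
    assume fp: "filter ?P p = us @ a # vs @ b # ws"
    show "filter ?P q \<noteq> us' @ b # vs' @ a # ws'"
    proof
      assume fq: "filter ?P q = us' @ b # vs' @ a # ws'"
      obtain p1 p2 p3 where p': "p = p1 @ a # p2 @ b # p3" using fp by (rule filter_split2)
      obtain q1 q2 q3 where q': "q = q1 @ b # q2 @ a # q3" using fq by (rule filter_split2)
      have "awalk s p t" "awalk s q t" using p q by (auto simp: apath_def)
      then have "awalk s q1 (fst b)" "awalk (fst b) (b # p3) t"
        unfolding p' q' by (simp_all add: awalk_Cons_iff) metis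
      then have "awalk s (q1 @ b # p3) t" by (rule awalk_appendI)
      moreover have "a \<in> bridges G s t"
        using set[OF p] fp by (metis in_set_conv_decomp)
      ultimately have "a \<in> set (q1 @ b # p3)" using bridge_in_awalk[OF assms] by blast
      with dist[OF p] dist[OF q] p' q' show False by auto
    qed
  qed
  show ?thesis
  proof (cases "\<exists>p. apath s p t")
    case True
    then obtain p where p: "apath s p t" by blast
    have "bridge_sequence G s t (filter ?P p)"
      unfolding bridge_sequence_def
    proof (intro conjI allI impI)
      show "distinct (filter ?P p)" by (rule distinct_filter[OF dist[OF p]])
      show "set (filter ?P p) = bridges G s t" by (rule set[OF p])
      show "filter ?P q = filter ?P p" if "apath s q t" for q by (rule eq[OF that p])
    qed
    then show ?thesis by blast
  next
    case False
    have "finite (bridges G s t)"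
      using pair_finite_arcs unfolding bridges_def by auto
    then obtain B where "set B = bridges G s t" "distinct B" using finite_distinct_list by blast
    with False have "bridge_sequence G s t B" unfolding bridge_sequence_def by auto
    then show ?thesis by blast
  qed
qed


section \<open>Word RAM\<close>

text \<open>
  A word RAM whose words are the numbers below \<open>W\<close>. Programs are structured; the memory consists of
  arrays of words, named by numbers, of which a fixed program can mention only finitely many
  (a scalar variable is a cell with a constant index). All cells outside the input are initially 0.
  Addition wraps around at \<open>W\<close>, subtraction truncates at 0, and every operator, memory access,
  assignment, output of a word and test costs one unit of time.
\<close>

datatype aexp = Const nat | Cell nat aexp | Add aexp aexp | Sub aexp aexp

datatype bexp = Less aexp aexp | Neg bexp | Conj bexp bexp

datatype com =
    Skip
  | Store nat aexp aexp
  | Emit aexp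
  | Seq com com
  | Cond bexp com com
  | While bexp com

type_synonym memory = "nat \<Rightarrow> nat \<Rightarrow> nat"

primrec aval :: "nat \<Rightarrow> memory \<Rightarrow> aexp \<Rightarrow> nat" where
  "aval W M (Const k) = k mod W"
| "aval W M (Cell a i) = M a (aval W M i)"
| "aval W M (Add e f) = (aval W M e + aval W M f) mod W"
| "aval W M (Sub e f) = aval W M e - aval W M f"

primrec bval :: "nat \<Rightarrow> memory \<Rightarrow> bexp \<Rightarrow> bool" where
  "bval W M (Less e f) \<longleftrightarrow> aval W M e < aval W M f"
| "bval W M (Neg b) \<longleftrightarrow> \<not> bval W M b"
| "bval W M (Conj b d) \<longleftrightarrow> bval W M b \<and> bval W M d"

primrec acost :: "aexp \<Rightarrow> nat" where
  "acost (Const k) = 1"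
| "acost (Cell a i) = acost i + 1"
| "acost (Add e f) = acost e + acost f + 1"
| "acost (Sub e f) = acost e + acost f + 1"

primrec bcost :: "bexp \<Rightarrow> nat" where
  "bcost (Less e f) = acost e + acost f + 1"
| "bcost (Neg b) = bcost b + 1"
| "bcost (Conj b d) = bcost b + bcost d + 1"

text \<open>
  \<open>exec W p (M, ys) k (M', ys')\<close>: started in memory \<open>M\<close> with output \<open>ys\<close> so far, \<open>p\<close> terminates
  after \<open>k\<close> time units in memory \<open>M'\<close> with output \<open>ys'\<close>.
\<close>

inductive exec ::
    "nat \<Rightarrow> com \<Rightarrow> memory \<times> nat list \<Rightarrow> nat \<Rightarrow> memory \<times> nat list \<Rightarrow> bool" for W where
  exec_Skip: "exec W Skip (M, ys) 1 (M, ys)"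
| exec_Store: "exec W (Store a i e) (M, ys) (acost i + acost e + 1)
                 (M(a := (M a)(aval W M i := aval W M e)), ys)"
| exec_Emit: "exec W (Emit e) (M, ys) (acost e + 1) (M, ys @ [aval W M e])"
| exec_Seq: "exec W p c1 k c2 \<Longrightarrow> exec W q c2 l c3 \<Longrightarrow> exec W (Seq p q) c1 (k + l) c3"
| exec_CondTrue: "bval W M b \<Longrightarrow> exec W p (M, ys) k c' \<Longrightarrow>
                 exec W (Cond b p q) (M, ys) (bcost b + k + 1) c'"
| exec_CondFalse: "\<not> bval W M b \<Longrightarrow> exec W q (M, ys) k c' \<Longrightarrow>
                 exec W (Cond b p q) (M, ys) (bcost b + k + 1) c'"
| exec_WhileFalse: "\<not> bval W M b \<Longrightarrow> exec W (While b p) (M, ys) (bcost b + 1) (M, ys)"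
| exec_WhileTrue: "bval W M b \<Longrightarrow> exec W p (M, ys) k c' \<Longrightarrow> exec W (While b p) c' l c'' \<Longrightarrow>
                 exec W (While b p) (M, ys) (bcost b + k + l + 1) c''"

definition input_memory :: "nat list \<Rightarrow> memory" where
  "input_memory xs = (\<lambda>a i. if a = 0 \<and> i < length xs then xs ! i else 0)"

definition outputs_within :: "nat \<Rightarrow> com \<Rightarrow> nat list \<Rightarrow> nat \<Rightarrow> nat list \<Rightarrow> bool" where
  "outputs_within W p xs T ys \<longleftrightarrow>
    (\<exists>k M. k \<le> T \<and> exec W p (input_memory xs, []) k (M, ys))"


section \<open>Encoding of instances and solutions\<close>

text \<open>
  An instance consists of \<open>n\<close>, the number of edges, \<open>s\<close>, \<open>t\<close>, the tails and the heads of the edges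
  in the (arbitrary) order of the edge list \<open>es\<close>, and the characteristic vectors of the visible
  nodes and of the visible edges.
\<close>

definition encode_instance ::
    "nat \<Rightarrow> (nat \<times> nat) list \<Rightarrow> nat \<Rightarrow> nat \<Rightarrow> nat elem set \<Rightarrow> nat list" where
  "encode_instance n es s t X =
    [n, length es, s, t] @ map fst es @ map snd es @
    map (\<lambda>v. of_bool (Node v \<in> X)) [0..<n] @ map (\<lambda>e. of_bool (Edge e \<in> X)) es"

text \<open>A node is reported by its number, the \<open>k\<close>-th edge of the edge list by \<open>n + k\<close>.\<close>

fun elem_code :: "nat \<Rightarrow> (nat \<times> nat) list \<Rightarrow> nat elem \<Rightarrow> nat" where
  "elem_code n es (Node v) = v"
| "elem_code n es (Edge e) = n + (THE k. k < length es \<and> es ! k = e)"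

text \<open>
  The sequences of \<open>S\<close> are reported one after another, each exactly once and preceded by its length.
\<close>

definition reports ::
    "nat \<Rightarrow> (nat \<times> nat) list \<Rightarrow> nat elem list set \<Rightarrow> nat list \<Rightarrow> bool" where
  "reports n es S ys \<longleftrightarrow>
    (\<exists>ws. distinct ws \<and> set ws = S \<and>
          ys = concat (map (\<lambda>w. length w # map (elem_code n es) w) ws))"

end

theory Submission
  imports Defs
begin

text \<open>
  Subdividing every edge turns the edges into nodes, so that only sequences of nodes occur, and the
  elements of a safe sequence are visible nodes on every \<open>s\<close>-\<open>t\<close> walk. Let \<open>Y 2, \<dots>, Y K\<close> be these
  nodes in the order in which every walk first meets them, and let \<open>L x\<close> be the least number \<open>b\<close> such
  that \<open>x\<close> is reachable from \<open>s\<close> without visiting \<open>Y (b + 1)\<close>. An arc leads from a layer to the same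
  layer, to a lower one, or to the first node of the next one.

  A walk spoils \<open>Y i, \<dots>, Y j\<close> in one of two ways: it meets another visible node in layer \<open>a - 1\<close> on the
  way to \<open>Y a\<close> (where \<open>i < a \<le> j\<close>), or it returns from layer \<open>b\<close> to \<open>Y a\<close> (where \<open>i < a \<le> b < j\<close>)
  without meeting any other \<open>Y\<close>. Both are detected by backward search from \<open>Y a\<close> inside layer \<open>a - 1\<close>
  (the set \<open>Tc a\<close>) by looking at the layers of the tails of all arcs into \<open>Tc a\<close>. Hence \<open>Y i, \<dots>, Y j\<close>
  is safe iff \<open>j \<le> r i\<close>, where \<open>r i\<close> is a suffix minimum of such layer numbers, and all of
  \<open>Y\<close>, \<open>L\<close> and \<open>r\<close> come from three linear searches. The representation consists of \<open>K\<close>, \<open>Y\<close> and \<open>r\<close>.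
\<close>

section \<open>Safe sequences and layers\<close>

definition walk :: "('a \<Rightarrow> 'a \<Rightarrow> bool) \<Rightarrow> 'a \<Rightarrow> 'a list \<Rightarrow> 'a \<Rightarrow> bool" where
  "walk E x p z \<longleftrightarrow> p \<noteq> [] \<and> hd p = x \<and> last p = z \<and> successively E p"

definition node_safe :: "('a \<Rightarrow> 'a \<Rightarrow> bool) \<Rightarrow> 'a \<Rightarrow> 'a \<Rightarrow> ('a \<Rightarrow> bool) \<Rightarrow> 'a list \<Rightarrow> bool" where
  "node_safe E s t vis w \<longleftrightarrow>
    (\<forall>x\<in>set w. vis x) \<and> (\<forall>p. walk E s p t \<longrightarrow> sublist w (filter vis p))"

definition node_maximal_safe ::
    "('a \<Rightarrow> 'a \<Rightarrow> bool) \<Rightarrow> 'a \<Rightarrow> 'a \<Rightarrow> ('a \<Rightarrow> bool) \<Rightarrow> 'a list \<Rightarrow> bool" where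
  "node_maximal_safe E s t vis w \<longleftrightarrow> node_safe E s t vis w \<and>
    (\<forall>x. \<not> node_safe E s t vis (x # w) \<and> \<not> node_safe E s t vis (w @ [x]))"

lemma walk_append:
  assumes "walk E x (x # p) y" "walk E y (y # q) z"
  shows "walk E x (x # p @ q) z"
proof -
  have "successively E ((x # p) @ q)"
    using assms unfolding walk_def successively_append_iff by (auto simp: successively_Cons)
  then show ?thesis using assms by (auto simp: walk_def)
qed

lemma walk_snoc: "walk E x (x # p) y \<Longrightarrow> E y z \<Longrightarrow> walk E x (x # p @ [z]) z"
  by (rule walk_append) (simp_all add: walk_def)

lemma walk_ConsI: "E z x \<Longrightarrow> walk E x (x # q) y \<Longrightarrow> walk E z (z # x # q) y"
  by (simp add: walk_def)

lemma walk_self: "walk E x [x] x"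
  by (simp add: walk_def)

lemma walk_to_rtranclp:
  assumes "walk E x p y"
  shows "E\<^sup>*\<^sup>* x y"
proof -
  have "successively E (x # q) \<Longrightarrow> E\<^sup>*\<^sup>* x (last (x # q))" for q
    by (induct q arbitrary: x) (auto intro: converse_rtranclp_into_rtranclp)
  then show ?thesis using assms unfolding walk_def by (metis list.collapse)
qed

lemma rtranclp_to_walk:
  assumes "(\<lambda>u v. E u v \<and> P v)\<^sup>*\<^sup>* x y"
  shows "\<exists>q. walk E x (x # q) y \<and> (\<forall>v\<in>set q. P v)"
  using assms
proof induct
  case base
  show ?case using walk_self by fastforce
next
  case (step y z)
  then obtain q where "walk E x (x # q) y" "\<forall>v\<in>set q. P v" by blast
  with step(2) show ?case by (intro exI[of _ "q @ [z]"]) (auto intro: walk_snoc)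
qed

lemma rtranclp_weaken: "R\<^sup>*\<^sup>* x y \<Longrightarrow> (\<And>u v. R u v \<Longrightarrow> R' u v) \<Longrightarrow> R'\<^sup>*\<^sup>* x y"
  by (metis mono_rtranclp)

lemma sublist_filter: "sublist u v \<Longrightarrow> sublist (filter P u) (filter P v)"
  unfolding sublist_def by (metis filter_append)

lemma sublist_unique_Cons:
  assumes "sublist (y # w) (us @ y # vs)" "y \<notin> set us" "y \<notin> set vs"
  shows "prefix w vs"
proof -
  from assms(1) obtain ps ss where eq: "us @ y # vs = ps @ (y # w) @ ss"
    by (auto simp: sublist_def)
  then have "us = ps \<and> vs = w @ ss"
    using assms(2,3) by (simp add: append_Cons_eq_iff)
  then show ?thesis by (simp add: prefix_def)
qed

lemma node_safe_sublist:
  assumes "node_safe E s t vis w" "sublist v w"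
  shows "node_safe E s t vis v"
  using assms unfolding node_safe_def
  by (meson set_mono_sublist sublist_order.order_trans subsetD)

locale layered =
  fixes E :: "nat \<Rightarrow> nat \<Rightarrow> bool" and s t :: nat and vis :: "nat \<Rightarrow> bool"
    and L Y :: "nat \<Rightarrow> nat" and K :: nat
  assumes K_pos: "1 \<le> K"
    and start: "L s = 1 \<or> (2 \<le> K \<and> L s = 2 \<and> Y 2 = s)"
    and step: "\<lbrakk>0 < L x; E x z\<rbrakk> \<Longrightarrow> 0 < L z \<and> (L z \<le> L x \<or> (L z = Suc (L x) \<and> z = Y (L z)))"
    and L_Y: "\<lbrakk>2 \<le> b; b \<le> K\<rbrakk> \<Longrightarrow> L (Y b) = b"
    and vis_Y: "\<lbrakk>2 \<le> b; b \<le> K\<rbrakk> \<Longrightarrow> vis (Y b)"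
    and direct: "0 < L x \<Longrightarrow>
      (\<lambda>u v. E u v \<and> L v = L x \<and> v \<noteq> (if L x = 1 then s else Y (L x)))\<^sup>*\<^sup>*
        (if L x = 1 then s else Y (L x)) x"
    and L_t: "L t = K"
    and enter: "\<lbrakk>2 \<le> b; b \<le> K\<rbrakk> \<Longrightarrow> (b = 2 \<and> Y 2 = s) \<or> (\<exists>u. L u = b - 1 \<and> E u (Y b))"
    and noncut: "\<lbrakk>vis x; \<forall>b. 2 \<le> b \<longrightarrow> b \<le> K \<longrightarrow> x \<noteq> Y b\<rbrakk> \<Longrightarrow>
      x \<noteq> s \<and> (\<lambda>u v. E u v \<and> v \<noteq> x)\<^sup>*\<^sup>* s t"
begin

definition isY :: "nat \<Rightarrow> bool" where
  "isY x \<longleftrightarrow> (\<exists>b. 2 \<le> b \<and> b \<le> K \<and> x = Y b)"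

definition Yseg :: "nat \<Rightarrow> nat \<Rightarrow> nat list" where
  "Yseg i j = map Y [i..<Suc j]"

inductive Tc :: "nat \<Rightarrow> nat \<Rightarrow> bool" for a where
  Tc_Y: "Tc a (Y a)"
| Tc_step: "Tc a x \<Longrightarrow> E z x \<Longrightarrow> L z = a - 1 \<Longrightarrow> z \<noteq> Y (a - 1) \<Longrightarrow> Tc a z"

lemma isY_iff: "isY x \<longleftrightarrow> 2 \<le> L x \<and> L x \<le> K \<and> x = Y (L x)"
  unfolding isY_def using L_Y by metis

lemma isY_Y: "2 \<le> b \<Longrightarrow> b \<le> K \<Longrightarrow> isY (Y b)"
  unfolding isY_def by blast

lemma isY_vis: "isY x \<Longrightarrow> vis x"
  unfolding isY_def using vis_Y by auto

lemma Y_inj: "\<lbrakk>2 \<le> a; a \<le> K; 2 \<le> b; b \<le> K; Y a = Y b\<rbrakk> \<Longrightarrow> a = b"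
  using L_Y by metis

lemma filter_isY_filter_vis: "filter isY (filter vis p) = filter isY p"
  by (induct p) (auto simp: isY_vis)

lemma Yseg_split: "i \<le> Suc j \<Longrightarrow> j \<le> l \<Longrightarrow> Yseg i j @ Yseg (Suc j) l = Yseg i l"
  unfolding Yseg_def map_append[symmetric] by (metis Suc_le_mono upt_add_eq_append le_Suc_ex)

lemma Yseg_Cons: "i \<le> j \<Longrightarrow> Yseg i j = Y i # Yseg (Suc i) j"
  by (simp add: Yseg_def upt_conv_Cons del: upt_Suc)

lemma Yseg_snoc: "i \<le> j \<Longrightarrow> 0 < j \<Longrightarrow> Yseg i j = Yseg i (j - 1) @ [Y j]"
  by (cases j) (simp_all add: Yseg_def)

lemma Yseg_self: "Yseg i i = [Y i]"
  by (simp add: Yseg_def)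

lemma Yseg_empty: "j < i \<Longrightarrow> Yseg i j = []"
  by (simp add: Yseg_def)

lemma set_Yseg: "set (Yseg i j) = Y ` {i..j}"
  by (auto simp: Yseg_def)

lemma length_Yseg: "length (Yseg i j) = Suc j - i"
  by (simp add: Yseg_def del: upt_Suc)

lemma Y_in_Yseg: "\<lbrakk>2 \<le> a; a \<le> K; 2 \<le> i; j \<le> K\<rbrakk> \<Longrightarrow> Y a \<in> set (Yseg i j) \<longleftrightarrow> i \<le> a \<and> a \<le> j"
  unfolding set_Yseg image_iff Bex_def atLeastAtMost_iff by (metis L_Y le_trans)

lemma filter_isY_Yseg: "2 \<le> i \<Longrightarrow> j \<le> K \<Longrightarrow> filter isY (Yseg i j) = Yseg i j"
  by (auto simp: filter_id_conv set_Yseg intro!: isY_Y)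

lemma direct_walk:
  assumes "2 \<le> L x"
  shows "\<exists>q. walk E (Y (L x)) (Y (L x) # q) x \<and> filter isY q = []"
proof -
  have "(\<lambda>u v. E u v \<and> L v = L x \<and> v \<noteq> Y (L x))\<^sup>*\<^sup>* (Y (L x)) x"
    using direct[of x] assms by simp
  from rtranclp_to_walk[OF this] obtain q where
    "walk E (Y (L x)) (Y (L x) # q) x" "\<forall>v\<in>set q. L v = L x \<and> v \<noteq> Y (L x)" by blast
  then show ?thesis by (metis (no_types, lifting) filter_False isY_iff)
qed

lemma direct_walk_start:
  assumes "L x = 1"
  shows "\<exists>q. walk E s (s # q) x \<and> filter isY q = []"
proof -
  have "(\<lambda>u v. E u v \<and> L v = 1 \<and> v \<noteq> s)\<^sup>*\<^sup>* s x"
    using direct[of x] assms by simp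
  from rtranclp_to_walk[OF this] obtain q where
    "walk E s (s # q) x" "\<forall>v\<in>set q. L v = 1 \<and> v \<noteq> s" by blast
  moreover from this have "filter isY q = []" by (auto simp: filter_empty_conv isY_iff)
  ultimately show ?thesis by blast
qed

lemma Tc_walk:
  assumes "Tc a x" "E z x" "2 \<le> a" "a \<le> K"
  shows "\<exists>q. walk E z (z # q) (Y a) \<and> filter isY q = [Y a]"
  using assms(1,2)
proof (induct arbitrary: z)
  case Tc_Y
  then show ?case using assms(3,4)
    by (intro exI[of _ "[Y a]"]) (simp add: walk_def isY_Y)
next
  case (Tc_step x y)
  then obtain q where "walk E y (y # q) (Y a)" "filter isY q = [Y a]" by blast
  moreover have "\<not> isY y" using Tc_step(4,5) by (auto simp: isY_iff)
  ultimately show ?case using Tc_step(6)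
    by (intro exI[of _ "y # q"]) (auto intro: walk_ConsI)
qed

lemma chain_walk:
  assumes "2 \<le> b" "b \<le> c" "c \<le> K"
  shows "\<exists>q. walk E (Y b) (Y b # q) (Y c) \<and> filter isY q = Yseg (Suc b) c"
  using assms(2,3)
proof (induct rule: dec_induct)
  case base
  show ?case by (intro exI[of _ "[]"]) (simp add: walk_self Yseg_empty)
next
  case (step c)
  then obtain q where q: "walk E (Y b) (Y b # q) (Y c)" "filter isY q = Yseg (Suc b) c" by auto
  obtain u where u: "L u = c" "E u (Y (Suc c))"
    using enter[of "Suc c"] step assms(1) by auto
  obtain q' where q': "walk E (Y c) (Y c # q') u" "filter isY q' = []"
    using direct_walk[of u] u step assms(1) by auto
  have "walk E (Y b) (Y b # (q @ q') @ [Y (Suc c)]) (Y (Suc c))"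
    by (rule walk_snoc[OF walk_append[OF q(1) q'(1)] u(2)])
  moreover have "filter isY ((q @ q') @ [Y (Suc c)]) = Yseg (Suc b) (Suc c)"
    using q q' step assms(1) by (simp add: isY_Y Yseg_snoc)
  ultimately show ?case by blast
qed

lemma suffix_walk:
  assumes "2 \<le> b" "b \<le> K"
  shows "\<exists>q. walk E (Y b) (Y b # q) t \<and> filter isY q = Yseg (Suc b) K"
proof -
  obtain q where q: "walk E (Y b) (Y b # q) (Y K)" "filter isY q = Yseg (Suc b) K"
    using chain_walk assms by blast
  obtain q' where q': "walk E (Y K) (Y K # q') t" "filter isY q' = []"
    using direct_walk[of t] assms L_t by auto
  show ?thesis using walk_append[OF q(1) q'(1)] q q' by (intro exI[of _ "q @ q'"]) simp
qed

lemma prefix_walk: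
  assumes "2 \<le> b" "b \<le> K"
  shows "\<exists>q. walk E s (s # q) (Y b) \<and> filter isY (s # q) = Yseg 2 b"
proof -
  have *: "\<exists>q. walk E s (s # q) (Y 2) \<and> filter isY (s # q) = [Y 2]"
  proof (cases "Y 2 = s")
    case True
    then show ?thesis using assms isY_Y[of 2] by (intro exI[of _ "[]"]) (auto simp: walk_self)
  next
    case False
    with enter[of 2] assms obtain u where u: "L u = 1" "E u (Y 2)" by auto
    obtain q where q: "walk E s (s # q) u" "filter isY q = []" using direct_walk_start[OF u(1)] by blast
    have "\<not> isY s" using start False by (auto simp: isY_iff)
    then show ?thesis using walk_snoc[OF q(1) u(2)] q assms
      by (intro exI[of _ "q @ [Y 2]"]) (auto simp: isY_Y)
  qed
  then obtain q where q: "walk E s (s # q) (Y 2)" "filter isY (s # q) = [Y 2]" by blast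
  obtain q' where q': "walk E (Y 2) (Y 2 # q') (Y b)" "filter isY q' = Yseg (Suc 2) b"
    using chain_walk[of 2 b] assms by auto
  have "filter isY (s # q @ q') = [Y 2] @ Yseg (Suc 2) b"
    using q(2) q'(2) by (simp split: if_splits)
  with walk_append[OF q(1) q'(1)] show ?thesis using assms
    by (intro exI[of _ "q @ q'"]) (simp add: Yseg_Cons[of 2])
qed

lemma main_walk: "\<exists>p. walk E s p t \<and> filter isY p = Yseg 2 K"
proof (cases "2 \<le> K")
  case True
  obtain q where q: "walk E s (s # q) (Y K)" "filter isY (s # q) = Yseg 2 K"
    using prefix_walk True by blast
  obtain q' where q': "walk E (Y K) (Y K # q') t" "filter isY q' = []"
    using direct_walk[of t] True L_t by auto
  have "filter isY (s # q @ q') = Yseg 2 K"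
    using q(2) q'(2) by (simp split: if_splits)
  with walk_append[OF q(1) q'(1)] show ?thesis by blast
next
  case False
  with K_pos L_t have K: "K = 1" "L t = 1" by auto
  obtain q where "walk E s (s # q) t" using direct_walk_start[OF K(2)] by blast
  moreover have "\<not> isY x" for x unfolding isY_def using K by linarith
  ultimately show ?thesis using K by (intro exI[of _ "s # q"]) (simp add: Yseg_empty)
qed

lemma node_safe_isY:
  assumes "node_safe E s t vis w" "x \<in> set w"
  shows "isY x"
proof (rule ccontr)
  assume "\<not> isY x"
  then have "\<forall>b. 2 \<le> b \<longrightarrow> b \<le> K \<longrightarrow> x \<noteq> Y b" by (auto simp: isY_def)
  moreover have "vis x" using assms by (auto simp: node_safe_def)
  ultimately have x: "x \<noteq> s" "(\<lambda>u v. E u v \<and> v \<noteq> x)\<^sup>*\<^sup>* s t" using noncut by blast+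
  from rtranclp_to_walk[OF x(2)] obtain q where "walk E s (s # q) t" "\<forall>v\<in>set q. v \<noteq> x" by blast
  with assms have "sublist w (filter vis (s # q))" by (auto simp: node_safe_def)
  with assms(2) have "x \<in> set (s # q)" by (metis filter_is_subset set_mono_sublist subsetD)
  with x(1) \<open>\<forall>v\<in>set q. v \<noteq> x\<close> show False by auto
qed

lemma node_safe_Yseg:
  assumes "node_safe E s t vis w" "w \<noteq> []"
  shows "\<exists>i j. 2 \<le> i \<and> i \<le> j \<and> j \<le> K \<and> w = Yseg i j"
proof -
  obtain p where p: "walk E s p t" "filter isY p = Yseg 2 K" using main_walk by blast
  with assms have "sublist w (filter vis p)" by (auto simp: node_safe_def)
  then have "sublist (filter isY w) (Yseg 2 K)"
    using p(2) sublist_filter filter_isY_filter_vis by metis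
  moreover have "filter isY w = w" using node_safe_isY[OF assms(1)] by (simp add: filter_id_conv)
  ultimately obtain us vs where "map Y [2..<Suc K] = us @ w @ vs"
    by (auto simp: sublist_def Yseg_def)
  note eq = this
  then have "w = map Y (take (length w) (drop (length us) [2..<Suc K]))"
    by (metis append_eq_conv_conj drop_map take_map)
  moreover have len: "length us + length w + length vs = Suc K - 2"
    using arg_cong[OF eq, of length] by (simp del: upt_Suc)
  moreover have "take (length w) (drop (length us) [2..<Suc K]) = [2 + length us ..< 2 + length us + length w]"
    if "w \<noteq> []" using len that by (cases w) (simp_all add: take_upt del: upt_Suc)
  ultimately have "w = map Y [2 + length us ..< 2 + length us + length w]"
    using assms(2) by metis
  with assms(2) len show ?thesis unfolding Yseg_def
    by (intro exI[of _ "2 + length us"] exI[of _ "1 + length us + length w"])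
      (cases w, auto simp del: upt_Suc)
qed

lemma pair_not_safe:
  assumes "3 \<le> a" "a \<le> K" "Tc a x" "E z x" "L z = a - 1" "z \<noteq> Y (a - 1)" "vis z"
  shows "\<not> node_safe E s t vis (Yseg (a - 1) a)"
proof
  assume safe: "node_safe E s t vis (Yseg (a - 1) a)"
  let ?y = "Y (a - 1)"
  obtain q0 where q0: "walk E s (s # q0) ?y" "filter isY (s # q0) = Yseg 2 (a - 1)"
    using prefix_walk[of "a - 1"] assms(1,2) by force
  have "2 \<le> L z" using assms by simp
  then obtain q1 where q1: "walk E ?y (?y # q1) z" "filter isY q1 = []"
    using direct_walk[of z] unfolding assms(5) by blast
  obtain q2 where q2: "walk E z (z # q2) (Y a)" "filter isY q2 = [Y a]"
    using Tc_walk assms by force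
  obtain q3 where q3: "walk E (Y a) (Y a # q3) t" "filter isY q3 = Yseg (Suc a) K"
    using suffix_walk[of a] assms by auto
  have w: "walk E s (s # ((q0 @ q1) @ q2) @ q3) t"
    by (rule walk_append[OF walk_append[OF walk_append[OF q0(1) q1(1)] q2(1)] q3(1)])
  obtain us where us: "s # q0 = us @ [?y]"
    using q0(1) unfolding walk_def by (metis append_butlast_last_id)
  have isY: "isY ?y" using assms by (intro isY_Y) auto
  have "Yseg 2 (a - 1) = Yseg 2 (a - 2) @ [?y]"
    using Yseg_snoc[of 2 "a - 1"] assms(1) by (simp add: numeral_2_eq_2)
  then have fus: "filter isY us = Yseg 2 (a - 2)" using q0(2) us isY by simp
  have nus: "?y \<notin> set us"
  proof
    assume "?y \<in> set us"
    then have "?y \<in> set (Yseg 2 (a - 2))" using isY by (subst fus[symmetric]) simp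
    moreover have "2 \<le> a - 1" "a - 1 \<le> K" "a - 2 \<le> K" "\<not> a - 1 \<le> a - 2" using assms(1,2) by auto
    ultimately show False using Y_in_Yseg[of "a - 1" 2 "a - 2"] by blast
  qed
  have n1: "?y \<notin> set q1" using q1(2) isY by (auto simp: filter_empty_conv)
  have n2: "?y \<notin> set q2"
  proof
    assume "?y \<in> set q2"
    then have "?y \<in> set [Y a]" using isY by (subst q2(2)[symmetric]) simp
    moreover have "2 \<le> a - 1" "a - 1 \<le> K" "2 \<le> a" "a - 1 \<noteq> a" using assms(1,2) by auto
    ultimately show False using assms(2) Y_inj[of "a - 1" a] by (metis empty_set set_ConsD empty_iff)
  qed
  have n3: "?y \<notin> set q3"
  proof
    assume "?y \<in> set q3"
    then have "?y \<in> set (Yseg (Suc a) K)" using isY by (subst q3(2)[symmetric]) simp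
    moreover have "2 \<le> a - 1" "a - 1 \<le> K" "2 \<le> Suc a" "\<not> Suc a \<le> a - 1" using assms(1,2) by auto
    ultimately show False using Y_in_Yseg[of "a - 1" "Suc a" K] by blast
  qed
  have "sublist (Yseg (a - 1) a) (filter vis (s # ((q0 @ q1) @ q2) @ q3))"
    using safe w unfolding node_safe_def by blast
  moreover have "Yseg (a - 1) a = [?y, Y a]"
    using assms Yseg_Cons[of "a - 1" a] by (simp add: Yseg_self)
  moreover have "s # ((q0 @ q1) @ q2) @ q3 = us @ ?y # q1 @ q2 @ q3" using us by simp
  ultimately have "sublist (?y # [Y a]) (filter vis (us @ ?y # q1 @ q2 @ q3))"
    by metis
  then have "sublist (?y # [Y a]) (filter vis us @ ?y # filter vis (q1 @ q2 @ q3))"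
    using isY_vis[OF isY] by simp
  then have "prefix [Y a] (filter vis (q1 @ q2 @ q3))"
    by (rule sublist_unique_Cons) (use nus n1 n2 n3 in auto)
  moreover have "q1 \<noteq> []" using q1(1) assms(6) by (auto simp: walk_def)
  then have "z \<in> set (filter vis q1)" using q1(1) assms(7) by (auto simp: walk_def)
  ultimately have "Y a \<in> set q1"
    by (cases "filter vis q1") (auto dest!: filter_eq_ConsD)
  moreover have "isY (Y a)" using assms by (intro isY_Y) auto
  ultimately show False using q1(2) by (auto simp: filter_empty_conv)
qed

lemma back_not_safe:
  assumes "3 \<le> a" "a \<le> L z" "L z < K" "Tc a x" "E z x"
  shows "\<not> node_safe E s t vis (Yseg (a - 1) (Suc (L z)))"
proof
  define b where "b = L z"
  assume safe: "node_safe E s t vis (Yseg (a - 1) (Suc (L z)))"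
  obtain q0 where q0: "walk E s (s # q0) (Y b)" "filter isY (s # q0) = Yseg 2 b"
    using prefix_walk[of b] assms b_def by auto
  obtain q1 where q1: "walk E (Y b) (Y b # q1) z" "filter isY q1 = []"
    using direct_walk[of z] assms b_def by auto
  obtain q2 where q2: "walk E z (z # q2) (Y a)" "filter isY q2 = [Y a]"
    using Tc_walk[OF assms(4,5)] assms by force
  obtain q3 where q3: "walk E (Y a) (Y a # q3) t" "filter isY q3 = Yseg (Suc a) K"
    using suffix_walk[of a] assms by auto
  have w: "walk E s (s # ((q0 @ q1) @ q2) @ q3) t"
    by (rule walk_append[OF walk_append[OF walk_append[OF q0(1) q1(1)] q2(1)] q3(1)])
  have "filter isY (s # ((q0 @ q1) @ q2) @ q3) = filter isY (s # q0) @ filter isY q1 @ filter isY q2 @ filter isY q3"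
    by simp
  also have "\<dots> = Yseg 2 b @ Y a # Yseg (Suc a) K"
    unfolding q0(2) q1(2) q2(2) q3(2) by simp
  also have "\<dots> = Yseg 2 (a - 2) @ Y (a - 1) # Yseg a b @ Yseg a K"
    using assms b_def Yseg_split[of 2 "a - 2" b] Yseg_Cons[of "a - 1" b] Yseg_Cons[of a K]
    by (simp add: Suc_diff_Suc numeral_2_eq_2 numeral_3_eq_3)
  finally have "filter isY (s # ((q0 @ q1) @ q2) @ q3) = Yseg 2 (a - 2) @ Y (a - 1) # Yseg a b @ Yseg a K" .
  moreover have "sublist (Yseg (a - 1) (Suc b)) (filter vis (s # ((q0 @ q1) @ q2) @ q3))"
    using safe w b_def unfolding node_safe_def by blast
  then have "sublist (filter isY (Yseg (a - 1) (Suc b))) (filter isY (filter vis (s # ((q0 @ q1) @ q2) @ q3)))"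
    by (rule sublist_filter)
  moreover have "filter isY (Yseg (a - 1) (Suc b)) = Y (a - 1) # Yseg a (Suc b)"
    using filter_isY_Yseg[of "a - 1" "Suc b"] Yseg_Cons[of "a - 1" "Suc b"] assms b_def by auto
  ultimately have "sublist (Y (a - 1) # Yseg a (Suc b)) (Yseg 2 (a - 2) @ Y (a - 1) # Yseg a b @ Yseg a K)"
    unfolding filter_isY_filter_vis by metis
  then have "prefix (Yseg a (Suc b)) (Yseg a b @ Yseg a K)"
    by (rule sublist_unique_Cons) (use assms b_def in \<open>auto simp: Y_in_Yseg\<close>)
  then have "prefix (Yseg a b @ [Y (Suc b)]) (Yseg a b @ Yseg a K)"
    using Yseg_snoc[of a "Suc b"] assms b_def by simp
  then have "prefix [Y (Suc b)] (Y a # Yseg (Suc a) K)"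
    using Yseg_Cons[of a K] assms b_def by simp
  then have "Y (Suc b) = Y a" by simp
  then show False using Y_inj[of "Suc b" a] assms b_def by auto
qed

lemma Tc_L: "Tc a x \<Longrightarrow> 2 \<le> a \<Longrightarrow> a \<le> K \<Longrightarrow> x = Y a \<and> L x = a \<or> L x = a - 1 \<and> x \<noteq> Y (a - 1)"
  by (induct rule: Tc.induct) (auto simp: L_Y)

lemma Tc_pred_L:
  assumes "Tc a x" "3 \<le> a" "a \<le> K" "E z x" "0 < L z"
  shows "a - 1 \<le> L z"
  using Tc_L[OF assms(1)] step[OF assms(5,4)] assms by auto

lemma walk_below:
  assumes "successively E u" "u \<noteq> []" "hd u = s" "2 \<le> j" "Y j \<notin> set u" "z \<in> set u" "j \<le> K"
  shows "0 < L z \<and> L z < j"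
  using assms(1-3,5,6)
proof (induct u arbitrary: z rule: rev_induct)
  case (snoc y u)
  show ?case
  proof (cases "u = []")
    case True
    with snoc start assms show ?thesis by (auto simp: le_less)
  next
    case False
    with snoc have u: "successively E u" "hd u = s" "Y j \<notin> set u" "E (last u) y"
      by (auto simp: successively_append_iff)
    with snoc False have IH: "x \<in> set u \<Longrightarrow> 0 < L x \<and> L x < j" for x by blast
    then have "0 < L (last u)" "L (last u) < j" using False by auto
    with step[OF _ u(4)] snoc(5) have "0 < L y" "L y < j"
      by (auto) (metis Suc_lessI)
    with IH snoc show ?thesis by auto
  qed
qed simp

lemma walk_Y:
  assumes "walk E s p t" "2 \<le> j" "j \<le> K"
  shows "Y j \<in> set p"
proof (rule ccontr)
  assume "Y j \<notin> set p"
  then have "L t < j" using walk_below[of p j t] assms by (auto simp: walk_def)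
  with L_t assms show False by simp
qed

end

locale layered_limits = layered +
  fixes r :: "nat \<Rightarrow> nat"
  assumes r_K: "r K = K"
    and r_step: "\<lbrakk>2 \<le> b; b < K\<rbrakk> \<Longrightarrow> r b \<le> r (Suc b)"
    and r_le: "\<lbrakk>2 \<le> b; b < K; Tc (Suc b) x; E z x; 0 < L z; z \<noteq> Y b; b < L z \<or> vis z\<rbrakk> \<Longrightarrow> r b \<le> L z"
    and r_ex: "\<lbrakk>2 \<le> b; b < K\<rbrakk> \<Longrightarrow> r b = r (Suc b) \<or>
      (\<exists>x z. Tc (Suc b) x \<and> E z x \<and> 0 < L z \<and> z \<noteq> Y b \<and> (b < L z \<or> vis z) \<and> r b = L z)"
begin

lemma r_mono:
  assumes "2 \<le> a" "a \<le> b" "b \<le> K"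
  shows "r a \<le> r b"
  using assms(2,3)
proof (induct rule: dec_induct)
  case (step n)
  then show ?case using r_step[of n] assms(1) by auto
qed simp

lemma r_witness:
  assumes "2 \<le> i" "i \<le> K"
  shows "r i = K \<or> (\<exists>a x z. i < a \<and> a \<le> K \<and> Tc a x \<and> E z x \<and> 0 < L z \<and> z \<noteq> Y (a - 1) \<and>
    (a \<le> L z \<or> vis z) \<and> r i = L z)"
  using assms(2,1)
proof (induct rule: inc_induct)
  case base
  then show ?case using r_K by simp
next
  case (step b)
  from r_ex[of b] step have "r b = r (Suc b) \<or>
    (\<exists>x z. Tc (Suc b) x \<and> E z x \<and> 0 < L z \<and> z \<noteq> Y b \<and> (b < L z \<or> vis z) \<and> r b = L z)" by auto
  then show ?case
  proof
    assume "r b = r (Suc b)"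
    with step show ?thesis by (metis Suc_lessD le_SucI)
  next
    assume "\<exists>x z. Tc (Suc b) x \<and> E z x \<and> 0 < L z \<and> z \<noteq> Y b \<and> (b < L z \<or> vis z) \<and> r b = L z"
    then show ?thesis using step(1,2) by (metis Suc_le_eq diff_Suc_1 lessI le_imp_less_Suc)
  qed
qed

lemma r_bounds:
  assumes "2 \<le> i" "i \<le> K"
  shows "i \<le> r i" "r i \<le> K"
proof -
  show "i \<le> r i" using r_witness[OF assms] Tc_pred_L assms by force
  show "r i \<le> K" using r_mono[of i K] assms r_K by simp
qed

text \<open>
  The walk is read backwards from the first visit of \<open>Y j\<close>: the limits force every node met in
  layer \<open>a - 1\<close> to be invisible until \<open>Y (a - 1)\<close> itself appears.
\<close>

lemma read_backwards:
  assumes "2 \<le> i" "j \<le> r i" "j \<le> K"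
  shows "\<lbrakk>i < a; a \<le> j; Tc a x; successively E (u @ [x]); hd (u @ [x]) = s;
      \<forall>z\<in>set u. 0 < L z \<and> L z < j\<rbrakk> \<Longrightarrow> \<exists>vs. filter vis u = vs @ Yseg i (a - 1)"
proof (induct u arbitrary: a x rule: rev_induct)
  case Nil
  then have "Tc a s" "3 \<le> a" "a \<le> K" using assms by auto
  then have "s = Y a \<and> L s = a \<or> L s = a - 1 \<and> s \<noteq> Y (a - 1)" using Tc_L by simp
  moreover from this have "2 \<le> L s" using \<open>3 \<le> a\<close> by linarith
  with start have "L s = 2" "Y 2 = s" by auto
  ultimately have False using \<open>3 \<le> a\<close> by auto
  then show ?case ..
next
  case (snoc z u)
  have a: "3 \<le> a" "a \<le> K" using snoc assms by auto
  have z: "0 < L z" "L z < j" "E z x" "successively E (u @ [z])" "hd (u @ [z]) = s"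
    using snoc by (auto simp: successively_append_iff hd_append)
  have "a - 1 \<le> L z" using Tc_pred_L[OF snoc(4) a z(3,1)] .
  have "r i \<le> r (a - 1)" using r_mono[of i "a - 1"] snoc assms by auto
  then have "L z < r (a - 1)" using assms z by simp
  moreover have "2 \<le> a - 1" "a - 1 < K" "Suc (a - 1) = a" using a by auto
  ultimately have "z = Y (a - 1) \<or> (z \<noteq> Y (a - 1) \<and> L z \<le> a - 1 \<and> \<not> vis z)"
    using r_le[of "a - 1" x z] snoc(4) z(1,3) by (metis not_le)
  then show ?case
  proof
    assume zY: "z = Y (a - 1)"
    then have v: "vis z" using vis_Y a by auto
    show ?case
    proof (cases "a - 1 = i")
      case True
      then show ?thesis using v zY by (auto simp: Yseg_self)
    next
      case False
      have "\<exists>vs. filter vis u = vs @ Yseg i (a - 1 - 1)"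
        by (rule snoc(1)[of "a - 1" z]) (use False snoc z zY Tc_Y in auto)
      then show ?thesis using v zY snoc(2) False Yseg_snoc[of i "a - 1"] by auto
    qed
  next
    assume *: "z \<noteq> Y (a - 1) \<and> L z \<le> a - 1 \<and> \<not> vis z"
    then have "Tc a z" using Tc_step[OF snoc(4) z(3)] \<open>a - 1 \<le> L z\<close> by auto
    then have "\<exists>vs. filter vis u = vs @ Yseg i (a - 1)"
      by (intro snoc(1)[of a z]) (use snoc z in auto)
    with * show ?case by simp
  qed
qed

lemma Yseg_safe:
  assumes "2 \<le> i" "i \<le> j" "j \<le> r i" "j \<le> K"
  shows "node_safe E s t vis (Yseg i j)"
  unfolding node_safe_def
proof (intro conjI allI impI ballI)
  show "vis x" if "x \<in> set (Yseg i j)" for x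
    using that assms vis_Y by (auto simp: set_Yseg)
  fix p assume p: "walk E s p t"
  have "Y j \<in> set p" using walk_Y p assms by auto
  then obtain u v where uv: "p = u @ Y j # v" "Y j \<notin> set u" by (meson split_list_first)
  have suc: "successively E (u @ [Y j])"
    using p uv by (auto simp: walk_def successively_append_iff)
  have hd: "hd (u @ [Y j]) = s" using p uv by (cases u) (auto simp: walk_def)
  have v: "vis (Y j)" using vis_Y assms by auto
  show "sublist (Yseg i j) (filter vis p)"
  proof (cases "i = j")
    case True
    then show ?thesis using uv v by (auto simp: Yseg_self sublist_def)
  next
    case False
    have "\<forall>z\<in>set u. 0 < L z \<and> L z < j"
    proof (cases "u = []")
      case False
      then show ?thesis using walk_below[of u j] suc hd uv(2) assms
        by (auto simp: successively_append_iff)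
    qed simp
    then obtain vs where "filter vis u = vs @ Yseg i (j - 1)"
      using read_backwards[of i j j "Y j" u] assms False suc hd Tc_Y by auto
    then have "filter vis p = vs @ Yseg i j @ filter vis v"
      using uv v Yseg_snoc[of i j] assms by simp
    then show ?thesis by (auto simp: sublist_def)
  qed
qed

lemma Yseg_sublist: "\<lbrakk>i \<le> i'; i' \<le> j'; j' \<le> j\<rbrakk> \<Longrightarrow> sublist (Yseg i' j') (Yseg i j)"
proof -
  assume *: "i \<le> i'" "i' \<le> j'" "j' \<le> j"
  have "[i..<Suc j] = [i..<i'] @ [i'..<Suc j'] @ [Suc j'..<Suc j]"
    using * upt_add_eq_append[of i i' "Suc j - i'"] upt_add_eq_append[of i' "Suc j'" "j - j'"]
    by (simp del: upt_Suc)
  then show ?thesis unfolding Yseg_def sublist_def by (metis map_append)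
qed

lemma Yseg_not_safe:
  assumes "2 \<le> i" "i \<le> j" "r i < j" "j \<le> K"
  shows "\<not> node_safe E s t vis (Yseg i j)"
proof
  assume safe: "node_safe E s t vis (Yseg i j)"
  from r_witness[of i] assms obtain a x z where *: "i < a" "a \<le> K" "Tc a x" "E z x" "0 < L z"
    "z \<noteq> Y (a - 1)" "a \<le> L z \<or> vis z" "r i = L z" by auto
  have a: "3 \<le> a" using * assms by simp
  have ge: "a - 1 \<le> L z" using Tc_pred_L * a by blast
  show False
  proof (cases "a \<le> L z")
    case True
    have "node_safe E s t vis (Yseg (a - 1) (Suc (L z)))"
      by (rule node_safe_sublist[OF safe Yseg_sublist]) (use * assms True in auto)
    moreover have "L z < K" using *(8) assms(3,4) by simp
    ultimately show False using back_not_safe[OF a True _ *(3,4)] by blast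
  next
    case False
    have "node_safe E s t vis (Yseg (a - 1) a)"
      by (rule node_safe_sublist[OF safe Yseg_sublist]) (use * assms False ge in auto)
    moreover have "L z = a - 1" "vis z" using False ge *(7) by auto
    ultimately show False using pair_not_safe[OF a *(2-4) _ *(6)] by blast
  qed
qed

lemma node_safe_iff:
  "node_safe E s t vis w \<longleftrightarrow>
    w = [] \<or> (\<exists>i j. 2 \<le> i \<and> i \<le> j \<and> j \<le> r i \<and> i \<le> K \<and> w = Yseg i j)"
proof
  assume safe: "node_safe E s t vis w"
  show "w = [] \<or> (\<exists>i j. 2 \<le> i \<and> i \<le> j \<and> j \<le> r i \<and> i \<le> K \<and> w = Yseg i j)"
  proof (cases "w = []")
    case False
    then obtain i j where ij: "2 \<le> i" "i \<le> j" "j \<le> K" "w = Yseg i j"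
      using node_safe_Yseg[OF safe] by blast
    then have "j \<le> r i" using Yseg_not_safe[of i j] safe by fastforce
    then show ?thesis using ij le_trans by blast
  qed simp
next
  assume *: "w = [] \<or> (\<exists>i j. 2 \<le> i \<and> i \<le> j \<and> j \<le> r i \<and> i \<le> K \<and> w = Yseg i j)"
  show "node_safe E s t vis w"
  proof (cases "w = []")
    case True
    then show ?thesis by (simp add: node_safe_def)
  next
    case False
    with * obtain i j where ij: "2 \<le> i" "i \<le> j" "j \<le> r i" "i \<le> K" "w = Yseg i j" by blast
    then have "j \<le> K" using r_bounds(2)[of i] by simp
    then show ?thesis using Yseg_safe[of i j] ij by simp
  qed
qed

lemma Yseg_eq:
  assumes "2 \<le> i" "i \<le> j" "j \<le> K" "2 \<le> i'" "i' \<le> j'" "j' \<le> K" "Yseg i j = Yseg i' j'"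
  shows "i = i'" "j = j'"
proof -
  have "Y i = Y i'" using assms(7) Yseg_Cons[OF assms(2)] Yseg_Cons[OF assms(5)] by simp
  then show "i = i'" using Y_inj assms by auto
  with assms(2,5) arg_cong[OF assms(7), of length] show "j = j'" by (simp add: length_Yseg)
qed

lemma node_maximal_safe_iff:
  "node_maximal_safe E s t vis w \<longleftrightarrow> (if K = 1 then w = [] else
     (\<exists>i. 2 \<le> i \<and> i \<le> K \<and> (i = 2 \<or> r (i - 1) < r i) \<and> w = Yseg i (r i)))"
proof (cases "K = 1")
  case True
  then show ?thesis unfolding node_maximal_safe_def node_safe_iff by auto
next
  case False
  with K_pos have K: "2 \<le> K" by simp
  have "node_maximal_safe E s t vis w \<longleftrightarrow>
     (\<exists>i. 2 \<le> i \<and> i \<le> K \<and> (i = 2 \<or> r (i - 1) < r i) \<and> w = Yseg i (r i))"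
  proof
    assume max: "node_maximal_safe E s t vis w"
    have "w \<noteq> []"
    proof
      assume "w = []"
      then have "\<not> node_safe E s t vis (Yseg 2 2)"
        using max by (simp add: node_maximal_safe_def Yseg_self)
      then show False using Yseg_safe[of 2 2] r_bounds[of 2] K by auto
    qed
    then obtain i j where ij: "2 \<le> i" "i \<le> j" "j \<le> r i" "i \<le> K" "w = Yseg i j"
      using max unfolding node_maximal_safe_def node_safe_iff by blast
    have "j = r i"
    proof (rule ccontr)
      assume "j \<noteq> r i"
      then have "node_safe E s t vis (Yseg i (Suc j))"
        using Yseg_safe[of i "Suc j"] ij(1-4) r_bounds[of i] by simp
      moreover have "Yseg i (Suc j) = w @ [Y (Suc j)]" using ij(2,5) by (simp add: Yseg_def)
      ultimately show False using max by (simp add: node_maximal_safe_def)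
    qed
    moreover have "i = 2 \<or> r (i - 1) < r i"
    proof (rule ccontr)
      assume *: "\<not> (i = 2 \<or> r (i - 1) < r i)"
      have "node_safe E s t vis (Yseg (i - 1) j)"
        by (rule Yseg_safe) (use * ij(1-4) r_bounds[of i] in auto)
      moreover have "Yseg (i - 1) j = Y (i - 1) # w" using ij(1,2,5) Yseg_Cons[of "i - 1" j] by simp
      ultimately show False using max by (simp add: node_maximal_safe_def)
    qed
    ultimately show "\<exists>i. 2 \<le> i \<and> i \<le> K \<and> (i = 2 \<or> r (i - 1) < r i) \<and> w = Yseg i (r i)"
      using ij by blast
  next
    assume "\<exists>i. 2 \<le> i \<and> i \<le> K \<and> (i = 2 \<or> r (i - 1) < r i) \<and> w = Yseg i (r i)"
    then obtain i where i: "2 \<le> i" "i \<le> K" "i = 2 \<or> r (i - 1) < r i" "w = Yseg i (r i)" by blast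
    note ri = r_bounds[OF i(1,2)]
    have cons: "\<not> node_safe E s t vis (x # w)" for x
    proof
      assume *: "node_safe E s t vis (x # w)"
      from node_safe_Yseg[OF this] obtain a b where ab: "2 \<le> a" "a \<le> b" "b \<le> K" "x # w = Yseg a b"
        by auto
      have "w = Yseg (Suc a) b" using ab Yseg_Cons[of a b] by simp
      moreover have "Suc a \<le> b" using arg_cong[OF calculation, of length] i ri by (simp add: length_Yseg)
      ultimately have "Suc a = i" "b = r i"
        using Yseg_eq[of "Suc a" b i "r i"] i(1,4) ri ab(1,3) by (metis le_SucI)+
      then have "r a < b" using i ab by auto
      then show False using Yseg_not_safe[of a b] ab * by simp
    qed
    have snoc: "\<not> node_safe E s t vis (w @ [x])" for x
    proof
      assume *: "node_safe E s t vis (w @ [x])"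
      from node_safe_Yseg[OF this] obtain a b where ab: "2 \<le> a" "a \<le> b" "b \<le> K" "w @ [x] = Yseg a b"
        by auto
      have "w = Yseg a (b - 1)" using ab Yseg_snoc[of a b] by simp
      moreover have "a \<le> b - 1" using arg_cong[OF calculation, of length] i ri by (simp add: length_Yseg)
      ultimately have "a = i" "b - 1 = r i"
        using Yseg_eq[of a "b - 1" i "r i"] i(1,4) ri ab(1,3) by (metis diff_le_self le_trans)+
      then show False using Yseg_not_safe[of a b] ab * by simp
    qed
    show "node_maximal_safe E s t vis w"
      unfolding node_maximal_safe_def using cons snoc Yseg_safe[of i "r i"] i ri by auto
  qed
  with False show ?thesis by simp
qed

end

section \<open>Search in arrays\<close>

text \<open>
  The arcs \<open>e\<close> with \<open>A e = v\<close> form a linked list with decreasing arc numbers, from \<open>f v\<close> along \<open>nx\<close>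
  to the end marker 0.
\<close>

definition arc_lists :: "(nat \<Rightarrow> nat) \<Rightarrow> (nat \<Rightarrow> nat) \<Rightarrow> (nat \<Rightarrow> nat) \<Rightarrow> nat \<Rightarrow> bool" where
  "arc_lists A f nx m \<longleftrightarrow>
    (\<forall>v. f v \<le> m \<and> (f v \<noteq> 0 \<longrightarrow> A (f v) = v) \<and> (\<forall>e. 1 \<le> e \<longrightarrow> e \<le> m \<longrightarrow> A e = v \<longrightarrow> e \<le> f v)) \<and>
    (\<forall>e. 1 \<le> e \<longrightarrow> e \<le> m \<longrightarrow> nx e < e \<and> (nx e \<noteq> 0 \<longrightarrow> A (nx e) = A e) \<and>
       (\<forall>e'. 1 \<le> e' \<longrightarrow> e' < e \<longrightarrow> A e' = A e \<longrightarrow> e' \<le> nx e))"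

lemma arc_lists_0: "arc_lists A (\<lambda>_. 0) nx 0"
  by (simp add: arc_lists_def)

lemma arc_lists_Suc:
  assumes "arc_lists A f nx m"
  shows "arc_lists (A(Suc m := v)) (f(v := Suc m)) (nx(Suc m := f v)) (Suc m)"
proof -
  have f: "f u \<le> m" "f u \<noteq> 0 \<Longrightarrow> A (f u) = u" "\<And>e. 1 \<le> e \<Longrightarrow> e \<le> m \<Longrightarrow> A e = u \<Longrightarrow> e \<le> f u" for u
    using assms unfolding arc_lists_def by blast+
  have nx: "nx e < e \<and> (nx e \<noteq> 0 \<longrightarrow> A (nx e) = A e) \<and>
       (\<forall>e'. 1 \<le> e' \<longrightarrow> e' < e \<longrightarrow> A e' = A e \<longrightarrow> e' \<le> nx e)" if "1 \<le> e" "e \<le> m" for e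
    using assms that unfolding arc_lists_def by blast
  have ne: "f u \<noteq> Suc m" for u using f(1)[of u] by auto
  show ?thesis unfolding arc_lists_def
  proof (intro conjI allI impI, goal_cases)
    case (4 e)
    then show ?case using f(1)[of v] nx[of e] by (cases "e = Suc m") auto
  next
    case (5 e)
    then show ?case using ne nx[of e] by (cases "e = Suc m") (auto simp: f(2))
  next
    case (6 e e')
    then show ?case using f(3)[of e' v] nx[of e] by (cases "e = Suc m") auto
  qed (use f ne in \<open>auto simp: le_Suc_eq split: if_splits\<close>)
qed

text \<open>
  A queue \<open>Q\<close> with head \<open>h\<close> and tail \<open>l\<close> that is never overwritten, so that it also lists all nodes
  found. The last node taken out is \<open>Q (h - 1)\<close>, and \<open>e\<close> is its next arc to be scanned (0 if none);
  as arc lists are decreasing, exactly its arcs above \<open>e\<close> have been scanned.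
\<close>

definition queue_ok :: "(nat \<Rightarrow> nat) \<Rightarrow> nat \<Rightarrow> nat \<Rightarrow> (nat \<Rightarrow> nat) \<Rightarrow> nat \<Rightarrow> nat \<Rightarrow> nat \<Rightarrow> bool" where
  "queue_ok A N m Q h l e \<longleftrightarrow> inj_on Q {..<l} \<and> (\<forall>j<l. Q j < N) \<and> h \<le> l \<and> e \<le> m \<and>
    (e \<noteq> 0 \<longrightarrow> 0 < h \<and> A e = Q (h - 1))"

definition scanned :: "(nat \<Rightarrow> nat) \<Rightarrow> nat \<Rightarrow> (nat \<Rightarrow> nat) \<Rightarrow> nat \<Rightarrow> nat \<Rightarrow> nat set" where
  "scanned A m Q h e = {e'. 1 \<le> e' \<and> e' \<le> m \<and> (\<exists>j<h. Q j = A e' \<and> (Suc j = h \<longrightarrow> e < e'))}"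

definition unscanned :: "(nat \<Rightarrow> nat) \<Rightarrow> nat \<Rightarrow> (nat \<Rightarrow> nat) \<Rightarrow> nat \<Rightarrow> nat \<Rightarrow> nat" where
  "unscanned A m Q h e = m - card (scanned A m Q h e)"

lemma queue_le:
  assumes "queue_ok A N m Q h l e"
  shows "h \<le> N" "l \<le> N" "h \<le> l"
proof -
  have "Q ` {..<l} \<subseteq> {..<N}" "inj_on Q {..<l}" using assms by (auto simp: queue_ok_def)
  then show "l \<le> N" by (metis card_image card_lessThan card_mono finite_lessThan)
  then show "h \<le> N" "h \<le> l" using assms by (auto simp: queue_ok_def)
qed

lemma queue_pop:
  assumes "queue_ok A N m Q h l 0" "h < l" "arc_lists A f nx m"
  shows "queue_ok A N m Q (Suc h) l (f (Q h))" "scanned A m Q (Suc h) (f (Q h)) = scanned A m Q h 0"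
proof -
  show "queue_ok A N m Q (Suc h) l (f (Q h))"
    using assms by (auto simp: queue_ok_def arc_lists_def)
  show "scanned A m Q (Suc h) (f (Q h)) = scanned A m Q h 0"
    unfolding scanned_def
  proof (intro Collect_cong conj_cong refl iffI)
    fix e' assume *: "1 \<le> e'" "e' \<le> m" "\<exists>j<Suc h. Q j = A e' \<and> (Suc j = Suc h \<longrightarrow> f (Q h) < e')"
    then obtain j where j: "j < Suc h" "Q j = A e'" "Suc j = Suc h \<longrightarrow> f (Q h) < e'" by blast
    have "j \<noteq> h" using j * assms(3) unfolding arc_lists_def by (metis not_le)
    with j * show "\<exists>j<h. Q j = A e' \<and> (Suc j = h \<longrightarrow> 0 < e')" by (auto simp: less_Suc_eq)
  qed (auto simp: less_Suc_eq)
qed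

lemma queue_scan:
  assumes "queue_ok A N m Q h l e" "e \<noteq> 0" "arc_lists A f nx m"
  shows "queue_ok A N m Q h l (nx e)" "scanned A m Q h (nx e) = insert e (scanned A m Q h e)"
    "e \<notin> scanned A m Q h e"
proof -
  have e: "1 \<le> e" "e \<le> m" "0 < h" "A e = Q (h - 1)" "h \<le> l" using assms by (auto simp: queue_ok_def)
  have nx: "nx e < e" "nx e \<noteq> 0 \<Longrightarrow> A (nx e) = A e"
    "\<And>e'. 1 \<le> e' \<Longrightarrow> e' < e \<Longrightarrow> A e' = A e \<Longrightarrow> e' \<le> nx e"
    using assms(3) e unfolding arc_lists_def by metis+
  show "queue_ok A N m Q h l (nx e)" using assms(1) e nx(1,2) by (auto simp: queue_ok_def)
  show "scanned A m Q h (nx e) = insert e (scanned A m Q h e)"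
  proof (intro set_eqI iffI)
    fix e' assume "e' \<in> scanned A m Q h (nx e)"
    then obtain j where j: "1 \<le> e'" "e' \<le> m" "j < h" "Q j = A e'" "Suc j = h \<longrightarrow> nx e < e'"
      by (auto simp: scanned_def)
    have "Suc j = h \<Longrightarrow> e \<le> e'" using nx(3)[of e'] j e by (metis diff_Suc_1 not_le)
    then show "e' \<in> insert e (scanned A m Q h e)" using j by (fastforce simp: scanned_def)
  next
    fix e' assume "e' \<in> insert e (scanned A m Q h e)"
    then show "e' \<in> scanned A m Q h (nx e)"
    proof
      assume "e' = e"
      then show ?thesis using e nx(1) unfolding scanned_def
        by (auto intro!: exI[of _ "h - 1"])
    next
      assume "e' \<in> scanned A m Q h e"
      then show ?thesis using nx(1) unfolding scanned_def by (auto intro: less_trans)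
    qed
  qed
  show "e \<notin> scanned A m Q h e"
  proof
    assume "e \<in> scanned A m Q h e"
    then obtain j where j: "j < h" "Q j = Q (h - 1)" "Suc j \<noteq> h" using e by (auto simp: scanned_def)
    then have "j = h - 1" using assms(1) e unfolding queue_ok_def inj_on_def
      by (metis diff_less lessThan_iff less_le_trans zero_less_one)
    with j e show False by simp
  qed
qed

lemma queue_push:
  assumes "queue_ok A N m Q h l e" "x < N" "x \<notin> Q ` {..<l}"
  shows "queue_ok A N m (Q(l := x)) h (Suc l) e" "scanned A m (Q(l := x)) h e = scanned A m Q h e"
proof -
  have hl: "h \<le> l" using assms by (auto simp: queue_ok_def)
  have "inj_on (Q(l := x)) {..<Suc l}"
    using assms by (auto simp: queue_ok_def inj_on_def less_Suc_eq image_iff)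
  then show "queue_ok A N m (Q(l := x)) h (Suc l) e"
    using assms by (auto simp: queue_ok_def less_Suc_eq)
  show "scanned A m (Q(l := x)) h e = scanned A m Q h e"
    unfolding scanned_def using hl by (intro Collect_cong conj_cong refl ex_cong1) auto
qed

lemma image_push: "(Q(l := x)) ` {..<Suc l} = insert x (Q ` {..<l})"
  by (auto simp: lessThan_Suc)

lemma finite_scanned: "finite (scanned A m Q h e)"
  unfolding scanned_def by (rule finite_subset[of _ "{..m}"]) auto

lemma card_scanned: "card (scanned A m Q h e) \<le> m"
proof -
  have "scanned A m Q h e \<subseteq> {1..m}" by (auto simp: scanned_def)
  then have "card (scanned A m Q h e) \<le> card {1..m}" by (intro card_mono) auto
  then show ?thesis by simp
qed

lemma unscanned_pop:
  assumes "queue_ok A N m Q h l 0" "h < l" "arc_lists A f nx m"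
  shows "unscanned A m Q (Suc h) (f (Q h)) = unscanned A m Q h 0"
  unfolding unscanned_def queue_pop(2)[OF assms] ..

lemma unscanned_scan:
  assumes "queue_ok A N m Q h l e" "e \<noteq> 0" "arc_lists A f nx m"
  shows "unscanned A m Q h e = Suc (unscanned A m Q h (nx e))"
  using queue_scan[OF assms] card_scanned[of A m Q h "nx e"]
  by (simp add: unscanned_def finite_scanned)

lemma unscanned_push:
  assumes "queue_ok A N m Q h l e"
  shows "unscanned A m (Q(l := x)) h e = unscanned A m Q h e"
proof -
  have "scanned A m (Q(l := x)) h e = scanned A m Q h e"
    unfolding scanned_def using assms
    by (intro Collect_cong conj_cong refl ex_cong1) (auto simp: queue_ok_def)
  then show ?thesis by (simp add: unscanned_def)
qed

lemma unscanned_le: "unscanned A m Q h e \<le> m"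
  by (simp add: unscanned_def)

lemma scanned_all: "scanned A m Q l 0 = {e'. 1 \<le> e' \<and> e' \<le> m \<and> A e' \<in> Q ` {..<l}}"
  unfolding scanned_def by (auto simp: image_iff) (metis lessThan_iff)+

lemma scanned_in_queue: "queue_ok A N m Q h l e \<Longrightarrow> e' \<in> scanned A m Q h e \<Longrightarrow> A e' \<in> Q ` {..<l}"
  unfolding scanned_def queue_ok_def image_iff by simp (metis lessThan_iff less_le_trans)

locale arcs =
  fixes N m :: nat and U V ff nf fr nr :: "nat \<Rightarrow> nat"
  assumes U_lists: "arc_lists U ff nf m" and V_lists: "arc_lists V fr nr m"
    and U_less: "\<lbrakk>1 \<le> e; e \<le> m\<rbrakk> \<Longrightarrow> U e < N" and V_less: "\<lbrakk>1 \<le> e; e \<le> m\<rbrakk> \<Longrightarrow> V e < N"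
begin

definition E :: "nat \<Rightarrow> nat \<Rightarrow> bool" where
  "E x y \<longleftrightarrow> (\<exists>e. 1 \<le> e \<and> e \<le> m \<and> U e = x \<and> V e = y)"

lemma E_arc: "1 \<le> e \<Longrightarrow> e \<le> m \<Longrightarrow> E (U e) (V e)"
  by (auto simp: E_def)

definition inv1 where
  "inv1 t Q h l e mk nx \<longleftrightarrow> queue_ok V N m Q h l e \<and>
    (\<forall>x. x \<in> Q ` {..<l} \<longleftrightarrow> mk x \<noteq> 0) \<and> mk t = 1 \<and> (\<forall>x. mk x \<le> l) \<and>
    (\<forall>x. mk x \<noteq> 0 \<longrightarrow> x \<noteq> t \<longrightarrow> E x (nx x) \<and> mk (nx x) \<noteq> 0 \<and> mk (nx x) < mk x) \<and>
    (\<forall>e'\<in>scanned V m Q h e. mk (U e') \<noteq> 0)"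

lemma inv1_init:
  assumes "t < N"
  shows "inv1 t (Q(0 := t)) 0 1 0 ((\<lambda>_. 0)(t := 1)) nx"
  using assms by (auto simp: inv1_def queue_ok_def scanned_def inj_on_def)

lemma inv1_pop:
  assumes "inv1 t Q h l 0 mk nx" "h < l"
  shows "inv1 t Q (Suc h) l (fr (Q h)) mk nx"
proof -
  have "queue_ok V N m Q h l 0" using assms(1) by (simp add: inv1_def)
  from queue_pop[OF this assms(2) V_lists] show ?thesis using assms(1) by (simp add: inv1_def)
qed

lemma inv1_skip:
  assumes "inv1 t Q h l e mk nx" "e \<noteq> 0" "mk (U e) \<noteq> 0"
  shows "inv1 t Q h l (nr e) mk nx"
proof -
  have "queue_ok V N m Q h l e" using assms(1) by (simp add: inv1_def)
  from queue_scan[OF this assms(2) V_lists] show ?thesis using assms(1,3) by (simp add: inv1_def)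
qed

lemma inv1_push:
  assumes "inv1 t Q h l e mk nx" "e \<noteq> 0" "mk (U e) = 0"
  shows "inv1 t (Q(l := U e)) h (Suc l) (nr e) (mk(U e := Suc l)) (nx(U e := V e))"
proof -
  have i: "queue_ok V N m Q h l e" "\<And>x. x \<in> Q ` {..<l} \<longleftrightarrow> mk x \<noteq> 0" "mk t = 1" "\<And>x. mk x \<le> l"
    "\<And>x. mk x \<noteq> 0 \<Longrightarrow> x \<noteq> t \<Longrightarrow> E x (nx x) \<and> mk (nx x) \<noteq> 0 \<and> mk (nx x) < mk x"
    "\<And>e'. e' \<in> scanned V m Q h e \<Longrightarrow> mk (U e') \<noteq> 0"
    using assms(1) unfolding inv1_def by blast+
  have e: "1 \<le> e" "e \<le> m" "V e = Q (h - 1)" "0 < h" "h \<le> l" using i(1) assms(2) by (auto simp: queue_ok_def)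
  have Ue: "U e < N" "U e \<notin> Q ` {..<l}" using U_less e assms(3) i(2) by simp_all
  note s = queue_scan[OF i(1) assms(2) V_lists]
  note p = queue_push[OF s(1) Ue]
  have "V e \<in> Q ` {..<l}" using e by auto
  then have Ve: "mk (V e) \<noteq> 0" using i(2) by simp
  then have "V e \<noteq> U e" using assms(3) by auto
  show ?thesis unfolding inv1_def
  proof (intro conjI allI impI ballI)
    fix x
    show "(x \<in> (Q(l := U e)) ` {..<Suc l}) = ((mk(U e := Suc l)) x \<noteq> 0)"
      unfolding image_push using i(2) by simp
    show "(mk(U e := Suc l)) x \<le> Suc l" using i(4)[of x] by auto
    assume x: "(mk(U e := Suc l)) x \<noteq> 0" "x \<noteq> t"
    have nxx: "x \<noteq> U e \<Longrightarrow> nx x \<noteq> U e" using i(5)[of x] x assms(3) by auto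
    show "E x ((nx(U e := V e)) x)" using i(5)[of x] x E_arc[OF e(1,2)] by auto
    show "(mk(U e := Suc l)) ((nx(U e := V e)) x) \<noteq> 0" using i(5)[of x] x Ve by auto
    show "(mk(U e := Suc l)) ((nx(U e := V e)) x) < (mk(U e := Suc l)) x"
      using i(5)[of x] x nxx \<open>V e \<noteq> U e\<close> i(4)[of "V e"] by auto
  next
    fix e' assume "e' \<in> scanned V m (Q(l := U e)) h (nr e)"
    then show "(mk(U e := Suc l)) (U e') \<noteq> 0" using i(6) unfolding p(2) s(2) by auto
  qed (use p(1) i(3) assms(3) in auto)
qed

lemma inv1_final:
  assumes "inv1 t Q l l 0 mk nx" "mk x \<noteq> 0" "E z x"
  shows "mk z \<noteq> 0"
  using assms unfolding inv1_def scanned_all E_def by (metis (mono_tags, lifting) mem_Collect_eq)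

end

locale arcs_path = arcs +
  fixes s t :: nat and vis :: "nat \<Rightarrow> bool" and P pos :: "nat \<Rightarrow> nat" and len :: nat
  assumes P_0: "P 0 = s" and P_len: "P len = t"
    and P_step: "i < len \<Longrightarrow> E (P i) (P (Suc i))"
    and pos_P: "i \<le> len \<Longrightarrow> pos (P i) = Suc i"
    and pos_D: "pos x \<noteq> 0 \<Longrightarrow> pos x \<le> Suc len \<and> P (pos x - 1) = x"
    and P_less: "i \<le> len \<Longrightarrow> P i < N"
begin

lemma path_avoiding:
  assumes "i \<le> len" "\<And>j. i < j \<Longrightarrow> j \<le> len \<Longrightarrow> P j \<noteq> x"
  shows "(\<lambda>u v. E u v \<and> v \<noteq> x)\<^sup>*\<^sup>* (P i) t"
  using assms
proof (induct rule: inc_induct)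
  case base
  then show ?case by (simp add: P_len)
next
  case (step i)
  have "E (P i) (P (Suc i)) \<and> P (Suc i) \<noteq> x" using step P_step by auto
  moreover have "(\<lambda>u v. E u v \<and> v \<noteq> x)\<^sup>*\<^sup>* (P (Suc i)) t" using step by auto
  ultimately show ?case by (rule converse_rtranclp_into_rtranclp)
qed

definition src :: "(nat \<Rightarrow> nat) \<Rightarrow> nat \<Rightarrow> nat" where
  "src Y b = (if b = 1 then s else Y b)"

inductive inv2 where
  inv2I: "\<lbrakk>queue_ok U N m Q h l e;
    \<And>x. x \<in> Q ` {..<l} \<longleftrightarrow> lay x \<noteq> 0;
    \<And>j. j \<le> len \<Longrightarrow> lay (P j) \<noteq> 0 \<longleftrightarrow> j < i;
    i \<le> Suc len;
    1 \<le> K;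
    K \<le> Suc i;
    \<And>x. lay x \<le> K;
    \<And>b. 2 \<le> b \<Longrightarrow> b \<le> K \<Longrightarrow> lay (Y b) = b \<and> vis (Y b);
    \<And>e'. e' \<in> scanned U m Q h e \<Longrightarrow> if i < pos (V e') then pos (V e') \<le> far \<and> lay (U e') = K
       else lay (V e') \<noteq> 0 \<and>
         (lay (V e') \<le> lay (U e') \<or> lay (V e') = Suc (lay (U e')) \<and> V e' = Y (lay (V e')));
    \<And>j. j < l \<Longrightarrow> h \<le> j \<or> Suc j = h \<and> e \<noteq> 0 \<Longrightarrow> lay (Q j) = K;
    far \<le> Suc len;
    Suc i < far \<Longrightarrow> \<exists>u. lay u \<noteq> 0 \<and> E u (P (far - 1));
    \<And>x. lay x \<noteq> 0 \<Longrightarrow> (\<lambda>u v. E u v \<and> lay v \<noteq> 0)\<^sup>*\<^sup>* s x;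
    \<And>x. lay x \<noteq> 0 \<Longrightarrow>
      (\<lambda>u v. E u v \<and> lay v = lay x \<and> v \<noteq> src Y (lay x))\<^sup>*\<^sup>* (src Y (lay x)) x;
    0 < i \<Longrightarrow> lay (P (i - 1)) = K \<and> (lay s = 1 \<or> 2 \<le> K \<and> lay s = 2 \<and> Y 2 = s);
    i = 0 \<Longrightarrow> K = 1 \<and> l = 0;
    \<And>b. 2 \<le> b \<Longrightarrow> b \<le> K \<Longrightarrow> (b = 2 \<and> Y 2 = s) \<or> (\<exists>u. lay u = b - 1 \<and> E u (Y b));
    \<And>j. j < i \<Longrightarrow> vis (P j) \<Longrightarrow> (\<forall>b. 2 \<le> b \<longrightarrow> b \<le> K \<longrightarrow> P j \<noteq> Y b) \<Longrightarrow>
      P j \<noteq> s \<and> (\<lambda>u v. E u v \<and> v \<noteq> P j)\<^sup>*\<^sup>* s t\<rbrakk> \<Longrightarrow>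
    inv2 i h l e Q lay K Y far"

lemma inv2_init: "inv2 0 0 0 0 Q (\<lambda>_. 0) 1 Y 0"
  by (rule inv2.intros) (auto simp: queue_ok_def scanned_def)

lemma inv2_pop:
  assumes "inv2 i h l 0 Q lay K Y far" "h < l"
  shows "inv2 i (Suc h) l (ff (Q h)) Q lay K Y far"
  using assms(1)
proof (cases rule: inv2.cases)
  case inv2I
  note i = this
  note p = queue_pop[OF i(1) assms(2) U_lists]
  have *: "lay (Q j) = K" if "j < l" "Suc h \<le> j \<or> Suc j = Suc h \<and> ff (Q h) \<noteq> 0" for j
    using i(10)[of j] that by auto
  show ?thesis
    by (rule inv2.intros) (unfold p(2), (fact p(1) * i)+)
qed

lemma inv2_scan_path:
  assumes "inv2 i h l e Q lay K Y far" "e \<noteq> 0" "pos (V e) \<noteq> 0"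
  shows "inv2 i h l (nf e) Q lay K Y (max far (pos (V e)))"
  using assms(1)
proof (cases rule: inv2.cases)
  case inv2I
  note i = this
  note s = queue_scan[OF i(1) assms(2) U_lists]
  have e: "1 \<le> e" "e \<le> m" "U e = Q (h - 1)" "0 < h" "h \<le> l" using i(1) assms(2) by (auto simp: queue_ok_def)
  have U: "lay (U e) = K" using i(10)[of "h - 1"] e assms(2) by auto
  have pos: "pos (V e) \<le> Suc len" "P (pos (V e) - 1) = V e" using pos_D[OF assms(3)] by auto
  have *: "lay (Q j) = K" if "j < l" "h \<le> j \<or> Suc j = h \<and> nf e \<noteq> 0" for j
    using i(10)[of j] that assms(2) by auto
  have **: "if i < pos (V e') then pos (V e') \<le> max far (pos (V e)) \<and> lay (U e') = K
       else lay (V e') \<noteq> 0 \<and>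
         (lay (V e') \<le> lay (U e') \<or> lay (V e') = Suc (lay (U e')) \<and> V e' = Y (lay (V e')))"
    if "e' \<in> insert e (scanned U m Q h e)" for e'
  proof (cases "e' = e")
    case True
    show ?thesis
    proof (cases "i < pos (V e)")
      case False
      have "lay (V e) \<noteq> 0" using i(3)[of "pos (V e) - 1"] pos False assms(3) by auto
      then show ?thesis using True False i(7)[of "V e"] U by simp
    qed (use True U in simp)
  next
    case False
    then show ?thesis using i(9)[of e'] that by (auto split: if_splits)
  qed
  have ***: "\<exists>u. lay u \<noteq> 0 \<and> E u (P (max far (pos (V e)) - 1))" if "Suc i < max far (pos (V e))"
  proof (cases "pos (V e) \<le> far")
    case True
    then show ?thesis using i(12) that by (simp add: max_def)
  next
    case False
    then show ?thesis using pos(2) E_arc[OF e(1,2)] U i(5) by (intro exI[of _ "U e"]) auto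
  qed
  have far: "max far (pos (V e)) \<le> Suc len" using i(11) pos by simp
  show ?thesis
    by (rule inv2.intros) (unfold s(2), (fact s(1) far * ** *** i)+)
qed

lemma inv2_skip:
  assumes "inv2 i h l e Q lay K Y far" "e \<noteq> 0" "pos (V e) = 0" "lay (V e) \<noteq> 0"
  shows "inv2 i h l (nf e) Q lay K Y far"
  using assms(1)
proof (cases rule: inv2.cases)
  case inv2I
  note i = this
  note s = queue_scan[OF i(1) assms(2) U_lists]
  have e: "1 \<le> e" "e \<le> m" "U e = Q (h - 1)" "0 < h" "h \<le> l" using i(1) assms(2) by (auto simp: queue_ok_def)
  have U: "lay (U e) = K" using i(10)[of "h - 1"] e assms(2) by auto
  have *: "lay (Q j) = K" if "j < l" "h \<le> j \<or> Suc j = h \<and> nf e \<noteq> 0" for j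
    using i(10)[of j] that assms(2) by auto
  have **: "if i < pos (V e') then pos (V e') \<le> far \<and> lay (U e') = K
       else lay (V e') \<noteq> 0 \<and>
         (lay (V e') \<le> lay (U e') \<or> lay (V e') = Suc (lay (U e')) \<and> V e' = Y (lay (V e')))"
    if "e' \<in> insert e (scanned U m Q h e)" for e'
  proof (cases "e' = e")
    case True
    then show ?thesis using i(7)[of "V e"] U assms by simp
  next
    case False
    then show ?thesis using i(9)[of e'] that by auto
  qed
  show ?thesis
    by (rule inv2.intros) (unfold s(2), (fact s(1) * ** i)+)
qed

text \<open>
  A node \<open>p\<close> enters the search; its layer is the current one, or a new one if it is a
  visible node on every path.
\<close>

lemma lay_extend:
  assumes "inv2 i h l e Q lay K Y far" "lay p = 0"
    and new: "K' = K \<and> Y' = Y \<or> K' = Suc K \<and> Y' = Y(Suc K := p)"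
    and pred: "p = s \<and> l = 0 \<or> (lay u = K \<and> E u p)"
    and x: "lay x \<noteq> 0 \<or> x = p"
  shows "(\<lambda>u v. E u v \<and> (lay(p := K')) v \<noteq> 0)\<^sup>*\<^sup>* s x \<and>
      (\<lambda>u v. E u v \<and> (lay(p := K')) v = (lay(p := K')) x \<and> v \<noteq> src Y' ((lay(p := K')) x))\<^sup>*\<^sup>*
        (src Y' ((lay(p := K')) x)) x"
  using assms(1)
proof (cases rule: inv2.cases)
  case inv2I
  note i = this
  have K': "K' \<noteq> 0" using new i(5) by auto
  have old: "(\<lambda>u v. E u v \<and> (lay(p := K')) v \<noteq> 0)\<^sup>*\<^sup>* s x" if "lay x \<noteq> 0" for x
    by (rule rtranclp_weaken[OF i(13)[OF that]]) (use K' in auto)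
  have srceq: "src Y' (lay x) = src Y (lay x)" for x
    using new i(7)[of x] by (auto simp: src_def)
  have old2: "(\<lambda>u v. E u v \<and> (lay(p := K')) v = lay x \<and> v \<noteq> src Y' (lay x))\<^sup>*\<^sup>* (src Y' (lay x)) x"
    if "lay x \<noteq> 0" for x
    unfolding srceq by (rule rtranclp_weaken[OF i(14)[OF that]]) (use that assms(2) in auto)
  have l0: "l = 0 \<Longrightarrow> lay x = 0" for x using i(2)[of x] by simp
  have newp: "(\<lambda>u v. E u v \<and> (lay(p := K')) v \<noteq> 0)\<^sup>*\<^sup>* s p"
    using pred
  proof
    assume "lay u = K \<and> E u p"
    then have "(\<lambda>u v. E u v \<and> (lay(p := K')) v \<noteq> 0)\<^sup>*\<^sup>* s u" and up: "E u p"
      using old[of u] i(5) by auto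
    from this(1) show ?thesis by (rule rtranclp.rtrancl_into_rtrancl) (use K' up in simp)
  qed simp
  have newp2: "(\<lambda>u v. E u v \<and> (lay(p := K')) v = K' \<and> v \<noteq> src Y' K')\<^sup>*\<^sup>* (src Y' K') p"
  proof (cases "src Y' K' = p")
    case False
    have K1: "K' = 1 \<or> K' = K"
      using new False i(5) by (auto simp: src_def)
    show ?thesis using pred
    proof
      assume "p = s \<and> l = 0"
      then have "K' \<noteq> 1" "l = 0" using False by (auto simp: src_def)
      then have "K' = K" "2 \<le> K" using K1 i(5) by auto
      then have "lay (Y K) = K" using i(8)[of K] by auto
      then show ?thesis using l0[OF \<open>l = 0\<close>, of "Y K"] \<open>2 \<le> K\<close> by simp
    next
      assume u: "lay u = K \<and> E u p"
      have "K' = K" using new False i(5) by (auto simp: src_def)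
      then have "(\<lambda>u v. E u v \<and> (lay(p := K')) v = K' \<and> v \<noteq> src Y' K')\<^sup>*\<^sup>* (src Y' K') u"
        using old2[of u] u i(5) by auto
      then show ?thesis by (rule rtranclp.rtrancl_into_rtrancl) (use u False in simp)
    qed
  qed simp
  have "(\<lambda>u v. E u v \<and> (lay(p := K')) v \<noteq> 0)\<^sup>*\<^sup>* s x"
    using x old newp by blast
  moreover have "(\<lambda>u v. E u v \<and> (lay(p := K')) v = (lay(p := K')) x \<and> v \<noteq> src Y' ((lay(p := K')) x))\<^sup>*\<^sup>*
        (src Y' ((lay(p := K')) x)) x"
  proof (cases "x = p")
    case True
    then show ?thesis using newp2 by simp
  next
    case False
    then show ?thesis using old2[of x] x by simp
  qed
  ultimately show ?thesis by blast
qed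

lemma inv2_push:
  assumes "inv2 i h l e Q lay K Y far" "e \<noteq> 0" "pos (V e) = 0" "lay (V e) = 0"
  shows "inv2 i h (Suc l) (nf e) (Q(l := V e)) (lay(V e := K)) K Y far"
  using assms(1)
proof (cases rule: inv2.cases)
  case inv2I
  note i = this
  note s = queue_scan[OF i(1) assms(2) U_lists]
  have e: "1 \<le> e" "e \<le> m" "U e = Q (h - 1)" "0 < h" "h \<le> l" using i(1) assms(2) by (auto simp: queue_ok_def)
  have U: "lay (U e) = K" using i(10)[of "h - 1"] e assms(2) by auto
  have Ve: "V e < N" "V e \<notin> Q ` {..<l}" using V_less e assms(4) i(2) by simp_all
  note p = queue_push[OF s(1) Ve]
  have ext: "K = K \<and> Y = Y \<or> K = Suc K \<and> Y = Y(Suc K := V e)"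
    "V e = s \<and> l = 0 \<or> (lay (U e) = K \<and> E (U e) (V e))" using U E_arc[OF e(1,2)] by auto
  note le = lay_extend[OF assms(1,4) ext]
  have nP: "V e \<noteq> P j" if "j \<le> len" for j using pos_P[OF that] assms(3) by auto
  have nl: "lay u \<noteq> 0 \<Longrightarrow> (lay(V e := K)) u = lay u" for u using assms(4) by auto
  have K: "K \<noteq> 0" using i(5) by simp
  show ?thesis
  proof (rule inv2.intros, goal_cases)
    case (2 x)
    show ?case unfolding image_push using i(2) K by simp
  next
    case (3 j)
    then show ?case using i(3)[of j] nP[of j] by auto
  next
    case (7 x)
    show ?case using i(7)[of x] by simp
  next
    case (8 b)
    then show ?case using i(8)[of b] assms(4) by auto
  next
    case (9 e')
    then have e': "e' \<in> insert e (scanned U m Q h e)" unfolding p(2) s(2) .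
    show ?case
    proof (cases "e' = e")
      case True
      then show ?thesis using U i(5) assms by auto
    next
      case False
      then have "U e' \<in> Q ` {..<l}" using scanned_in_queue[OF i(1)] e' by simp
      then have "lay (U e') \<noteq> 0" using i(2) by simp
      then show ?thesis using False e' i(9)[of e'] assms(3,4) i(7)[of "V e'"] by (auto split: if_splits)
    qed
  next
    case (10 j)
    then show ?case using i(10)[of j] assms(2) by (auto simp: less_Suc_eq)
  next
    case 12
    then show ?case using i(12) nl by metis
  next
    case (13 x)
    show ?case by (rule le[THEN conjunct1]) (use 13 in \<open>simp split: if_splits\<close>)
  next
    case (14 x)
    show ?case by (rule le[THEN conjunct2]) (use 14 in \<open>simp split: if_splits\<close>)
  next
    case 15
    have "lay s \<noteq> 0" using i(15) 15 by auto
    then show ?case using i(15)[OF 15] i(4) nP[of "i - 1"] nl[of s] 15 by auto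
  next
    case 16
    then show ?case using i(16) e by auto
  next
    case (17 b)
    then have "b - 1 \<noteq> 0" by simp
    then show ?case using i(17)[OF 17] nl by metis
  qed (fact p(1) i)+
qed

end

context arcs_path begin

lemma P_inj: "\<lbrakk>i \<le> len; j \<le> len; P i = P j\<rbrakk> \<Longrightarrow> i = j"
  using pos_P by (metis nat.inject)

lemma len_less: "len < N"
proof -
  have "inj_on P {..len}" using P_inj by (auto simp: inj_on_def)
  moreover have "P ` {..len} \<subseteq> {..<N}" using P_less by auto
  ultimately have "card {..len} \<le> card {..<N}" by (metis card_inj_on_le finite_lessThan)
  then show ?thesis by simp
qed

lemma inv2_phase:
  assumes "inv2 i l l 0 Q lay K Y far" "i \<le> len"
    and new: "if \<not> Suc i < far \<and> vis (P i) then K' = Suc K \<and> Y' = Y(Suc K := P i) else K' = K \<and> Y' = Y"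
  shows "inv2 (Suc i) l (Suc l) 0 (Q(l := P i)) (lay(P i := K')) K' Y' far"
  using assms(1)
proof (cases rule: inv2.cases)
  case inv2I
  note i = this
  define p where "p = P i"
  have p0: "lay p = 0" using i(3)[OF assms(2)] by (simp add: p_def)
  have p: "p < N" "p \<notin> Q ` {..<l}" using P_less assms(2) i(2)[of p] p0 by (auto simp: p_def)
  note q = queue_push[OF i(1) p]
  have pos: "pos p = Suc i" using pos_P assms(2) by (simp add: p_def)
  have new': "K' = K \<and> Y' = Y \<or> K' = Suc K \<and> Y' = Y(Suc K := p)"
    using new by (auto simp: p_def split: if_splits)
  have pred: "i \<noteq> 0 \<Longrightarrow> lay (P (i - 1)) = K \<and> E (P (i - 1)) p"
    using i(15) P_step[of "i - 1"] assms(2) by (auto simp: p_def)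
  have pred': "p = s \<and> l = 0 \<or> (lay (P (i - 1)) = K \<and> E (P (i - 1)) p)"
    using pred i(16) P_0 by (cases "i = 0") (auto simp: p_def)
  note le = lay_extend[OF assms(1) p0 new' pred']
  have nl: "lay u \<noteq> 0 \<Longrightarrow> (lay(p := K')) u = lay u" for u using p0 by auto
  have K': "K' \<noteq> 0" "K \<le> K'" "K' \<le> Suc K" using new' i(5) by auto
  have Y'_old: "b \<le> K \<Longrightarrow> Y' b = Y b" for b using new' by auto
  show ?thesis unfolding p_def[symmetric]
  proof (rule inv2.intros, goal_cases)
    case (2 x)
    show ?case unfolding image_push using i(2)[of x] K' by simp
  next
    case (3 j)
    then show ?case using i(3)[OF 3] K' P_inj[of j i] assms(2) by (auto simp: p_def less_Suc_eq)
  next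
    case (7 x)
    show ?case using i(7)[of x] K' by simp
  next
    case (8 b)
    show ?case
    proof (cases "b \<le> K")
      case True
      then show ?thesis using i(8)[OF 8(1) True] Y'_old[OF True] nl[of "Y b"] 8 by simp
    next
      case False
      then have "b = Suc K" "K' = Suc K" "Y' = Y(Suc K := p)" "vis p"
        using 8(2) new' new by (auto simp: p_def split: if_splits)
      then show ?thesis by simp
    qed
  next
    case (9 e')
    then have e': "e' \<in> scanned U m Q l 0" unfolding q(2) .
    then have "U e' \<in> Q ` {..<l}" using scanned_in_queue[OF i(1)] by simp
    then have U: "lay (U e') \<noteq> 0" "(lay(p := K')) (U e') = lay (U e')" using i(2) nl by simp_all
    show ?case
    proof (cases "i < pos (V e')")
      case True
      with i(9)[OF e'] have *: "pos (V e') \<le> far" "lay (U e') = K" by auto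
      show ?thesis
      proof (cases "V e' = p")
        case True
        then show ?thesis using * U pos new' by auto
      next
        case False
        then have "pos (V e') \<noteq> Suc i" using pos_D[of "V e'"] by (auto simp: p_def)
        then have "Suc i < pos (V e')" using True by simp
        moreover have "K' = K" using new * calculation by (auto split: if_splits)
        ultimately show ?thesis using * U by auto
      qed
    next
      case False
      with i(9)[OF e'] have *: "lay (V e') \<noteq> 0"
        "lay (V e') \<le> lay (U e') \<or> lay (V e') = Suc (lay (U e')) \<and> V e' = Y (lay (V e'))" by auto
      have "V e' \<noteq> p" using * p0 by auto
      then show ?thesis using False * U Y'_old[of "lay (V e')"] i(7)[of "V e'"] by auto
    qed
  next
    case (10 j)
    then show ?case by (auto simp: less_Suc_eq)
  next
    case 12
    then show ?case using i(12) nl by (metis Suc_lessD)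
  next
    case (13 x)
    show ?case by (rule le[THEN conjunct1]) (use 13 in \<open>simp split: if_splits\<close>)
  next
    case (14 x)
    show ?case by (rule le[THEN conjunct2]) (use 14 in \<open>simp split: if_splits\<close>)
  next
    case 15
    show ?case
    proof (cases "i = 0")
      case True
      then have "p = s" "K = 1" using P_0 i(16) by (auto simp: p_def)
      then show ?thesis using new' True P_0 by (auto simp: numeral_2_eq_2)
    next
      case False
      then have "lay s \<noteq> 0" using i(15) by auto
      then show ?thesis using i(15) False nl[of s] Y'_old[of 2] K' by (auto simp: p_def)
    qed
  next
    case (17 b)
    show ?case
    proof (cases "b \<le> K")
      case True
      have "b - 1 \<noteq> 0" using 17 by simp
      then show ?thesis using i(17)[OF 17(1) True] nl Y'_old[OF True] Y'_old[of 2] True 17(1)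
        by (metis order_trans)
    next
      case False
      then have b: "b = Suc K" "Y' b = p" using 17(2) new' by auto
      show ?thesis
      proof (cases "i = 0")
        case True
        then show ?thesis using i(16) b P_0 by (auto simp: p_def numeral_2_eq_2)
      next
        case False
        then show ?thesis using pred b nl[of "P (i - 1)"] i(5) by (intro disjI2 exI[of _ "P (i - 1)"]) simp
      qed
    qed
  next
    case (18 j)
    have notY: "\<forall>b. 2 \<le> b \<longrightarrow> b \<le> K \<longrightarrow> P j \<noteq> Y b"
      using 18(3) Y'_old K' by (metis le_trans)
    show ?case
    proof (cases "j = i")
      case False
      then show ?thesis using i(18)[of j] 18 notY by auto
    next
      case True
      have K2: "2 \<le> Suc K" using i(5) by simp
      have "Suc i < far"
      proof (rule ccontr)
        assume "\<not> Suc i < far"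
        then have "K' = Suc K" "Y' (Suc K) = P i" using new 18(2) True by auto
        then show False using 18(3) K2 True by (metis order_refl)
      qed
      with i(12) obtain u where u: "lay u \<noteq> 0" "E u (P (far - 1))" by blast
      then have "l \<noteq> 0" using i(2)[of u] by auto
      with i(16) have "i \<noteq> 0" by auto
      then have "lay s \<noteq> 0" using i(15) by auto
      then have ps: "p \<noteq> s" using p0 by auto
      have "(\<lambda>u v. E u v \<and> v \<noteq> p)\<^sup>*\<^sup>* s u"
        by (rule rtranclp_weaken[OF i(13)[OF u(1)]]) (use p0 in auto)
      moreover have fp: "P (far - 1) \<noteq> p"
        using P_inj[of "far - 1" i] i(11) \<open>Suc i < far\<close> assms(2) by (auto simp: p_def)
      ultimately have "(\<lambda>u v. E u v \<and> v \<noteq> p)\<^sup>*\<^sup>* s (P (far - 1))"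
        using u(2) by (auto intro: rtranclp.rtrancl_into_rtrancl)
      moreover have "(\<lambda>u v. E u v \<and> v \<noteq> p)\<^sup>*\<^sup>* (P (far - 1)) t"
        by (rule path_avoiding) (use i(11) \<open>Suc i < far\<close> assms(2) P_inj in \<open>fastforce simp: p_def\<close>)+
      ultimately show ?thesis using ps True by (auto simp: p_def)
    qed
  qed (use q(1) i K' assms(2) in auto)
qed

lemma inv2_final:
  assumes "inv2 (Suc len) l l 0 Q lay K Y far"
  shows "layered E s t vis lay Y K"
  using assms
proof (cases rule: inv2.cases)
  case inv2I
  note i = this
  show ?thesis
  proof
    show "1 \<le> K" by (rule i(5))
    show "lay s = 1 \<or> 2 \<le> K \<and> lay s = 2 \<and> Y 2 = s" using i(15) by simp
    show "lay t = K" using i(15) P_len by simp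
    fix x z assume x: "0 < lay x" "E x z"
    then obtain e' where e': "1 \<le> e'" "e' \<le> m" "U e' = x" "V e' = z" by (auto simp: E_def)
    have "x \<in> Q ` {..<l}" using x i(2)[of x] by simp
    then have "e' \<in> scanned U m Q l 0" unfolding scanned_all using e' by simp
    from i(9)[OF this] e' show "0 < lay z \<and> (lay z \<le> lay x \<or> lay z = Suc (lay x) \<and> z = Y (lay z))"
      using pos_D[of z] by (auto split: if_splits)
  next
    fix b assume b: "2 \<le> b" "b \<le> K"
    show "lay (Y b) = b" "vis (Y b)" using i(8)[OF b] by auto
    show "b = 2 \<and> Y 2 = s \<or> (\<exists>u. lay u = b - 1 \<and> E u (Y b))" by (rule i(17)[OF b])
  next
    fix x assume x: "0 < lay x"
    then show "(\<lambda>u v. E u v \<and> lay v = lay x \<and> v \<noteq> (if lay x = 1 then s else Y (lay x)))\<^sup>*\<^sup>*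
            (if lay x = 1 then s else Y (lay x)) x"
      using i(14)[of x] by (simp add: src_def)
  next
    fix x assume x: "vis x" "\<forall>b\<ge>2. b \<le> K \<longrightarrow> x \<noteq> Y b"
    show "x \<noteq> s \<and> (\<lambda>u v. E u v \<and> v \<noteq> x)\<^sup>*\<^sup>* s t"
    proof (cases "pos x = 0")
      case True
      then have "P j \<noteq> x" if "j \<le> len" for j using pos_P[OF that] by auto
      then show ?thesis using path_avoiding[of 0 x] P_0 by auto
    next
      case False
      then have "P (pos x - 1) = x" "pos x - 1 < Suc len" using pos_D[of x] by auto
      with i(18)[of "pos x - 1"] x show ?thesis by metis
    qed
  qed
qed

lemma inv2_Y_less:
  assumes "inv2 i h l e Q lay K Y far" "2 \<le> b" "b \<le> K"
  shows "Y b < N"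
  using assms(1)
proof (cases rule: inv2.cases)
  case inv2I
  note i = this
  have "lay (Y b) \<noteq> 0" using i(8)[OF assms(2,3)] assms(2) by simp
  then have "Y b \<in> Q ` {..<l}" using i(2) by simp
  then show ?thesis using i(1) by (auto simp: queue_ok_def)
qed

end

locale arcs_layered = arcs N m U V ff nf fr nr + layered "arcs.E m U V" s t vis L Y K
  for N m U V ff nf fr nr s t vis L Y K +
  assumes Y_less: "2 \<le> b \<Longrightarrow> b \<le> K \<Longrightarrow> Y b < N"
begin

inductive inv3 where
  inv3I: "\<lbrakk>queue_ok V N m Q h l e;
    1 \<le> b; b \<le> K; 2 \<le> K \<Longrightarrow> 2 \<le> b;
    \<And>x. x \<in> Q ` {..<l} \<longleftrightarrow> mark x \<noteq> 0;
    \<And>x. mark x \<noteq> 0 \<Longrightarrow> \<exists>c. b < c \<and> c \<le> K \<and> Tc c x;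
    \<And>c. b < c \<Longrightarrow> c \<le> K \<Longrightarrow> mark (Y c) \<noteq> 0;
    \<And>e' c. \<lbrakk>e' \<in> scanned V m Q h e; b < c; c \<le> K; Tc c (V e'); L (U e') \<noteq> 0; U e' \<noteq> Y (c - 1)\<rbrakk> \<Longrightarrow>
      (c \<le> L (U e') \<or> vis (U e') \<longrightarrow> r (c - 1) \<le> L (U e')) \<and> (L (U e') = c - 1 \<longrightarrow> mark (U e') \<noteq> 0);
    \<And>j. j < l \<Longrightarrow> h \<le> j \<or> Suc j = h \<and> e \<noteq> 0 \<Longrightarrow> b < K \<and> Tc (Suc b) (Q j);
    r K = K;
    \<And>c. b \<le> c \<Longrightarrow> c < K \<Longrightarrow> r c \<le> r (Suc c);
    \<And>c. b \<le> c \<Longrightarrow> c < K \<Longrightarrow> r c = r (Suc c) \<or>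
      (\<exists>x z. Tc (Suc c) x \<and> E z x \<and> 0 < L z \<and> z \<noteq> Y c \<and> (c < L z \<or> vis z) \<and> r c = L z)\<rbrakk> \<Longrightarrow>
    inv3 b h l e Q mark r"

lemma Tc_unique:
  assumes "Tc c x" "Tc c' x" "3 \<le> c" "c \<le> K" "3 \<le> c'" "c' \<le> K"
  shows "c = c'"
proof -
  have "x = Y c \<and> L x = c \<or> L x = c - 1 \<and> x \<noteq> Y (c - 1)"
    "x = Y c' \<and> L x = c' \<or> L x = c' - 1 \<and> x \<noteq> Y (c' - 1)" using Tc_L assms by auto
  then show ?thesis using assms(3,5) by auto
qed

lemma inv3_init: "inv3 K 0 0 0 Q (\<lambda>_. 0) (r(K := K))"
  by (rule inv3.intros) (use K_pos in \<open>auto simp: queue_ok_def scanned_def\<close>)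

lemma inv3_pop:
  assumes "inv3 b h l 0 Q mark r" "h < l"
  shows "inv3 b (Suc h) l (fr (Q h)) Q mark r"
  using assms(1)
proof (cases rule: inv3.cases)
  case inv3I
  note i = this
  note p = queue_pop[OF i(1) assms(2) V_lists]
  have *: "b < K \<and> Tc (Suc b) (Q j)" if "j < l" "Suc h \<le> j \<or> Suc j = Suc h \<and> fr (Q h) \<noteq> 0" for j
    using i(9)[of j] that by auto
  show ?thesis
    by (rule inv3.intros) (unfold p(2), (fact p(1) * i)+)
qed

lemma inv3_arc:
  assumes "inv3 b h l e Q mark r" "e \<noteq> 0"
  shows "1 \<le> e" "e \<le> m" "b < K" "Tc (Suc b) (V e)" "E (U e) (V e)" "2 \<le> b"
    "U e < N" "L (U e) \<noteq> 0 \<Longrightarrow> b \<le> L (U e)"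
proof -
  have "1 \<le> e \<and> e \<le> m \<and> b < K \<and> Tc (Suc b) (V e) \<and> 2 \<le> b"
    using assms(1)
  proof (cases rule: inv3.cases)
    case inv3I
    note i = this
    have e: "1 \<le> e" "e \<le> m" "V e = Q (h - 1)" "0 < h" "h \<le> l"
      using i(1) assms(2) by (auto simp: queue_ok_def)
    moreover have "b < K \<and> Tc (Suc b) (V e)" using i(9)[of "h - 1"] e assms(2) by auto
    ultimately show ?thesis using i(2,4) by auto
  qed
  then show *: "1 \<le> e" "e \<le> m" "b < K" "Tc (Suc b) (V e)" "2 \<le> b" by auto
  then show E: "E (U e) (V e)" "U e < N" using E_arc U_less by auto
  show "L (U e) \<noteq> 0 \<Longrightarrow> b \<le> L (U e)"
    using Tc_pred_L[OF *(4) _ _ E(1)] * by auto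
qed

lemma inv3_next:
  assumes "inv3 b h l e Q mark r" "e \<noteq> 0"
    and "L (U e) = 0 \<or> U e = Y b \<or>
      (b < L (U e) \<or> vis (U e) \<longrightarrow> r b \<le> L (U e)) \<and> (L (U e) = b \<longrightarrow> mark (U e) \<noteq> 0)"
  shows "inv3 b h l (nr e) Q mark r"
  using assms(1)
proof (cases rule: inv3.cases)
  case inv3I
  note i = this
  note s = queue_scan[OF i(1) assms(2) V_lists]
  note a = inv3_arc[OF assms(1,2)]
  have *: "b < K \<and> Tc (Suc b) (Q j)" if "j < l" "h \<le> j \<or> Suc j = h \<and> nr e \<noteq> 0" for j
    using i(9)[of j] that assms(2) by auto
  have **: "(c \<le> L (U e') \<or> vis (U e') \<longrightarrow> r (c - 1) \<le> L (U e')) \<and> (L (U e') = c - 1 \<longrightarrow> mark (U e') \<noteq> 0)"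
    if "e' \<in> insert e (scanned V m Q h e)" "b < c" "c \<le> K" "Tc c (V e')" "L (U e') \<noteq> 0" "U e' \<noteq> Y (c - 1)" for e' c
  proof (cases "e' = e")
    case True
    then have "c = Suc b" using Tc_unique[of c "V e" "Suc b"] that a by auto
    then show ?thesis using assms(3) that True by auto
  next
    case False
    then show ?thesis using i(8)[of e' c] that by blast
  qed
  show ?thesis
    by (rule inv3.intros) (unfold s(2), (fact s(1) * ** i)+)
qed

lemma inv3_limit:
  assumes "inv3 b h l e Q mark r" "e \<noteq> 0"
    and "L (U e) \<noteq> 0" "U e \<noteq> Y b" "b < L (U e) \<or> vis (U e)" "L (U e) < r b"
  shows "inv3 b h l e Q mark (r(b := L (U e)))"
  using assms(1)
proof (cases rule: inv3.cases)
  case inv3I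
  note i = this
  note a = inv3_arc[OF assms(1,2)]
  show ?thesis
  proof (rule inv3.intros, goal_cases)
    case (8 e' c)
    then show ?case using i(8)[of e' c] assms(6) by (cases "c - 1 = b") auto
  next
    case (11 c)
    then show ?case using i(11)[of c] assms(6) by (cases "c = b") auto
  next
    case (12 c)
    show ?case
    proof (cases "c = b")
      case True
      then show ?thesis using a assms by (intro disjI2 exI[of _ "V e"] exI[of _ "U e"]) auto
    next
      case False
      then show ?thesis using i(12)[of c] 12 by auto
    qed
  qed (use i a in auto)
qed

lemma inv3_push:
  assumes "inv3 b h l e Q mark r" "e \<noteq> 0" "L (U e) = b" "U e \<noteq> Y b" "mark (U e) = 0" "k \<noteq> 0"
  shows "inv3 b h (Suc l) e (Q(l := U e)) (mark(U e := k)) r"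
  using assms(1)
proof (cases rule: inv3.cases)
  case inv3I
  note i = this
  note a = inv3_arc[OF assms(1,2)]
  have "U e \<notin> Q ` {..<l}" using i(5)[of "U e"] assms(5) by simp
  note p = queue_push[OF i(1) a(7) this]
  have Tc: "Tc (Suc b) (U e)" using Tc_step[OF a(4,5)] assms(3,4) by simp
  show ?thesis
  proof (rule inv3.intros, goal_cases)
    case (5 x)
    show ?case unfolding image_push using i(5)[of x] assms(6) by simp
  next
    case (6 x)
    then show ?case using i(6)[of x] Tc a by (cases "x = U e") auto
  next
    case (8 e' c)
    then show ?case using i(8)[of e' c] assms(6) unfolding p(2) by auto
  next
    case (9 j)
    then show ?case using i(9)[of j] Tc a by (cases "j = l") auto
  qed (use i p(1) assms(6) in auto)
qed

lemma inv3_phase: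
  assumes "inv3 b l l 0 Q mark r" "2 < b" "k \<noteq> 0"
  shows "inv3 (b - 1) l (Suc l) 0 (Q(l := Y b)) (mark(Y b := k)) (r(b - 1 := r b))"
  using assms(1)
proof (cases rule: inv3.cases)
  case inv3I
  note i = this
  have m0: "mark (Y b) = 0"
  proof (rule ccontr)
    assume "mark (Y b) \<noteq> 0"
    then obtain c where c: "b < c" "c \<le> K" "Tc c (Y b)" using i(6) by blast
    then have "b = c" using Tc_unique[OF c(3) Tc_Y] assms(2) i(3) by auto
    then show False using c by simp
  qed
  then have "Y b \<notin> Q ` {..<l}" using i(5)[of "Y b"] by simp
  moreover have "Y b < N" using Y_less assms(2) i(3) by auto
  ultimately have p: "queue_ok V N m (Q(l := Y b)) l (Suc l) 0" "scanned V m (Q(l := Y b)) l 0 = scanned V m Q l 0"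
    using queue_push[OF i(1)] by auto
  show ?thesis
  proof (rule inv3.intros, goal_cases)
    case (5 x)
    show ?case unfolding image_push using i(5)[of x] assms(3) by simp
  next
    case (6 x)
    show ?case
    proof (cases "x = Y b")
      case True
      then show ?thesis using Tc_Y[of b] assms(2) i(3) by (intro exI[of _ b]) auto
    next
      case False
      then obtain c where "b < c" "c \<le> K" "Tc c x" using i(6)[of x] 6 by auto
      then show ?thesis by (intro exI[of _ c]) auto
    qed
  next
    case (7 c)
    then show ?case using i(7)[of c] assms by (cases "c = b") auto
  next
    case (8 e' c)
    then have e': "e' \<in> scanned V m Q l 0" unfolding p(2) by simp
    have "V e' \<in> Q ` {..<l}" using scanned_in_queue[OF i(1) e'] .
    then obtain d where d: "b < d" "d \<le> K" "Tc d (V e')" using i(5,6) by metis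
    then have "c = d" using Tc_unique[OF 8(4) d(3)] 8 assms(2) by auto
    then have c: "b < c" "c - 1 \<noteq> b - 1" using d assms(2) by auto
    show ?case using i(8)[OF e' c(1) 8(3-6)] c(2) assms(3) by auto
  next
    case (9 j)
    then show ?case using Tc_Y[of b] assms(2) i(3) by (auto simp: less_Suc_eq)
  next
    case 10
    then show ?case using i(10) i(3) assms(2) by auto
  next
    case (11 c)
    then show ?case using i(11)[of c] assms(2) by (cases "c = b - 1") auto
  next
    case (12 c)
    show ?case
    proof (cases "c = b - 1")
      case True
      then show ?thesis using assms(2) by auto
    next
      case False
      then have "b \<le> c" using 12 assms(2) by auto
      then show ?thesis using i(12)[of c] 12 False assms(2) by auto
    qed
  qed (use p(1) assms(2) i in auto)
qed

lemma inv3_final: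
  assumes "inv3 b l l 0 Q mark r" "b \<le> 2"
  shows "layered_limits E s t vis L Y K r"
  using assms(1)
proof (cases rule: inv3.cases)
  case inv3I
  note i = this
  have b: "b < c" if "3 \<le> c" "c \<le> K" for c using that i assms(2) by auto
  have scan: "e' \<in> scanned V m Q l 0" if "1 \<le> e'" "e' \<le> m" "mark (V e') \<noteq> 0" for e'
    unfolding scanned_all using that i(5)[of "V e'"] by simp
  have marked: "mark x \<noteq> 0" if "Tc c x" "3 \<le> c" "c \<le> K" for c x
    using that
  proof (induct rule: Tc.induct)
    case Tc_Y
    then show ?case using i(7) b by auto
  next
    case (Tc_step x z)
    then obtain e' where e': "1 \<le> e'" "e' \<le> m" "U e' = z" "V e' = x" by (auto simp: E_def)
    have "mark x \<noteq> 0" using Tc_step by auto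
    then have "e' \<in> scanned V m Q l 0" using scan[of e'] e' by auto
    from i(8)[OF this b[OF Tc_step(6,7)] Tc_step(7)] e' Tc_step show ?case by auto
  qed
  show ?thesis
  proof
    show "r K = K" by (rule i(10))
    fix c assume c: "2 \<le> c" "c < K"
    then have bc: "b \<le> c" using assms(2) by simp
    show "r c \<le> r (Suc c)" by (rule i(11)[OF bc c(2)])
    show "r c = r (Suc c) \<or>
         (\<exists>x z. Tc (Suc c) x \<and> E z x \<and> 0 < L z \<and> z \<noteq> Y c \<and> (c < L z \<or> vis z) \<and> r c = L z)"
      by (rule i(12)[OF bc c(2)])
    fix x z assume x: "Tc (Suc c) x" "E z x" "0 < L z" "z \<noteq> Y c" "c < L z \<or> vis z"
    then obtain e' where e': "1 \<le> e'" "e' \<le> m" "U e' = z" "V e' = x" by (auto simp: E_def)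
    have "mark x \<noteq> 0" using marked[OF x(1)] c by auto
    then have "e' \<in> scanned V m Q l 0" using scan[of e'] e' by auto
    from i(8)[OF this, of "Suc c"] e' x c bc show "r c \<le> L z" by auto
  qed
qed

end

section \<open>Programs\<close>

definition wp :: "nat \<Rightarrow> com \<Rightarrow> (memory \<Rightarrow> nat list \<Rightarrow> nat \<Rightarrow> bool) \<Rightarrow> memory \<Rightarrow> nat list \<Rightarrow> nat \<Rightarrow> bool"
  where "wp W p Q M ys k \<longleftrightarrow> (\<exists>j M' ys'. exec W p (M, ys) j (M', ys') \<and> Q M' ys' (k + j))"

lemma wp_Seq:
  assumes "wp W p (wp W q Q) M ys k"
  shows "wp W (Seq p q) Q M ys k"
proof -
  from assms obtain j M' ys' j' M'' ys'' where
    "exec W p (M, ys) j (M', ys')" "exec W q (M', ys') j' (M'', ys'')" "Q M'' ys'' (k + j + j')"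
    unfolding wp_def by blast
  then show ?thesis unfolding wp_def using exec_Seq by (metis add.assoc)
qed

lemma wp_Cond:
  assumes "bval W M b \<Longrightarrow> wp W p Q M ys (k + (bcost b + 1))"
    and "\<not> bval W M b \<Longrightarrow> wp W q Q M ys (k + (bcost b + 1))"
  shows "wp W (Cond b p q) Q M ys k"
proof (cases "bval W M b")
  case True
  with assms(1) obtain j M' ys' where
    *: "exec W p (M, ys) j (M', ys')" "Q M' ys' (k + (bcost b + 1) + j)" unfolding wp_def by blast
  moreover have "k + (bcost b + 1) + j = k + (bcost b + j + 1)" by simp
  ultimately show ?thesis unfolding wp_def using exec_CondTrue[OF True *(1)] by metis
next
  case False
  with assms(2) obtain j M' ys' where
    *: "exec W q (M, ys) j (M', ys')" "Q M' ys' (k + (bcost b + 1) + j)" unfolding wp_def by blast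
  moreover have "k + (bcost b + 1) + j = k + (bcost b + j + 1)" by simp
  ultimately show ?thesis unfolding wp_def using exec_CondFalse[OF False *(1)] by metis
qed

text \<open>Termination comes for free: every iteration costs time, and the invariant bounds the time.\<close>

lemma wp_While:
  assumes "I M ys k"
    and bound: "\<And>M ys k. I M ys k \<Longrightarrow> k \<le> T"
    and body: "\<And>M ys k. I M ys k \<Longrightarrow> bval W M b \<Longrightarrow> wp W p I M ys (k + (bcost b + 1))"
    and exit: "\<And>M ys k. I M ys k \<Longrightarrow> \<not> bval W M b \<Longrightarrow> Q M ys (k + (bcost b + 1))"
  shows "wp W (While b p) Q M ys k"
  using assms(1)
proof (induct "T - k" arbitrary: M ys k rule: less_induct)
  case less
  show ?case
  proof (cases "bval W M b")
    case True
    obtain j M' ys' where 1: "exec W p (M, ys) j (M', ys')" "I M' ys' (k + (bcost b + 1) + j)"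
      using body[OF less(2) True] unfolding wp_def by blast
    have "T - (k + (bcost b + 1) + j) < T - k" using bound[OF 1(2)] by simp
    from less(1)[OF this 1(2)] obtain j' M'' ys'' where
      2: "exec W (While b p) (M', ys') j' (M'', ys'')" "Q M'' ys'' (k + (bcost b + 1) + j + j')"
      unfolding wp_def by blast
    have "k + (bcost b + 1) + j + j' = k + (bcost b + j + j' + 1)" by simp
    then show ?thesis unfolding wp_def using exec_WhileTrue[OF True 1(1) 2(1)] 2(2) by metis
  next
    case False
    then show ?thesis unfolding wp_def using exec_WhileFalse[OF False] exit[OF less(2) False] by blast
  qed
qed

lemma outputs_withinI:
  assumes "wp W p (\<lambda>M zs k. zs = ys \<and> k \<le> T) (input_memory xs) [] 0"
  shows "outputs_within W p xs T ys"
  using assms unfolding wp_def outputs_within_def by auto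

lemma wp_Skip_eq: "wp W Skip Q M ys k \<longleftrightarrow> Q M ys (k + 1)"
  unfolding wp_def using exec_Skip by (fastforce elim: exec.cases)

lemma wp_Store_eq: "wp W (Store a i e) Q M ys k \<longleftrightarrow>
    Q (M(a := (M a)(aval W M i := aval W M e))) ys (k + (acost i + acost e + 1))"
  unfolding wp_def using exec_Store by (fastforce elim: exec.cases)

lemma wp_Emit_eq: "wp W (Emit e) Q M ys k \<longleftrightarrow> Q M (ys @ [aval W M e]) (k + (acost e + 1))"
  unfolding wp_def using exec_Emit by (fastforce elim: exec.cases)

lemma wp_Cond_eq: "wp W (Cond b p q) Q M ys k \<longleftrightarrow>
    (if bval W M b then wp W p Q M ys (k + (bcost b + 1)) else wp W q Q M ys (k + (bcost b + 1)))"
proof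
  assume "wp W (Cond b p q) Q M ys k"
  then obtain j M' ys' where "exec W (Cond b p q) (M, ys) j (M', ys')" "Q M' ys' (k + j)"
    unfolding wp_def by blast
  then show "if bval W M b then wp W p Q M ys (k + (bcost b + 1)) else wp W q Q M ys (k + (bcost b + 1))"
    by (cases rule: exec.cases) (auto simp: wp_def add.assoc intro!: exI)
qed (auto intro: wp_Cond split: if_splits)

lemma wp_Seq_eq: "wp W (Seq p q) Q M ys k \<longleftrightarrow> wp W p (wp W q Q) M ys k"
proof
  assume "wp W (Seq p q) Q M ys k"
  then obtain j M' ys' where "exec W (Seq p q) (M, ys) j (M', ys')" "Q M' ys' (k + j)"
    unfolding wp_def by blast
  then show "wp W p (wp W q Q) M ys k"
  proof (cases rule: exec.cases)
    case (exec_Seq i c l)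
    then show ?thesis using \<open>Q M' ys' (k + j)\<close>
      by (cases c) (auto simp: wp_def add.assoc intro!: exI)
  qed
qed (rule wp_Seq)

lemmas wp_eqs = wp_Skip_eq wp_Store_eq wp_Emit_eq wp_Cond_eq wp_Seq_eq

definition frame :: "nat set \<Rightarrow> memory \<Rightarrow> memory \<Rightarrow> bool" where
  "frame S M0 M \<longleftrightarrow> (\<forall>a. a \<notin> S \<longrightarrow> M a = M0 a)"

lemma frame_refl: "frame S M M"
  by (simp add: frame_def)

lemma frame_upd: "a \<in> S \<Longrightarrow> frame S M0 (M(a := f)) \<longleftrightarrow> frame S M0 M"
  by (auto simp: frame_def)

lemma frameD: "frame S M0 M \<Longrightarrow> a \<notin> S \<Longrightarrow> M a = M0 a"
  by (simp add: frame_def)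

abbreviation seq_com :: "com \<Rightarrow> com \<Rightarrow> com" (infixr \<open>;;\<close> 60) where
  "p ;; q \<equiv> Seq p q"

abbreviation "var a \<equiv> Cell a (Const 0)"
abbreviation "setvar a e \<equiv> Store a (Const 0) e"
abbreviation "incr a \<equiv> Store a (Const 0) (Add (Cell a (Const 0)) (Const 1))"
abbreviation "pending h l e \<equiv> Neg (Conj (Neg (Less (Const 0) (var e))) (Neg (Less (var h) (var l))))"

text \<open>Otherwise running times turn into towers of \<^const>\<open>Suc\<close>.\<close>

declare One_nat_def [simp del]

text \<open>
  Memory layout: array 0 is the input; 2 and 3 hold the tails and heads of the arcs of the
  subdivided graph, 4 and 5 the linked lists of its arcs by tail, 6 and 7 those by head.
\<close>

definition lists_body :: com where
  "lists_body =
    incr 8 ;;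
    Cond (Less (Cell 0 (Const 1)) (var 8))
      (Store 2 (var 8) (Sub (Add (Cell 0 (Const 0)) (var 8)) (Add (Cell 0 (Const 1)) (Const 1))) ;;
       Store 3 (var 8) (Cell 0 (Add (Const 3) (var 8))))
      (Store 2 (var 8) (Cell 0 (Add (Const 3) (var 8))) ;;
       Store 3 (var 8) (Sub (Add (Cell 0 (Const 0)) (var 8)) (Const 1))) ;;
    Store 5 (var 8) (Cell 4 (Cell 2 (var 8))) ;;
    Store 4 (Cell 2 (var 8)) (var 8) ;;
    Store 7 (var 8) (Cell 6 (Cell 3 (var 8))) ;;
    Store 6 (Cell 3 (var 8)) (var 8)"

definition build_lists :: com where
  "build_lists = While (Less (var 8) (Add (Cell 0 (Const 1)) (Cell 0 (Const 1)))) lists_body"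

lemma wp_build_lists:
  assumes M0: "\<And>a. 2 \<le> a \<Longrightarrow> a < 9 \<Longrightarrow> M0 a = (\<lambda>_. 0)"
    and I: "M0 0 0 = n" "M0 0 1 = m"
    and W: "4 * (n + m) + 10 < W"
    and Q: "\<And>M k'. \<lbrakk>frame {2..<9} M0 M; arc_lists (M 2) (M 4) (M 5) (2 * m);
      arc_lists (M 3) (M 6) (M 7) (2 * m);
      \<And>e. 1 \<le> e \<Longrightarrow> e \<le> m \<Longrightarrow> M 2 e = M0 0 (3 + e) \<and> M 3 e = n + e - 1;
      \<And>e. m < e \<Longrightarrow> e \<le> 2 * m \<Longrightarrow> M 2 e = n + e - (m + 1) \<and> M 3 e = M0 0 (3 + e);
      k' \<le> k + 200 * m + 20\<rbrakk> \<Longrightarrow> Q M ys k'"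
  shows "wp W build_lists Q M0 ys k"
proof -
  define Inv where "Inv M zs j \<longleftrightarrow> frame {2..<9} M0 M \<and> zs = ys \<and> M 8 0 \<le> 2 * m \<and>
      arc_lists (M 2) (M 4) (M 5) (M 8 0) \<and> arc_lists (M 3) (M 6) (M 7) (M 8 0) \<and>
      (\<forall>e. 1 \<le> e \<longrightarrow> e \<le> m \<longrightarrow> e \<le> M 8 0 \<longrightarrow> M 2 e = M0 0 (3 + e) \<and> M 3 e = n + e - 1) \<and>
      (\<forall>e. m < e \<longrightarrow> e \<le> 2 * m \<longrightarrow> e \<le> M 8 0 \<longrightarrow> M 2 e = n + e - (m + 1) \<and> M 3 e = M0 0 (3 + e)) \<and>
      j + 100 * (2 * m - M 8 0) \<le> k + 200 * m" for M :: memory and zs :: "nat list" and j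
  have c: "1 mod W = 1" "3 mod W = 3" using W by auto
  show ?thesis unfolding build_lists_def
  proof (rule wp_While[of Inv _ _ _ "k + 200 * m"])
    show "Inv M0 ys k" using M0 by (auto simp: Inv_def frame_refl arc_lists_0)
    show "j \<le> k + 200 * m" if "Inv M zs j" for M zs j using that by (simp add: Inv_def)
  next
    fix M zs j
    assume inv: "Inv M zs j" and b: "bval W M (Less (var 8) (Add (Cell 0 (Const 1)) (Cell 0 (Const 1))))"
    have f: "M 0 = M0 0" using inv by (auto simp: Inv_def frame_def)
    have lt: "M 8 0 < 2 * m" using b f I W c by (auto simp: mult_2)
    have s: "(M 8 0 + 1) mod W = M 8 0 + 1" "(4 + M 8 0) mod W = 4 + M 8 0"
      "(n + (M 8 0 + 1)) mod W = n + (M 8 0 + 1)" "(m + 1) mod W = m + 1" using lt W by auto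
    have step: "Inv (M(8 := (M 8)(0 := M 8 0 + 1), 2 := (M 2)(M 8 0 + 1 := u), 3 := (M 3)(M 8 0 + 1 := v),
        5 := (M 5)(M 8 0 + 1 := M 4 u), 4 := (M 4)(u := M 8 0 + 1),
        7 := (M 7)(M 8 0 + 1 := M 6 v), 6 := (M 6)(v := M 8 0 + 1))) zs j'"
      if "if M 8 0 < m then u = M0 0 (4 + M 8 0) \<and> v = n + M 8 0 else u = n + M 8 0 - m \<and> v = M0 0 (4 + M 8 0)"
        "j' \<le> 90 + j" for u v j'
    proof -
      have "arc_lists ((M 2)(M 8 0 + 1 := u)) ((M 4)(u := M 8 0 + 1)) ((M 5)(M 8 0 + 1 := M 4 u)) (M 8 0 + 1)"
        "arc_lists ((M 3)(M 8 0 + 1 := v)) ((M 6)(v := M 8 0 + 1)) ((M 7)(M 8 0 + 1 := M 6 v)) (M 8 0 + 1)"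
        using inv by (auto simp: Inv_def intro!: arc_lists_Suc[unfolded Suc_eq_plus1])
      then show ?thesis using inv that lt
        by (auto simp: Inv_def frame_upd le_Suc_eq[unfolded Suc_eq_plus1] split: if_splits)
    qed
    show "wp W lists_body Inv M zs (j + (bcost (Less (var 8) (Add (Cell 0 (Const 1)) (Cell 0 (Const 1)))) + 1))"
      unfolding lists_body_def
      by (cases "m < M 8 0 + 1") (auto simp: wp_eqs c s f I intro!: step)
  next
    fix M zs j
    assume inv: "Inv M zs j" and b: "\<not> bval W M (Less (var 8) (Add (Cell 0 (Const 1)) (Cell 0 (Const 1))))"
    have f: "M 0 = M0 0" using inv by (auto simp: Inv_def frame_def)
    have "\<not> M 8 0 < 2 * m" using b f I W c by (auto simp: mult_2)
    then have c: "M 8 0 = 2 * m" using inv by (simp add: Inv_def)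
    show "Q M zs (j + (bcost (Less (var 8) (Add (Cell 0 (Const 1)) (Cell 0 (Const 1)))) + 1))"
      using inv c by (auto simp: Inv_def intro!: Q)
  qed
qed

definition visible_body :: com where
  "visible_body =
    Cond (Less (Const 0) (Cell 0 (Add (Add (Const 4) (Add (Cell 0 (Const 1)) (Cell 0 (Const 1)))) (var 16))))
      (setvar 9 (Const 1)) Skip ;;
    incr 16"

definition find_visible :: com where
  "find_visible = While (Less (var 16) (Add (Cell 0 (Const 0)) (Cell 0 (Const 1)))) visible_body"

lemma wp_find_visible:
  assumes M0: "M0 9 = (\<lambda>_. 0)" "M0 16 = (\<lambda>_. 0)"
    and I: "M0 0 0 = n" "M0 0 1 = m"
    and W: "4 * (n + m) + 10 < W"
    and Q: "\<And>M k'. \<lbrakk>frame {9, 16} M0 M; M 9 0 = 0 \<longleftrightarrow> (\<forall>x<n + m. M0 0 (4 + (m + m) + x) = 0);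
      k' \<le> k + 100 * (n + m) + 20\<rbrakk> \<Longrightarrow> Q M ys k'"
  shows "wp W find_visible Q M0 ys k"
proof -
  define Inv where "Inv M zs j \<longleftrightarrow> frame {9, 16} M0 M \<and> zs = ys \<and> M 16 0 \<le> n + m \<and>
      (M 9 0 = 0 \<longleftrightarrow> (\<forall>x<M 16 0. M0 0 (4 + (m + m) + x) = 0)) \<and>
      j + 100 * (n + m - M 16 0) \<le> k + 100 * (n + m)" for M :: memory and zs :: "nat list" and j
  have c: "1 mod W = 1" "4 mod W = 4" "(n + m) mod W = n + m" "(m + m) mod W = m + m"
    "(4 + (m + m)) mod W = 4 + (m + m)" using W by auto
  show ?thesis unfolding find_visible_def
  proof (rule wp_While[of Inv _ _ _ "k + 100 * (n + m)"])
    show "Inv M0 ys k" using M0 by (auto simp: Inv_def frame_refl)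
    show "j \<le> k + 100 * (n + m)" if "Inv M zs j" for M zs j using that by (simp add: Inv_def)
  next
    fix M zs j
    assume inv: "Inv M zs j" and b: "bval W M (Less (var 16) (Add (Cell 0 (Const 0)) (Cell 0 (Const 1))))"
    have f: "M 0 = M0 0" using inv by (auto simp: Inv_def frame_def)
    have lt: "M 16 0 < n + m" using b f I W c by auto
    have s: "(M 16 0 + 1) mod W = M 16 0 + 1" "(2 * m + 4) mod W = 2 * m + 4"
      "(2 * m + 4 + M 16 0) mod W = 2 * m + 4 + M 16 0"
      using lt W by auto
    show "wp W visible_body Inv M zs (j + (bcost (Less (var 16) (Add (Cell 0 (Const 0)) (Cell 0 (Const 1)))) + 1))"
      unfolding visible_body_def using inv lt
      by (auto simp: wp_eqs c s f I Inv_def frame_upd less_Suc_eq[unfolded Suc_eq_plus1])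
  next
    fix M zs j
    assume inv: "Inv M zs j" and b: "\<not> bval W M (Less (var 16) (Add (Cell 0 (Const 0)) (Cell 0 (Const 1))))"
    have f: "M 0 = M0 0" using inv by (auto simp: Inv_def frame_def)
    have "\<not> M 16 0 < n + m" using b f I W c by auto
    then have c: "M 16 0 = n + m" using inv by (simp add: Inv_def)
    show "Q M zs (j + (bcost (Less (var 16) (Add (Cell 0 (Const 0)) (Cell 0 (Const 1)))) + 1))"
      using inv c by (auto simp: Inv_def intro!: Q)
  qed
qed

text \<open>
  Backward search from \<open>t\<close>: queue 10 between head 11 and tail 12, current arc 13. Array 14 numbers
  the reached nodes from 1 on, array 15 gives the next node on the way to \<open>t\<close>.
\<close>

definition reach_body :: com where
  "reach_body =
    Cond (Less (Const 0) (var 13))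
      (Cond (Less (Cell 14 (Cell 2 (var 13))) (Const 1))
         (Store 10 (var 12) (Cell 2 (var 13)) ;;
          incr 12 ;;
          Store 14 (Cell 2 (var 13)) (var 12) ;;
          Store 15 (Cell 2 (var 13)) (Cell 3 (var 13)))
         Skip ;;
       setvar 13 (Cell 7 (var 13)))
      (setvar 13 (Cell 6 (Cell 10 (var 11))) ;;
       incr 11)"

definition reach :: com where
  "reach =
    setvar 10 (Cell 0 (Const 3)) ;;
    setvar 12 (Const 1) ;;
    Store 14 (Cell 0 (Const 3)) (Const 1) ;;
    While (pending 11 12 13) reach_body"

lemma (in arcs) wp_reach:
  assumes M0: "\<And>a. 10 \<le> a \<Longrightarrow> a < 16 \<Longrightarrow> M0 a = (\<lambda>_. 0)"
    and A: "M0 2 = U" "M0 3 = V" "M0 6 = fr" "M0 7 = nr" "M0 0 3 = t"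
    and t: "t < N" and W: "N + m + 10 < W"
    and Q: "\<And>M k'. \<lbrakk>frame {10..<16} M0 M; M 14 t = 1; \<And>x. M 14 x \<le> N; \<And>x. M 14 x \<noteq> 0 \<Longrightarrow> x < N;
      \<And>x. M 14 x \<noteq> 0 \<Longrightarrow> x \<noteq> t \<Longrightarrow> E x (M 15 x) \<and> M 14 (M 15 x) \<noteq> 0 \<and> M 14 (M 15 x) < M 14 x;
      \<And>x z. M 14 x \<noteq> 0 \<Longrightarrow> E z x \<Longrightarrow> M 14 z \<noteq> 0;
      k' \<le> k + 100 * (m + N) + 50\<rbrakk> \<Longrightarrow> Q M ys k'"
  shows "wp W reach Q M0 ys k"
proof -
  define T where "T = k + 100 * (m + N) + 20"
  define Inv where "Inv M zs j \<longleftrightarrow> frame {10..<16} M0 M \<and> zs = ys \<and>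
      inv1 t (M 10) (M 11 0) (M 12 0) (M 13 0) (M 14) (M 15) \<and>
      j + 100 * unscanned V m (M 10) (M 11 0) (M 13 0) + 100 * (N - M 11 0) \<le> T"
    for M :: memory and zs :: "nat list" and j
  have c: "1 mod W = 1" "3 mod W = 3" using W by auto
  have init: "inv1 t ((\<lambda>_. 0)(0 := t)) 0 1 0 ((\<lambda>_. 0)(t := 1)) (\<lambda>_. 0)" by (rule inv1_init[OF t])
  have "wp W (While (pending 11 12 13) reach_body) Q M zs j" if I0: "Inv M zs j" for M zs j
  proof (rule wp_While[of Inv _ _ _ T])
    show "Inv M zs j" by fact
    show "j \<le> T" if "Inv M zs j" for M zs j using that by (simp add: Inv_def)
  next
    fix M zs j
    assume inv: "Inv M zs j" and b: "bval W M (pending 11 12 13)"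
    have f: "M 0 = M0 0" "M 2 = U" "M 3 = V" "M 6 = fr" "M 7 = nr"
      using inv A by (auto simp: Inv_def frame_def)
    have i1: "inv1 t (M 10) (M 11 0) (M 12 0) (M 13 0) (M 14) (M 15)" using inv by (simp add: Inv_def)
    then have q: "queue_ok V N m (M 10) (M 11 0) (M 12 0) (M 13 0)" by (simp add: inv1_def)
    note le = queue_le[OF q]
    have s: "(M 12 0 + 1) mod W = M 12 0 + 1" "(M 11 0 + 1) mod W = M 11 0 + 1" using le W by auto
    show "wp W reach_body Inv M zs (j + (bcost (pending 11 12 13) + 1))"
    proof (cases "M 13 0 = 0")
      case True
      then have lt: "M 11 0 < M 12 0" using b by simp
      have i0: "inv1 t (M 10) (M 11 0) (M 12 0) 0 (M 14) (M 15)"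
        and q0: "queue_ok V N m (M 10) (M 11 0) (M 12 0) 0" using i1 q True by simp_all
      show ?thesis unfolding reach_body_def
        using inv True inv1_pop[OF i0 lt, unfolded Suc_eq_plus1]
          unscanned_pop[OF q0 lt V_lists, unfolded Suc_eq_plus1] lt le
        by (auto simp: wp_eqs c s f Inv_def frame_upd)
    next
      case False
      note us = unscanned_scan[OF q False V_lists, unfolded Suc_eq_plus1]
        unscanned_push[OF queue_scan(1)[OF q False V_lists]]
      show ?thesis
      proof (cases "M 14 (U (M 13 0)) = 0")
        case True
        show ?thesis unfolding reach_body_def
          using inv False True inv1_push[OF i1 False True, unfolded Suc_eq_plus1] us
          by (auto simp: wp_eqs c s f Inv_def frame_upd)
      next
        case nz: False
        show ?thesis unfolding reach_body_def
          using inv False nz inv1_skip[OF i1 False nz] us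
          by (auto simp: wp_eqs c s f Inv_def frame_upd)
      qed
    qed
  next
    fix M zs j
    assume inv: "Inv M zs j" and b: "\<not> bval W M (pending 11 12 13)"
    have i1: "inv1 t (M 10) (M 11 0) (M 12 0) (M 13 0) (M 14) (M 15)" using inv by (simp add: Inv_def)
    then have q: "queue_ok V N m (M 10) (M 11 0) (M 12 0) (M 13 0)" by (simp add: inv1_def)
    note le = queue_le[OF q]
    have "M 13 0 = 0" "M 11 0 = M 12 0" using b le by auto
    with i1 have i2: "inv1 t (M 10) (M 12 0) (M 12 0) 0 (M 14) (M 15)" by simp
    have *: "M 14 t = 1" "\<And>x. M 14 x \<le> M 12 0" "\<And>x. x \<in> M 10 ` {..<M 12 0} \<longleftrightarrow> M 14 x \<noteq> 0"
      "\<And>x. M 14 x \<noteq> 0 \<Longrightarrow> x \<noteq> t \<Longrightarrow> E x (M 15 x) \<and> M 14 (M 15 x) \<noteq> 0 \<and> M 14 (M 15 x) < M 14 x"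
      using i1 by (auto simp: inv1_def)
    have "x < N" if "M 14 x \<noteq> 0" for x
      using *(3)[of x] that q by (auto simp: queue_ok_def)
    moreover have "M 14 x \<le> N" for x using *(2)[of x] le by simp
    ultimately show "Q M zs (j + (bcost (pending 11 12 13) + 1))"
      using inv * inv1_final[OF i2] by (auto simp: Inv_def T_def intro!: Q)
  qed
  moreover have "Inv (M0(10 := (\<lambda>_. 0)(0 := t), 12 := (\<lambda>_. 0)(0 := 1), 14 := (\<lambda>_. 0)(t := 1))) ys (11 + k)"
    using init unscanned_le[of V m "(\<lambda>_. 0)(0 := t)" 0 0] M0 by (simp add: Inv_def T_def frame_upd frame_refl)
  ultimately show ?thesis unfolding reach_def using M0
    by (simp add: wp_eqs c A)
qed

text \<open>
  The \<open>s\<close>-\<open>t\<close> path of array 15 is copied to array 21, with last index 20 and current node 23; array 22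
  holds one plus the index of a path node and 0 off the path.
\<close>

definition path_body :: com where
  "path_body =
    setvar 23 (Cell 15 (var 23)) ;;
    incr 20 ;;
    Store 21 (var 20) (var 23) ;;
    Store 22 (var 23) (Add (var 20) (Const 1))"

definition find_path :: com where
  "find_path =
    setvar 23 (Cell 0 (Const 2)) ;;
    setvar 21 (Cell 0 (Const 2)) ;;
    Store 22 (Cell 0 (Const 2)) (Const 1) ;;
    While (Less (Const 1) (Cell 14 (var 23))) path_body"

lemma (in arcs) wp_find_path:
  assumes M0: "\<And>a. 20 \<le> a \<Longrightarrow> a < 24 \<Longrightarrow> M0 a = (\<lambda>_. 0)"
    and I: "M0 0 2 = s" and W: "N + 10 < W"
    and mk: "M0 14 t = 1" "\<And>x. M0 14 x \<le> N" "\<And>x. M0 14 x \<noteq> 0 \<Longrightarrow> x < N" "M0 14 s \<noteq> 0"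
      "\<And>x. M0 14 x \<noteq> 0 \<Longrightarrow> x \<noteq> t \<Longrightarrow> E x (M0 15 x) \<and> M0 14 (M0 15 x) \<noteq> 0 \<and> M0 14 (M0 15 x) < M0 14 x"
    and Q: "\<And>M k'. \<lbrakk>frame {20..<24} M0 M; arcs_path N m U V ff nf fr nr s t (M 21) (M 22) (M 20 0);
      k' \<le> k + 100 * N + 50\<rbrakk> \<Longrightarrow> Q M ys k'"
  shows "wp W find_path Q M0 ys k"
proof -
  define T where "T = k + 100 * N + 20"
  define Inv where "Inv M zs j \<longleftrightarrow> frame {20..<24} M0 M \<and> zs = ys \<and>
      M 21 0 = s \<and> M 21 (M 20 0) = M 23 0 \<and> (\<forall>i<M 20 0. E (M 21 i) (M 21 (Suc i))) \<and>
      (\<forall>i\<le>M 20 0. M 22 (M 21 i) = Suc i \<and> M 21 i < N) \<and>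
      (\<forall>y. M 22 y \<noteq> 0 \<longrightarrow> M 22 y \<le> Suc (M 20 0) \<and> M 21 (M 22 y - 1) = y \<and> M0 14 (M 23 0) \<le> M0 14 y) \<and>
      M0 14 (M 23 0) \<noteq> 0 \<and> M 20 0 + M0 14 (M 23 0) \<le> N \<and>
      j + 100 * M0 14 (M 23 0) \<le> T"
    for M :: memory and zs :: "nat list" and j
  have c: "1 mod W = 1" "2 mod W = 2" using W by auto
  have "wp W (While (Less (Const 1) (Cell 14 (var 23))) path_body) Q M zs j" if I0: "Inv M zs j" for M zs j
  proof (rule wp_While[of Inv _ _ _ T])
    show "Inv M zs j" by fact
    show "j \<le> T" if "Inv M zs j" for M zs j using that by (simp add: Inv_def)
  next
    fix M zs j
    assume inv: "Inv M zs j" and b: "bval W M (Less (Const 1) (Cell 14 (var 23)))"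
    have f: "M 0 = M0 0" "M 14 = M0 14" "M 15 = M0 15" using inv by (auto simp: Inv_def frame_def)
    let ?x = "M 23 0" and ?l = "M 20 0" and ?y = "M0 15 (M 23 0)"
    have x: "M0 14 ?x > 1" using b f c by simp
    then have "?x \<noteq> t" using mk(1) by auto
    then have y: "E ?x ?y" "M0 14 ?y \<noteq> 0" "M0 14 ?y < M0 14 ?x" using mk(5)[of ?x] x by auto
    have yN: "?y < N" using mk(3) y by simp
    have y0: "M 22 ?y = 0" using inv y(3) unfolding Inv_def by (metis not_le)
    have ny: "M 21 i \<noteq> ?y" if "i \<le> ?l" for i using inv that y0 unfolding Inv_def by (metis nat.distinct(1))
    have s: "(?l + 1) mod W = ?l + 1" "(?l + 1 + 1) mod W = Suc (Suc ?l)" using inv W x by (auto simp: Inv_def)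
    have "Inv (M(23 := (M 23)(0 := ?y), 20 := (M 20)(0 := ?l + 1), 21 := (M 21)(?l + 1 := ?y),
        22 := (M 22)(?y := Suc (Suc ?l)))) zs (29 + j)"
      unfolding Inv_def
    proof (intro conjI, goal_cases)
      case 5
      show ?case using inv y by (auto simp: Inv_def less_Suc_eq)
    next
      case 6
      show ?case using inv y yN ny by (auto simp: Inv_def le_Suc_eq)
    next
      case 7
      have old: "M 22 v \<le> Suc ?l \<and> M 21 (M 22 v - 1) = v \<and> M0 14 ?x \<le> M0 14 v" if "M 22 v \<noteq> 0" for v
        using inv that by (auto simp: Inv_def)
      have "M0 14 ?y \<le> M0 14 v \<and> M 22 v \<le> Suc (?l + 1) \<and> M 22 v - 1 \<noteq> ?l + 1" if "M 22 v \<noteq> 0" for v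
        using old[OF that] y(3) by auto
      then show ?case using old by auto
    qed (use inv y in \<open>auto simp: Inv_def frame_upd\<close>)
    then show "wp W path_body Inv M zs (j + (bcost (Less (Const 1) (Cell 14 (var 23))) + 1))"
      unfolding path_body_def by (simp add: wp_eqs c s f)
  next
    fix M zs j
    assume inv: "Inv M zs j" and b: "\<not> bval W M (Less (Const 1) (Cell 14 (var 23)))"
    have f: "M 0 = M0 0" "M 14 = M0 14" using inv by (auto simp: Inv_def frame_def)
    have x: "M0 14 (M 23 0) \<le> 1" "M0 14 (M 23 0) \<noteq> 0" using b f c inv by (auto simp: Inv_def)
    have "M 23 0 = t" using mk(5)[of "M 23 0"] x by (metis One_nat_def le_Suc_eq le_zero_eq less_one not_less_zero)
    then have "arcs_path N m U V ff nf fr nr s t (M 21) (M 22) (M 20 0)"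
      using inv by unfold_locales (auto simp: Inv_def)
    then show "Q M zs (j + (bcost (Less (Const 1) (Cell 14 (var 23))) + 1))"
      using inv by (auto simp: Inv_def T_def intro!: Q)
  qed
  moreover have "Inv (M0(23 := (\<lambda>_. 0)(0 := s), 21 := (\<lambda>_. 0)(0 := s), 22 := (\<lambda>_. 0)(s := 1))) ys (12 + k)"
    using M0 mk(2)[of s] mk(3,4) by (auto simp: Inv_def T_def frame_upd frame_refl)
  ultimately show ?thesis unfolding find_path_def using M0
    by (simp add: wp_eqs c I)
qed

abbreviation "visible x \<equiv> Less (Const 0) (Cell 0 (Add (Add (Const 4) (Add (Cell 0 (Const 1)) (Cell 0 (Const 1)))) x))"

text \<open>
  Search along the path: queue 30 with head 31, tail 32 and current arc 33; layers 34, number of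
  the current layer 35, the visible nodes on every path 36, one plus the farthest path index that has
  been seen 37, next path index 38.
\<close>

definition layers_body :: com where
  "layers_body =
    Cond (Less (Const 0) (var 33))
      (Cond (Less (Const 0) (Cell 22 (Cell 3 (var 33))))
         (Cond (Less (var 37) (Cell 22 (Cell 3 (var 33)))) (setvar 37 (Cell 22 (Cell 3 (var 33)))) Skip)
         (Cond (Less (Cell 34 (Cell 3 (var 33))) (Const 1))
            (Store 34 (Cell 3 (var 33)) (var 35) ;;
             Store 30 (var 32) (Cell 3 (var 33)) ;;
             incr 32)
            Skip) ;;
       setvar 33 (Cell 5 (var 33)))
      (Cond (Less (var 31) (var 32))
         (setvar 33 (Cell 4 (Cell 30 (var 31))) ;;
          incr 31)
         (Cond (Conj (Neg (Less (Add (var 38) (Const 1)) (var 37))) (visible (Cell 21 (var 38))))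
            (incr 35 ;; Store 36 (var 35) (Cell 21 (var 38))) Skip ;;
          Store 34 (Cell 21 (var 38)) (var 35) ;;
          Store 30 (var 32) (Cell 21 (var 38)) ;;
          incr 32 ;;
          incr 38))"

abbreviation "layers_cond \<equiv> Neg (Conj (Conj (Neg (Less (Const 0) (var 33))) (Neg (Less (var 31) (var 32))))
    (Less (var 20) (var 38)))"

definition find_layers :: com where
  "find_layers = setvar 35 (Const 1) ;; While layers_cond layers_body"

lemma (in arcs_path) wp_find_layers:
  assumes M0: "\<And>a. 30 \<le> a \<Longrightarrow> a < 39 \<Longrightarrow> M0 a = (\<lambda>_. 0)"
    and A: "M0 3 = V" "M0 4 = ff" "M0 5 = nf" "M0 20 0 = len" "M0 21 = P" "M0 22 = pos" "M0 0 1 = mm"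
    and vis: "\<And>x. x < N \<Longrightarrow> vis x \<longleftrightarrow> 0 < M0 0 (2 * mm + 4 + x)"
    and W: "N + m + 2 * mm + 10 < W"
    and Q: "\<And>M k'. \<lbrakk>frame {30..<39} M0 M; layered E s t vis (M 34) (M 36) (M 35 0); M 35 0 \<le> N + 1;
      \<And>b. 2 \<le> b \<Longrightarrow> b \<le> M 35 0 \<Longrightarrow> M 36 b < N;
      k' \<le> k + 100 * m + 400 * N + 50\<rbrakk> \<Longrightarrow> Q M ys k'"
  shows "wp W find_layers Q M0 ys k"
proof -
  define T where "T = k + 100 * m + 400 * N + 20"
  define Inv where "Inv M zs j \<longleftrightarrow> frame {30..<39} M0 M \<and> zs = ys \<and>
      inv2 (M 38 0) (M 31 0) (M 32 0) (M 33 0) (M 30) (M 34) (M 35 0) (M 36) (M 37 0) \<and>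
      j + 100 * unscanned U m (M 30) (M 31 0) (M 33 0) + 100 * (N - M 31 0) + 200 * (Suc len - M 38 0) \<le> T"
    for M :: memory and zs :: "nat list" and j
  have c: "1 mod W = 1" "4 mod W = 4" "(mm + mm) mod W = 2 * mm" "(4 + 2 * mm) mod W = 2 * mm + 4" using W by auto
  have "wp W (While layers_cond layers_body) Q M zs j" if I0: "Inv M zs j" for M zs j
  proof (rule wp_While[of Inv _ _ _ T])
    show "Inv M zs j" by fact
    show "j \<le> T" if "Inv M zs j" for M zs j using that by (simp add: Inv_def)
  next
    fix M zs j
    assume inv: "Inv M zs j" and b: "bval W M layers_cond"
    have f: "M 0 = M0 0" "M 3 = V" "M 4 = ff" "M 5 = nf" "M 20 0 = len" "M 21 = P" "M 22 = pos"
      using inv A by (auto simp: Inv_def frame_def)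
    have i2: "inv2 (M 38 0) (M 31 0) (M 32 0) (M 33 0) (M 30) (M 34) (M 35 0) (M 36) (M 37 0)"
      using inv by (simp add: Inv_def)
    then have q: "queue_ok U N m (M 30) (M 31 0) (M 32 0) (M 33 0)"
      and bd: "M 38 0 \<le> Suc len" "M 35 0 \<le> Suc (M 38 0)" by (auto elim: inv2.cases)
    note le = queue_le[OF q]
    have s: "(M 32 0 + 1) mod W = M 32 0 + 1" "(M 31 0 + 1) mod W = M 31 0 + 1"
      "(M 35 0 + 1) mod W = M 35 0 + 1" "(M 38 0 + 1) mod W = M 38 0 + 1"
      using le W bd len_less by auto
    show "wp W layers_body Inv M zs (j + (bcost layers_cond + 1))"
    proof (cases "M 33 0 = 0")
      case e0: True
      have i0: "inv2 (M 38 0) (M 31 0) (M 32 0) 0 (M 30) (M 34) (M 35 0) (M 36) (M 37 0)"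
        and q0: "queue_ok U N m (M 30) (M 31 0) (M 32 0) 0" using i2 q e0 by simp_all
      show ?thesis
      proof (cases "M 31 0 < M 32 0")
        case lt: True
        show ?thesis unfolding layers_body_def
          using inv e0 inv2_pop[OF i0 lt, unfolded Suc_eq_plus1]
            unscanned_pop[OF q0 lt U_lists, unfolded Suc_eq_plus1] lt le
          by (auto simp: wp_eqs c s f Inv_def frame_upd)
      next
        case False
        then have hl: "M 31 0 = M 32 0" using le by simp
        have il: "M 38 0 \<le> len" using b e0 False f by auto
        have iP: "inv2 (M 38 0) (M 32 0) (M 32 0) 0 (M 30) (M 34) (M 35 0) (M 36) (M 37 0)"
          using i0 hl by simp
        let ?p = "P (M 38 0)"
        have p: "?p < N" using P_less il by simp
        have sp: "(2 * mm + 4 + ?p) mod W = 2 * mm + 4 + ?p" using p W by simp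
        have up: "unscanned U m ((M 30)(M 32 0 := ?p)) (M 31 0) 0 = unscanned U m (M 30) (M 31 0) 0"
          by (rule unscanned_push[OF q0])
        show ?thesis
        proof (cases "\<not> M 38 0 + 1 < M 37 0 \<and> vis ?p")
          case True
          have new: "if \<not> Suc (M 38 0) < M 37 0 \<and> vis ?p
              then Suc (M 35 0) = Suc (M 35 0) \<and> (M 36)(Suc (M 35 0) := ?p) = (M 36)(Suc (M 35 0) := ?p)
              else Suc (M 35 0) = M 35 0 \<and> (M 36)(Suc (M 35 0) := ?p) = M 36"
            using True by simp
          show ?thesis unfolding layers_body_def
            using inv e0 hl True vis[OF p] inv2_phase[OF iP il new, unfolded Suc_eq_plus1] up il
            by (auto simp: wp_eqs c s sp f A Inv_def frame_upd)
        next
          case False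
          have new: "if \<not> Suc (M 38 0) < M 37 0 \<and> vis ?p
              then M 35 0 = Suc (M 35 0) \<and> M 36 = (M 36)(Suc (M 35 0) := ?p)
              else M 35 0 = M 35 0 \<and> M 36 = M 36"
            using False by auto
          show ?thesis unfolding layers_body_def
            using inv e0 hl False vis[OF p] inv2_phase[OF iP il new, unfolded Suc_eq_plus1] up il
            by (auto simp: wp_eqs c s sp f A Inv_def frame_upd)
        qed
      qed
    next
      case e: False
      note us = unscanned_scan[OF q e U_lists, unfolded Suc_eq_plus1]
        unscanned_push[OF queue_scan(1)[OF q e U_lists]]
      show ?thesis
      proof (cases "pos (V (M 33 0)) = 0")
        case p0: True
        show ?thesis
        proof (cases "M 34 (V (M 33 0)) = 0")
          case True
          show ?thesis unfolding layers_body_def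
            using inv e p0 True inv2_push[OF i2 e p0 True, unfolded Suc_eq_plus1] us
            by (auto simp: wp_eqs c s f Inv_def frame_upd)
        next
          case False
          show ?thesis unfolding layers_body_def
            using inv e p0 False inv2_skip[OF i2 e p0 False] us
            by (auto simp: wp_eqs c s f Inv_def frame_upd)
        qed
      next
        case p: False
        show ?thesis unfolding layers_body_def
          using inv e p inv2_scan_path[OF i2 e p] us
          by (cases "M 37 0 < pos (V (M 33 0))") (auto simp: wp_eqs c s f Inv_def frame_upd max_def)
      qed
    qed
  next
    fix M zs j
    assume inv: "Inv M zs j" and b: "\<not> bval W M layers_cond"
    have f: "M 20 0 = len" using inv A by (auto simp: Inv_def frame_def)
    have i2: "inv2 (M 38 0) (M 31 0) (M 32 0) (M 33 0) (M 30) (M 34) (M 35 0) (M 36) (M 37 0)"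
      using inv by (simp add: Inv_def)
    then have q: "queue_ok U N m (M 30) (M 31 0) (M 32 0) (M 33 0)"
      and bd: "M 38 0 \<le> Suc len" "M 35 0 \<le> Suc (M 38 0)" by (auto elim: inv2.cases)
    note le = queue_le[OF q]
    have eq: "M 33 0 = 0" "M 31 0 = M 32 0" "M 38 0 = Suc len" using b le bd f by auto
    have "layered E s t vis (M 34) (M 36) (M 35 0)"
      by (rule inv2_final) (use i2 eq in simp)
    then show "Q M zs (j + (bcost layers_cond + 1))"
      using inv inv2_Y_less[OF i2] bd len_less eq by (auto simp: Inv_def T_def intro!: Q)
  qed
  moreover have "Inv (M0(35 := (\<lambda>_. 0)(0 := 1))) ys (k + 3)"
    using M0 inv2_init[of "\<lambda>_. 0" "\<lambda>_. 0"] unscanned_le[of U m "\<lambda>_. 0" 0 0] len_less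
    by (simp add: Inv_def T_def frame_upd frame_refl)
  ultimately show ?thesis unfolding find_layers_def using M0
    by (simp add: wp_eqs c)
qed

text \<open>
  Backward searches from \<open>Y K, \<dots>, Y 3\<close>: queue 40 with head 41, tail 42 and current arc 43;
  marks 44, current layer 45, limits 46.
\<close>

definition limits_body :: com where
  "limits_body =
    Cond (Less (Const 0) (var 43))
      (Cond (Conj (Less (Const 0) (Cell 34 (Cell 2 (var 43))))
               (Neg (Conj (Neg (Less (Cell 2 (var 43)) (Cell 36 (var 45))))
                 (Neg (Less (Cell 36 (var 45)) (Cell 2 (var 43)))))))
         (Cond (Conj (Neg (Conj (Neg (Less (var 45) (Cell 34 (Cell 2 (var 43)))))
                   (Neg (visible (Cell 2 (var 43))))))
                 (Less (Cell 34 (Cell 2 (var 43))) (Cell 46 (var 45))))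
            (Store 46 (var 45) (Cell 34 (Cell 2 (var 43)))) Skip ;;
          Cond (Conj (Neg (Less (var 45) (Cell 34 (Cell 2 (var 43))))) (Less (Cell 44 (Cell 2 (var 43))) (Const 1)))
            (Store 44 (Cell 2 (var 43)) (Const 1) ;;
             Store 40 (var 42) (Cell 2 (var 43)) ;;
             incr 42)
            Skip)
         Skip ;;
       setvar 43 (Cell 7 (var 43)))
      (Cond (Less (var 41) (var 42))
         (setvar 43 (Cell 6 (Cell 40 (var 41))) ;;
          incr 41)
         (Store 44 (Cell 36 (var 45)) (Const 1) ;;
          Store 40 (var 42) (Cell 36 (var 45)) ;;
          incr 42 ;;
          Store 46 (Sub (var 45) (Const 1)) (Cell 46 (var 45)) ;;
          setvar 45 (Sub (var 45) (Const 1))))"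

abbreviation "limits_cond \<equiv> Neg (Conj (Conj (Neg (Less (Const 0) (var 43))) (Neg (Less (var 41) (var 42))))
    (Less (var 45) (Const 3)))"

definition find_limits :: com where
  "find_limits = setvar 45 (var 35) ;; Store 46 (var 35) (var 35) ;; While limits_cond limits_body"

lemma (in arcs_layered) wp_find_limits:
  assumes M0: "\<And>a. 40 \<le> a \<Longrightarrow> a < 47 \<Longrightarrow> M0 a = (\<lambda>_. 0)"
    and A: "M0 2 = U" "M0 6 = fr" "M0 7 = nr" "M0 34 = L" "M0 36 = Y" "M0 35 0 = K" "M0 0 1 = mm"
    and vis: "\<And>x. x < N \<Longrightarrow> vis x \<longleftrightarrow> 0 < M0 0 (2 * mm + 4 + x)"
    and W: "N + m + 2 * mm + 10 < W"
    and Q: "\<And>M k'. \<lbrakk>frame {40..<47} M0 M; layered_limits E s t vis L Y K (M 46);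
      k' \<le> k + 200 * m + 100 * N + 100 * K + 50\<rbrakk> \<Longrightarrow> Q M ys k'"
  shows "wp W find_limits Q M0 ys k"
proof -
  define T where "T = k + 200 * m + 100 * N + 100 * K + 20"
  define Inv where "Inv M zs j \<longleftrightarrow> frame {40..<47} M0 M \<and> zs = ys \<and>
      inv3 (M 45 0) (M 41 0) (M 42 0) (M 43 0) (M 40) (M 44) (M 46) \<and>
      j + 200 * unscanned V m (M 40) (M 41 0) (M 43 0) + 100 * (N - M 41 0) + 100 * M 45 0 \<le> T"
    for M :: memory and zs :: "nat list" and j
  have c: "1 mod W = 1" "3 mod W = 3" "4 mod W = 4" "(mm + mm) mod W = 2 * mm" "(4 + 2 * mm) mod W = 2 * mm + 4"
    using W by auto
  have "wp W (While limits_cond limits_body) Q M zs j" if I0: "Inv M zs j" for M zs j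
  proof (rule wp_While[of Inv _ _ _ T])
    show "Inv M zs j" by fact
    show "j \<le> T" if "Inv M zs j" for M zs j using that by (simp add: Inv_def)
  next
    fix M zs j
    assume inv: "Inv M zs j" and b: "bval W M limits_cond"
    have f: "M 0 = M0 0" "M 2 = U" "M 6 = fr" "M 7 = nr" "M 34 = L" "M 36 = Y" "M 35 0 = K"
      using inv A by (auto simp: Inv_def frame_def)
    have i3: "inv3 (M 45 0) (M 41 0) (M 42 0) (M 43 0) (M 40) (M 44) (M 46)"
      using inv by (simp add: Inv_def)
    then have q: "queue_ok V N m (M 40) (M 41 0) (M 42 0) (M 43 0)" by (auto elim: inv3.cases)
    note le = queue_le[OF q]
    have s: "(M 42 0 + 1) mod W = M 42 0 + 1" "(M 41 0 + 1) mod W = M 41 0 + 1"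
      using le W by auto
    show "wp W limits_body Inv M zs (j + (bcost limits_cond + 1))"
    proof (cases "M 43 0 = 0")
      case e0: True
      have i0: "inv3 (M 45 0) (M 41 0) (M 42 0) 0 (M 40) (M 44) (M 46)"
        and q0: "queue_ok V N m (M 40) (M 41 0) (M 42 0) 0" using i3 q e0 by simp_all
      show ?thesis
      proof (cases "M 41 0 < M 42 0")
        case lt: True
        show ?thesis unfolding limits_body_def
          using inv e0 inv3_pop[OF i0 lt, unfolded Suc_eq_plus1]
            unscanned_pop[OF q0 lt V_lists, unfolded Suc_eq_plus1] lt le
          by (auto simp: wp_eqs c s f Inv_def frame_upd)
      next
        case False
        then have hl: "M 41 0 = M 42 0" using le by simp
        have il: "2 < M 45 0" using b e0 False c by auto
        have iP: "inv3 (M 45 0) (M 42 0) (M 42 0) 0 (M 40) (M 44) (M 46)"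
          using i0 hl by simp
        have up: "unscanned V m ((M 40)(M 42 0 := Y (M 45 0))) (M 41 0) 0 = unscanned V m (M 40) (M 41 0) 0"
          by (rule unscanned_push[OF q0])
        show ?thesis unfolding limits_body_def
          using inv e0 hl inv3_phase[OF iP il, of 1, unfolded Suc_eq_plus1] up il
          by (auto simp: wp_eqs c s f Inv_def frame_upd)
      qed
    next
      case e: False
      let ?e = "M 43 0" and ?b = "M 45 0"
      let ?z = "U (M 43 0)"
      note a = inv3_arc[OF i3 e]
      note us = unscanned_scan[OF q e V_lists, unfolded Suc_eq_plus1]
        unscanned_push[OF queue_scan(1)[OF q e V_lists]]
      have sz: "(2 * mm + 4 + ?z) mod W = 2 * mm + 4 + ?z" using a(7) W by simp
      show ?thesis
      proof (cases "L ?z = 0 \<or> ?z = Y ?b")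
        case True
        then have "inv3 ?b (M 41 0) (M 42 0) (nr ?e) (M 40) (M 44) (M 46)"
          by (intro inv3_next[OF i3 e]) auto
        then show ?thesis unfolding limits_body_def
          using inv e True us
          by (auto simp: wp_eqs c s f Inv_def frame_upd)
      next
        case z: False
        then have zb: "?b \<le> L ?z" "0 < L ?z" "?z \<noteq> Y ?b" using a(8) by auto
        then have nz: "?z < Y ?b \<or> Y ?b < ?z" by auto
        define r' where "r' = (if (?b < L ?z \<or> vis ?z) \<and> L ?z < M 46 ?b then (M 46)(?b := L ?z) else M 46)"
        have i4: "inv3 ?b (M 41 0) (M 42 0) ?e (M 40) (M 44) r'"
          using inv3_limit[OF i3 e] zb i3 by (auto simp: r'_def)
        have r': "?b < L ?z \<or> vis ?z \<longrightarrow> r' ?b \<le> L ?z" by (auto simp: r'_def)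
        show ?thesis
        proof (cases "L ?z = ?b \<and> M 44 ?z = 0")
          case True
          have "inv3 ?b (M 41 0) (M 42 0 + 1) ?e ((M 40)(M 42 0 := ?z)) ((M 44)(?z := 1)) r'"
            using inv3_push[OF i4 e _ zb(3), of 1, unfolded Suc_eq_plus1] True by simp
          then have "inv3 ?b (M 41 0) (M 42 0 + 1) (nr ?e) ((M 40)(M 42 0 := ?z)) ((M 44)(?z := 1)) r'"
            using e by (rule inv3_next) (use r' in auto)
          then show ?thesis unfolding limits_body_def
            using inv e True nz zb us vis[OF a(7)]
            by (auto simp: wp_eqs c s sz f A Inv_def frame_upd r'_def split: if_splits)
        next
          case False
          have "inv3 ?b (M 41 0) (M 42 0) (nr ?e) (M 40) (M 44) r'"
            using i4 e by (rule inv3_next) (use r' False in auto)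
          then show ?thesis unfolding limits_body_def
            using inv e False nz zb us vis[OF a(7)]
            by (auto simp: wp_eqs c s sz f A Inv_def frame_upd r'_def split: if_splits)
        qed
      qed
    qed
  next
    fix M zs j
    assume inv: "Inv M zs j" and b: "\<not> bval W M limits_cond"
    have i3: "inv3 (M 45 0) (M 41 0) (M 42 0) (M 43 0) (M 40) (M 44) (M 46)"
      using inv by (simp add: Inv_def)
    then have q: "queue_ok V N m (M 40) (M 41 0) (M 42 0) (M 43 0)" by (auto elim: inv3.cases)
    have eq: "M 43 0 = 0" "M 41 0 = M 42 0" "M 45 0 \<le> 2" using b queue_le[OF q] c by auto
    have "layered_limits E s t vis L Y K (M 46)"
      by (rule inv3_final) (use i3 eq in auto)
    then show "Q M zs (j + (bcost limits_cond + 1))"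
      using inv by (auto simp: Inv_def T_def intro!: Q)
  qed
  moreover have "Inv (M0(45 := (\<lambda>_. 0)(0 := K), 46 := (\<lambda>_. 0)(K := K))) ys (9 + k)"
    using M0 inv3_init[of "\<lambda>_. 0" "\<lambda>_. 0"] unscanned_le[of V m "\<lambda>_. 0" 0 0]
    by (simp add: Inv_def T_def frame_upd frame_refl)
  ultimately show ?thesis unfolding find_limits_def using M0
    by (simp add: wp_eqs c A)
qed

definition emit_array :: "nat \<Rightarrow> com" where
  "emit_array a = setvar 50 (Const 2) ;; While (Neg (Less (var 35) (var 50))) (Emit (Cell a (var 50)) ;; incr 50)"

lemma wp_emit_array:
  assumes W: "M0 35 0 + 10 < W" and a: "a \<noteq> 50" and K: "1 \<le> M0 35 0"
    and Q: "\<And>M k'. \<lbrakk>frame {50} M0 M; k' \<le> k + 100 * M0 35 0 + 50\<rbrakk> \<Longrightarrow>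
      Q M (ys @ map (M0 a) [2..<Suc (M0 35 0)]) k'"
  shows "wp W (emit_array a) Q M0 ys k"
proof -
  define T where "T = k + 100 * M0 35 0 + 20"
  define Inv where "Inv M zs j \<longleftrightarrow> frame {50} M0 M \<and> zs = ys @ map (M0 a) [2..<M 50 0] \<and>
      2 \<le> M 50 0 \<and> M 50 0 \<le> M0 35 0 + 1 \<and> j + 100 * (M0 35 0 + 1 - M 50 0) \<le> T"
    for M :: memory and zs :: "nat list" and j
  have c: "1 mod W = 1" "2 mod W = 2" using W by auto
  let ?b = "Neg (Less (var 35) (var 50))"
  have "wp W (While ?b (Emit (Cell a (var 50)) ;; incr 50)) Q M zs j" if I0: "Inv M zs j" for M zs j
  proof (rule wp_While[of Inv _ _ _ T])
    show "Inv M zs j" by fact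
    show "j \<le> T" if "Inv M zs j" for M zs j using that by (simp add: Inv_def)
  next
    fix M zs j
    assume inv: "Inv M zs j" and b: "bval W M ?b"
    have f: "M 35 = M0 35" "M a = M0 a" using inv a by (auto simp: Inv_def frame_def)
    have "(M 50 0 + 1) mod W = M 50 0 + 1" using inv W by (auto simp: Inv_def)
    then show "wp W (Emit (Cell a (var 50)) ;; incr 50) Inv M zs (j + (bcost ?b + 1))"
      using inv b f by (auto simp: wp_eqs c Inv_def frame_upd upt_Suc[unfolded Suc_eq_plus1])
  next
    fix M zs j
    assume inv: "Inv M zs j" and b: "\<not> bval W M ?b"
    have f: "M 35 = M0 35" using inv by (auto simp: Inv_def frame_def)
    then have "M 50 0 = Suc (M0 35 0)" using inv b by (auto simp: Inv_def)
    then show "Q M zs (j + (bcost ?b + 1))"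
      using inv by (auto simp: Inv_def T_def simp del: upt_Suc intro!: Q)
  qed
  moreover have "Inv (M0(50 := (M0 50)(0 := 2))) ys (k + 3)"
    using K by (simp add: Inv_def T_def frame_upd frame_refl)
  ultimately show ?thesis unfolding emit_array_def
    by (simp add: wp_eqs c)
qed

definition build :: com where
  "build = build_lists ;; find_visible ;; reach ;;
    Cond (Less (Const 0) (Cell 14 (Cell 0 (Const 2))))
      (find_path ;; find_layers ;; find_limits ;; Emit (var 35) ;; emit_array 36 ;; emit_array 46)
      (Cond (Less (Const 0) (var 9)) Skip (Emit (Const 1)))"

text \<open>
  The representation \<open>K, Y 2, \<dots>, Y K, r 2, \<dots>, r K\<close> has \<open>Y b\<close> in cell \<open>b - 1\<close> and \<open>r b\<close> in cell
  \<open>K + b - 2\<close>; the last limit is kept in 3 to skip the starts that do not raise it.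
\<close>

definition report_seq :: com where
  "report_seq =
    Emit (Sub (Add (Cell 0 (Sub (Add (Cell 0 (Const 0)) (var 2)) (Const 2))) (Const 1)) (var 2)) ;;
    setvar 4 (var 2) ;;
    While (Neg (Less (Cell 0 (Sub (Add (Cell 0 (Const 0)) (var 2)) (Const 2))) (var 4)))
      (Emit (Cell 0 (Sub (var 4) (Const 1))) ;; incr 4)"

definition report_body :: com where
  "report_body =
    Cond (Less (var 3) (Cell 0 (Sub (Add (Cell 0 (Const 0)) (var 2)) (Const 2))))
      report_seq Skip ;;
    setvar 3 (Cell 0 (Sub (Add (Cell 0 (Const 0)) (var 2)) (Const 2))) ;;
    incr 2"

definition report :: com where
  "report =
    Cond (Less (Const 0) (Cell 0 (Const 0)))
      (Cond (Less (Cell 0 (Const 0)) (Const 2)) (Emit (Const 0))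
        (setvar 2 (Const 2) ;; While (Neg (Less (Cell 0 (Const 0)) (var 2))) report_body))
      Skip"

definition starts :: "(nat \<Rightarrow> nat) \<Rightarrow> nat \<Rightarrow> bool" where
  "starts r i \<longleftrightarrow> i = 2 \<or> r (i - 1) < r i"

locale representation =
  fixes M0 :: memory and K :: nat and Y r :: "nat \<Rightarrow> nat" and W :: nat
  assumes K: "M0 0 0 = K" "2 \<le> K" and Y: "\<And>b. 2 \<le> b \<Longrightarrow> b \<le> K \<Longrightarrow> M0 0 (b - 1) = Y b"
    and r: "\<And>b. 2 \<le> b \<Longrightarrow> b \<le> K \<Longrightarrow> M0 0 (K + b - 2) = r b \<and> b \<le> r b \<and> r b \<le> K"
    and W: "2 * K + 10 < W"
begin

lemma wp_report_seq:
  assumes M: "M 0 = M0 0" "2 \<le> M 2 0" "M 2 0 \<le> K"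
    and Q: "\<And>M' k'. \<lbrakk>frame {4} M M'; k' \<le> k + 100 * (r (M 2 0) + 1 - M 2 0) + 50\<rbrakk> \<Longrightarrow>
      Q M' (ys @ (r (M 2 0) + 1 - M 2 0) # map Y [M 2 0..<Suc (r (M 2 0))]) k'"
  shows "wp W report_seq Q M ys k"
proof -
  let ?i = "M 2 0"
  define T where "T = k + 100 * (r ?i + 1 - ?i) + 30"
  define Inv where "Inv M' zs j \<longleftrightarrow> frame {4} M M' \<and> zs = ys @ (r ?i + 1 - ?i) # map Y [?i..<M' 4 0] \<and>
      ?i \<le> M' 4 0 \<and> M' 4 0 \<le> r ?i + 1 \<and> j + 100 * (r ?i + 1 - M' 4 0) \<le> T"
    for M' :: memory and zs :: "nat list" and j
  let ?b = "Neg (Less (Cell 0 (Sub (Add (Cell 0 (Const 0)) (var 2)) (Const 2))) (var 4))"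
  have ri: "M0 0 (K + ?i - 2) = r ?i" "?i \<le> r ?i" "r ?i \<le> K" using r[OF M(2,3)] by auto
  have c: "1 mod W = 1" "2 mod W = 2" "(K + ?i) mod W = K + ?i" "(r ?i + 1) mod W = r ?i + 1" using W M ri by auto
  have "wp W (While ?b (Emit (Cell 0 (Sub (var 4) (Const 1))) ;; incr 4)) Q M' zs j" if I0: "Inv M' zs j" for M' zs j
  proof (rule wp_While[of Inv _ _ _ T])
    show "Inv M' zs j" by fact
    show "j \<le> T" if "Inv M zs j" for M zs j using that by (simp add: Inv_def)
  next
    fix M' zs j
    assume inv: "Inv M' zs j" and b: "bval W M' ?b"
    have f: "M' 0 = M0 0" "M' 2 = M 2" using inv M by (auto simp: Inv_def frame_def)
    have "M' 4 0 \<le> r ?i" using b f K(1) c ri by auto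
    moreover from this have "M0 0 (M' 4 0 - 1) = Y (M' 4 0)" using inv M ri by (auto simp: Inv_def intro!: Y)
    moreover have "(M' 4 0 + 1) mod W = M' 4 0 + 1" using calculation(1) ri W by simp
    ultimately show "wp W (Emit (Cell 0 (Sub (var 4) (Const 1))) ;; incr 4) Inv M' zs (j + (bcost ?b + 1))"
      using inv f K(1) by (auto simp: wp_eqs c Inv_def frame_upd upt_Suc[unfolded Suc_eq_plus1])
  next
    fix M' zs j
    assume inv: "Inv M' zs j" and b: "\<not> bval W M' ?b"
    have f: "M' 0 = M0 0" "M' 2 = M 2" using inv M by (auto simp: Inv_def frame_def)
    have "r ?i < M' 4 0" using b f K(1) c ri by auto
    then have "M' 4 0 = Suc (r ?i)" using inv by (auto simp: Inv_def)
    then show "Q M' zs (j + (bcost ?b + 1))"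
      using inv by (auto simp: Inv_def T_def simp del: upt_Suc intro!: Q)
  qed
  moreover have "Inv (M(4 := (M 4)(0 := ?i))) (ys @ [r ?i + 1 - ?i]) (18 + k)"
    using ri by (simp add: Inv_def T_def frame_upd frame_refl)
  ultimately show ?thesis unfolding report_seq_def
    by (simp add: wp_eqs c M K(1) ri)
qed

lemma wp_report:
  assumes M: "M0 2 = (\<lambda>_. 0)" "M0 3 = (\<lambda>_. 0)"
    and Q: "\<And>M' k'. k' \<le> 100 * (\<Sum>i\<leftarrow>filter (starts r) [2..<Suc K]. r i + 1 - i) + 300 * K + 100 \<Longrightarrow>
      Q M' (concat (map (\<lambda>i. (r i + 1 - i) # map Y [i..<Suc (r i)]) (filter (starts r) [2..<Suc K]))) k'"
  shows "wp W report Q M0 [] 0"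
proof -
  define rest where "rest i = (\<Sum>i\<leftarrow>filter (starts r) [i..<Suc K]. r i + 1 - i)" for i
  define out where "out i = concat (map (\<lambda>i. (r i + 1 - i) # map Y [i..<Suc (r i)]) (filter (starts r) [2..<i]))" for i
  define T where "T = 100 * rest 2 + 300 * K + 50"
  define Inv where "Inv M zs j \<longleftrightarrow> M 0 = M0 0 \<and> zs = out (M 2 0) \<and> 2 \<le> M 2 0 \<and> M 2 0 \<le> K + 1 \<and>
      M 3 0 = (if M 2 0 = 2 then 0 else r (M 2 0 - 1)) \<and>
      j + 100 * rest (M 2 0) + 300 * (K + 1 - M 2 0) \<le> T"
    for M :: memory and zs :: "nat list" and j
  let ?b = "Neg (Less (Cell 0 (Const 0)) (var 2))"
  have c: "1 mod W = 1" "2 mod W = 2" using W by auto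
  have rest: "rest i = (if starts r i then r i + 1 - i else 0) + rest (i + 1)" if "i \<le> K" for i
    using that by (simp add: rest_def upt_conv_Cons[unfolded Suc_eq_plus1] del: upt_Suc)
  have out: "out (i + 1) = out i @ (if starts r i then (r i + 1 - i) # map Y [i..<Suc (r i)] else [])"
    if "2 \<le> i" for i
    using that by (simp add: out_def upt_Suc[unfolded Suc_eq_plus1] del: upt_Suc)
  have "wp W (While ?b report_body) Q M zs j" if I0: "Inv M zs j" for M zs j
  proof (rule wp_While[of Inv _ _ _ T])
    show "Inv M zs j" by fact
    show "j \<le> T" if "Inv M zs j" for M zs j using that by (simp add: Inv_def)
  next
    fix M zs j
    assume inv: "Inv M zs j" and b: "bval W M ?b"
    let ?i = "M 2 0"
    have i: "2 \<le> ?i" "?i \<le> K" and f: "M 0 = M0 0" using inv b K(1) by (auto simp: Inv_def)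
    have ri: "M0 0 (K + ?i - 2) = r ?i" "?i \<le> r ?i" "r ?i \<le> K" using r[OF i] by auto
    have s: "(K + ?i) mod W = K + ?i" "(?i + 1) mod W = ?i + 1" using W i by auto
    have st: "M 3 0 < r ?i \<longleftrightarrow> starts r ?i" using inv ri i by (auto simp: Inv_def starts_def)
    show "wp W report_body Inv M zs (j + (bcost ?b + 1))"
    proof (cases "starts r ?i")
      case False
      then show ?thesis unfolding report_body_def
        using inv i st rest[OF i(2)] out[OF i(1)]
        by (auto simp: wp_eqs c s f K(1) ri Inv_def)
    next
      case True
      have "Inv (M'(3 := (M' 3)(0 := r ?i), 2 := (M' 2)(0 := ?i + 1))) (zs @ (r ?i + 1 - ?i) # map Y [?i..<Suc (r ?i)]) (16 + k')"
        if "frame {4} M M'" "k' \<le> j + 20 + 100 * (r ?i + 1 - ?i) + 50" for M' k'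
        using inv i True rest[OF i(2)] out[OF i(1)] that by (auto simp: Inv_def frame_def)
      then show ?thesis unfolding report_body_def
        using True st
        by (simp add: wp_eqs c s f K(1) ri)
          (rule wp_report_seq, use f i K(1) ri s c in \<open>auto simp: wp_eqs frame_def\<close>)
    qed
  next
    fix M zs j
    assume inv: "Inv M zs j" and b: "\<not> bval W M ?b"
    have "M 2 0 = Suc K" using inv b K(1) by (auto simp: Inv_def)
    then show "Q M zs (j + (bcost ?b + 1))"
      using inv by (auto simp: Inv_def T_def rest_def out_def simp del: upt_Suc intro!: Q)
  qed
  moreover have "Inv (M0(2 := (\<lambda>_. 0)(0 := 2))) [] 13"
    using M K by (simp add: Inv_def T_def out_def)
  ultimately show ?thesis unfolding report_def using K M
    by (simp add: wp_eqs c)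
qed

end

section \<open>The subdivided graph\<close>

definition subdiv_arc :: "nat \<Rightarrow> (nat \<times> nat) list \<Rightarrow> nat \<Rightarrow> nat \<Rightarrow> bool" where
  "subdiv_arc n es x y \<longleftrightarrow>
    (\<exists>k<length es. x = fst (es ! k) \<and> y = n + k \<or> x = n + k \<and> y = snd (es ! k))"

definition decode :: "nat \<Rightarrow> (nat \<times> nat) list \<Rightarrow> nat \<Rightarrow> nat elem" where
  "decode n es x = (if x < n then Node x else Edge (es ! (x - n)))"

definition node_visible :: "nat \<Rightarrow> (nat \<times> nat) list \<Rightarrow> nat elem set \<Rightarrow> nat \<Rightarrow> bool" where
  "node_visible n es X x \<longleftrightarrow> x < n + length es \<and> decode n es x \<in> X"

definition represents ::
    "nat \<Rightarrow> (nat \<times> nat) list \<Rightarrow> nat \<Rightarrow> nat \<Rightarrow> nat elem set \<Rightarrow> nat list \<Rightarrow> bool" where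
  "represents n es s t X R \<longleftrightarrow>
    (\<exists>L Y K r. layered_limits (subdiv_arc n es) s t (node_visible n es X) L Y K r \<and>
       K \<le> n + length es + 1 \<and> R = K # map Y [2..<Suc K] @ map r [2..<Suc K]) \<or>
    \<not> (subdiv_arc n es)\<^sup>*\<^sup>* s t \<and>
      R = (if \<exists>x<n + length es. node_visible n es X x then [] else [1])"

lemma wp_build:
  fixes n :: nat and es :: "(nat \<times> nat) list"
  defines "m \<equiv> length es"
  assumes es: "\<And>k. k < m \<Longrightarrow> fst (es ! k) < n \<and> snd (es ! k) < n"
    and st: "s < n" "t < n" and W: "5000 * (m + n) \<le> W"
  shows "wp W build (\<lambda>M R k. represents n es s t X R \<and> k \<le> 5000 * (m + n))
    (input_memory (encode_instance n es s t X)) [] 0"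
proof -
  define M0 where "M0 = input_memory (encode_instance n es s t X)"
  define vis where "vis = node_visible n es X"
  define Q where "Q = (\<lambda>(M :: memory) R k. represents n es s t X R \<and> k \<le> 5000 * (m + n))"
  have zero: "M0 a = (\<lambda>_. 0)" if "a \<noteq> 0" for a using that by (auto simp: M0_def input_memory_def)
  have I: "M0 0 0 = n" "M0 0 1 = m" "M0 0 2 = s" "M0 0 3 = t"
    by (auto simp: M0_def input_memory_def encode_instance_def m_def nth_append nth_Cons' One_nat_def numeral_2_eq_2 numeral_3_eq_3)
  have cell: "M0 0 (4 + i) = (map fst es @ map snd es @
    map (\<lambda>v. of_bool (Node v \<in> X)) [0..<n] @ map (\<lambda>e. of_bool (Edge e \<in> X)) es) ! i" if "i < 3 * m + n" for i
    using that by (simp add: M0_def input_memory_def encode_instance_def m_def numeral_eq_Suc)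
  have tails: "M0 0 (4 + k) = fst (es ! k)" if "k < m" for k
    using cell[of k] that by (simp add: nth_append m_def)
  have heads: "M0 0 (4 + (m + k)) = snd (es ! k)" if "k < m" for k
    using cell[of "m + k"] that by (simp add: nth_append m_def)
  have vis: "vis x \<longleftrightarrow> 0 < M0 0 (2 * m + 4 + x)" if "x < n + m" for x
  proof -
    have "M0 0 (2 * m + 4 + x) = M0 0 (4 + (m + m + x))" by (simp add: algebra_simps mult_2)
    also have "\<dots> = of_bool (decode n es x \<in> X)"
      using cell[of "m + m + x"] that by (auto simp: nth_append m_def decode_def not_less)
    finally show ?thesis using that by (simp add: vis_def node_visible_def m_def)
  qed
  have W': "5000 * m + 5000 * n \<le> W" "1 \<le> n" using W st by auto
  have "wp W build Q M0 [] 0" unfolding build_def wp_Seq_eq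
  proof (rule wp_build_lists[where n = n and m = m])
    fix M1 k1
    assume f1: "frame {2..<9} M0 M1" and l1: "arc_lists (M1 2) (M1 4) (M1 5) (2 * m)"
      "arc_lists (M1 3) (M1 6) (M1 7) (2 * m)"
      and t1: "\<And>e. 1 \<le> e \<Longrightarrow> e \<le> m \<Longrightarrow> M1 2 e = M0 0 (3 + e) \<and> M1 3 e = n + e - 1"
      and h1: "\<And>e. m < e \<Longrightarrow> e \<le> 2 * m \<Longrightarrow> M1 2 e = n + e - (m + 1) \<and> M1 3 e = M0 0 (3 + e)"
      and k1: "k1 \<le> 0 + 200 * m + 20"
    have arc: "M1 2 (Suc k) = fst (es ! k)" "M1 3 (Suc k) = n + k"
      "M1 2 (Suc (m + k)) = n + k" "M1 3 (Suc (m + k)) = snd (es ! k)" if "k < m" for k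
      using t1[of "Suc k"] h1[of "Suc (m + k)"] tails[OF that] heads[OF that] that
      by (simp_all add: numeral_eq_Suc)
    have split: "(\<exists>k<m. e = Suc k) \<or> (\<exists>k<m. e = Suc (m + k))" if "1 \<le> e" "e \<le> 2 * m" for e
    proof (cases "e \<le> m")
      case True
      then show ?thesis using that by (intro disjI1 exI[of _ "e - 1"]) auto
    next
      case False
      then show ?thesis using that by (intro disjI2 exI[of _ "e - 1 - m"]) auto
    qed
    interpret arcs "n + m" "2 * m" "M1 2" "M1 3" "M1 4" "M1 5" "M1 6" "M1 7"
    proof
      fix e assume "1 \<le> e" "e \<le> 2 * m"
      from split[OF this] show "M1 2 e < n + m" "M1 3 e < n + m" using arc es by (auto simp: trans_less_add1)
    qed (fact l1)+
    have E: "E = subdiv_arc n es"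
    proof (intro ext iffI)
      fix x y assume "E x y"
      then obtain e where "1 \<le> e" "e \<le> 2 * m" "M1 2 e = x" "M1 3 e = y" by (auto simp: E_def)
      with split[of e] arc show "subdiv_arc n es x y" by (auto simp: subdiv_arc_def m_def)
    next
      fix x y assume "subdiv_arc n es x y"
      then obtain k where k: "k < m" "x = fst (es ! k) \<and> y = n + k \<or> x = n + k \<and> y = snd (es ! k)"
        by (auto simp: subdiv_arc_def m_def)
      then have "E (M1 2 (Suc k)) (M1 3 (Suc k))" "E (M1 2 (Suc (m + k))) (M1 3 (Suc (m + k)))"
        by (auto intro!: E_arc)
      with k arc[OF k(1)] show "E x y" by auto
    qed
    have m1: "M1 a = M0 a" if "a \<notin> {2..<9}" for a using frameD[OF f1 that] .
    show "wp W find_visible (wp W reach (wp W (Cond (Less (Const 0) (Cell 14 (Cell 0 (Const 2))))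
      (find_path ;; find_layers ;; find_limits ;; Emit (var 35) ;; emit_array 36 ;; emit_array 46)
      (Cond (Less (Const 0) (var 9)) Skip (Emit (Const 1)))) Q)) M1 [] k1"
    proof (rule wp_find_visible[where n = n and m = m])
      fix M2 k2
      assume f2: "frame {9, 16} M1 M2" and any: "(M2 9 0 = 0) = (\<forall>x<n + m. M1 0 (4 + (m + m) + x) = 0)"
        and k2: "k2 \<le> k1 + 100 * (n + m) + 20"
      have m2: "M2 a = M1 a" if "a \<notin> {9, 16}" for a using frameD[OF f2 that] .
      have any': "(M2 9 0 = 0) \<longleftrightarrow> \<not> (\<exists>x<n + m. vis x)"
        unfolding any using vis m1[of 0] by (auto simp: algebra_simps mult_2)
      show "wp W reach (wp W (Cond (Less (Const 0) (Cell 14 (Cell 0 (Const 2))))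
        (find_path ;; find_layers ;; find_limits ;; Emit (var 35) ;; emit_array 36 ;; emit_array 46)
        (Cond (Less (Const 0) (var 9)) Skip (Emit (Const 1)))) Q) M2 [] k2"
      proof (rule wp_reach[where t = t])
        fix M3 k3
        assume f3: "frame {10..<16} M2 M3" and mk: "M3 14 t = 1" "\<And>x. M3 14 x \<le> n + m"
            "\<And>x. M3 14 x \<noteq> 0 \<Longrightarrow> x < n + m"
            "\<And>x. M3 14 x \<noteq> 0 \<Longrightarrow> x \<noteq> t \<Longrightarrow> E x (M3 15 x) \<and> M3 14 (M3 15 x) \<noteq> 0 \<and> M3 14 (M3 15 x) < M3 14 x"
          and closed: "\<And>x z. M3 14 x \<noteq> 0 \<Longrightarrow> E z x \<Longrightarrow> M3 14 z \<noteq> 0"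
          and k3: "k3 \<le> k2 + 100 * (2 * m + (n + m)) + 50"
        have m3: "M3 a = M2 a" if "a \<notin> {10..<16}" for a using frameD[OF f3 that] .
        have M3: "M3 0 = M0 0" "M3 2 = M1 2" "M3 3 = M1 3" "M3 4 = M1 4" "M3 5 = M1 5" "M3 6 = M1 6" "M3 7 = M1 7"
          "M3 9 = M2 9" using m1 m2 m3 by auto
        have zero3: "M3 a = (\<lambda>_. 0)" if "20 \<le> a" for a using m1[of a] m2[of a] m3[of a] zero[of a] that by auto
        have c: "1 mod W = 1" "2 mod W = 2" using W' by auto
        show "wp W (Cond (Less (Const 0) (Cell 14 (Cell 0 (Const 2))))
          (find_path ;; find_layers ;; find_limits ;; Emit (var 35) ;; emit_array 36 ;; emit_array 46)
          (Cond (Less (Const 0) (var 9)) Skip (Emit (Const 1)))) Q M3 [] k3"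
        proof (rule wp_Cond)
          assume "bval W M3 (Less (Const 0) (Cell 14 (Cell 0 (Const 2))))"
          then have s14: "M3 14 s \<noteq> 0" using M3 I c by simp
          show "wp W (find_path ;; find_layers ;; find_limits ;; Emit (var 35) ;; emit_array 36 ;; emit_array 46) Q M3 []
            (k3 + (bcost (Less (Const 0) (Cell 14 (Cell 0 (Const 2)))) + 1))"
            unfolding wp_Seq_eq
          proof (rule wp_find_path[where s = s and t = t])
            fix M4 k4
            assume f4: "frame {20..<24} M3 M4"
              and ap: "arcs_path (n + m) (2 * m) (M1 2) (M1 3) (M1 4) (M1 5) (M1 6) (M1 7) s t (M4 21) (M4 22) (M4 20 0)"
              and k4: "k4 \<le> k3 + (bcost (Less (Const 0) (Cell 14 (Cell 0 (Const 2)))) + 1) + 100 * (n + m) + 50"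
            have m4: "M4 a = M3 a" if "a \<notin> {20..<24}" for a using frameD[OF f4 that] .
            interpret p: arcs_path "n + m" "2 * m" "M1 2" "M1 3" "M1 4" "M1 5" "M1 6" "M1 7" s t vis "M4 21" "M4 22" "M4 20 0"
              by (fact ap)
            show "wp W find_layers (wp W find_limits (wp W (Emit (var 35)) (wp W (emit_array 36) (wp W (emit_array 46) Q)))) M4 [] k4"
            proof (rule p.wp_find_layers[where mm = m])
              fix M5 k5
              assume f5: "frame {30..<39} M4 M5" and lay: "layered E s t vis (M5 34) (M5 36) (M5 35 0)"
                and K5: "M5 35 0 \<le> n + m + 1" and Y5: "\<And>b. 2 \<le> b \<Longrightarrow> b \<le> M5 35 0 \<Longrightarrow> M5 36 b < n + m"
                and k5: "k5 \<le> k4 + 100 * (2 * m) + 400 * (n + m) + 50"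
              have m5: "M5 a = M4 a" if "a \<notin> {30..<39}" for a using frameD[OF f5 that] .
              interpret al: arcs_layered "n + m" "2 * m" "M1 2" "M1 3" "M1 4" "M1 5" "M1 6" "M1 7" s t vis "M5 34" "M5 36" "M5 35 0"
                by (rule arcs_layered.intro[OF arcs_axioms lay arcs_layered_axioms.intro[OF Y5]])
              show "wp W find_limits (wp W (Emit (var 35)) (wp W (emit_array 36) (wp W (emit_array 46) Q))) M5 [] k5"
              proof (rule al.wp_find_limits[where mm = m])
                fix M6 k6
                assume f6: "frame {40..<47} M5 M6" and lim: "layered_limits E s t vis (M5 34) (M5 36) (M5 35 0) (M6 46)"
                  and k6: "k6 \<le> k5 + 200 * (2 * m) + 100 * (n + m) + 100 * M5 35 0 + 50"
                have m6: "M6 35 = M5 35" "M6 36 = M5 36" using f6 by (auto simp: frame_def)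
                have K1: "1 \<le> M5 35 0" by (rule al.K_pos)
                have W6: "M5 35 0 + 10 < W" using K5 W' by linarith
                have rep: "represents n es s t X
                  (M5 35 0 # map (M5 36) [2..<Suc (M5 35 0)] @ map (M6 46) [2..<Suc (M5 35 0)])"
                  using lim[unfolded E vis_def] K5 unfolding represents_def m_def by blast
                show "wp W (Emit (var 35)) (wp W (emit_array 36) (wp W (emit_array 46) Q)) M6 [] k6"
                  unfolding wp_Emit_eq
                proof (rule wp_emit_array)
                  fix M7 k7
                  assume f7: "frame {50} M6 M7" and k7: "k7 \<le> k6 + (acost (var 35) + 1) + 100 * M6 35 0 + 50"
                  have m7: "M7 35 = M5 35" "M7 46 = M6 46" using f7 m6 by (auto simp: frame_def)
                  show "wp W (emit_array 46) Q M7 (([] @ [aval W M6 (var 35)]) @ map (M6 36) [2..<Suc (M6 35 0)]) k7"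
                  proof (rule wp_emit_array)
                    fix M8 k8
                    assume k8: "k8 \<le> k7 + 100 * M7 35 0 + 50"
                    have "k8 \<le> 5000 * (m + n)"
                      using k1 k2 k3 k4 k5 k6 k7 k8 K5 W' unfolding m7 m6 by simp
                    then show "Q M8 ((([] @ [aval W M6 (var 35)]) @ map (M6 36) [2..<Suc (M6 35 0)]) @ map (M7 46) [2..<Suc (M7 35 0)]) k8"
                      using rep unfolding Q_def m7 m6 by (simp add: m6 del: upt_Suc)
                  qed (use W6 K1 m7 in auto)
                qed (use W6 K1 m6 in auto)
              qed (use zero3 m4 m5 M3 I vis W' in auto)
            qed (use zero3 m4 M3 I vis W' in auto)
          qed (use zero3 M3 I W' mk s14 in auto)
        next
          assume "\<not> bval W M3 (Less (Const 0) (Cell 14 (Cell 0 (Const 2))))"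
          then have s14: "M3 14 s = 0" using M3 I c by simp
          have "\<not> E\<^sup>*\<^sup>* s t"
          proof
            assume "E\<^sup>*\<^sup>* s t"
            then have "M3 14 s \<noteq> 0"
              by (induct rule: converse_rtranclp_induct) (use mk(1) closed in auto)
            with s14 show False by simp
          qed
          then have "represents n es s t X (if \<exists>x<n + m. vis x then [] else [1])"
            unfolding represents_def E unfolding vis_def m_def by blast
          moreover have "k3 + 20 \<le> 5000 * (m + n)" using k1 k2 k3 W' by simp
          ultimately show "wp W (Cond (Less (Const 0) (var 9)) Skip (Emit (Const 1))) Q M3 []
            (k3 + (bcost (Less (Const 0) (Cell 14 (Cell 0 (Const 2)))) + 1))"
            using any' by (cases "\<exists>x<n + m. vis x") (simp_all add: wp_eqs M3 c Q_def)
        qed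
      qed (use zero m1 m2 I st W' in auto)
    qed (use zero m1 I W' in auto)
  qed (use zero I W' in auto)
  then show ?thesis by (simp add: Q_def M0_def)
qed

locale encoded_graph = pair_fin_digraph G for G :: "nat pair_pre_digraph" +
  fixes n :: nat and es :: "(nat \<times> nat) list"
  assumes verts_n: "pverts G = {0..<n}" and es: "distinct es" "set es = parcs G"
begin

abbreviation "N \<equiv> n + length es"
abbreviation "code \<equiv> elem_code n es"
abbreviation "dec \<equiv> decode n es"

lemma ends_less: "k < length es \<Longrightarrow> fst (es ! k) < n \<and> snd (es ! k) < n"
  using verts_n es(2) in_arcsD1 in_arcsD2 nth_mem[of k es] arc_fst_in_verts arc_snd_in_verts
  by (metis atLeastLessThan_iff prod.collapse)

lemma code_edge: "k < length es \<Longrightarrow> code (Edge (es ! k)) = n + k"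
  using es(1) by (auto intro!: the_equality simp: nth_eq_iff_index_eq)

lemma elems_cases:
  assumes "x \<in> elems G"
  obtains v where "x = Node v" "v < n" | k where "x = Edge (es ! k)" "k < length es"
  using assms verts_n es(2) unfolding elems_def by (auto simp: in_set_conv_nth) (metis es(2) in_set_conv_nth)

lemma dec_code: "x \<in> elems G \<Longrightarrow> dec (code x) = x"
  by (erule elems_cases) (auto simp: code_edge decode_def simp del: elem_code.simps(2))

lemma code_less: "x \<in> elems G \<Longrightarrow> code x < N"
  by (erule elems_cases) (auto simp: code_edge simp del: elem_code.simps(2))

lemma code_dec: "x < N \<Longrightarrow> code (dec x) = x"
  by (cases "x < n") (auto simp: code_edge decode_def simp del: elem_code.simps(2))

lemma dec_elems: "x < N \<Longrightarrow> dec x \<in> elems G"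
  using es(2) verts_n by (auto simp: decode_def elems_def)

lemma alternating_elems:
  "awalk u p v \<Longrightarrow> set (alternating u p) \<subseteq> elems G"
  by (induct p arbitrary: u) (auto simp: awalk_Cons_iff elems_def awalk_Nil_iff)

lemma walk_of_awalk:
  "awalk u p v \<Longrightarrow> walk (subdiv_arc n es) u (map code (alternating u p)) v"
proof (induct p arbitrary: u)
  case Nil
  then show ?case by (auto simp: awalk_Nil_iff walk_def)
next
  case (Cons e p)
  then have e: "e \<in> parcs G" "fst e = u" "awalk (snd e) p v" by (auto simp: awalk_Cons_iff)
  then obtain k where k: "k < length es" "es ! k = e" using es(2) by (metis in_set_conv_nth)
  then have "code (Edge e) = n + k" using code_edge by blast
  moreover have "subdiv_arc n es u (n + k)" "subdiv_arc n es (n + k) (snd e)"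
    using k e by (auto simp: subdiv_arc_def)
  moreover have "walk (subdiv_arc n es) (snd e) (map code (alternating (snd e) p)) v"
    by (rule Cons(1)[OF e(3)])
  moreover have "map code (alternating (snd e) p) = snd e # tl (map code (alternating (snd e) p))"
    by (cases p) auto
  ultimately show ?case unfolding walk_def
    by (auto simp: successively_Cons simp del: elem_code.simps(2))
qed

lemma awalk_of_walk:
  assumes "walk (subdiv_arc n es) u w v" "u < n" "v < n"
  shows "\<exists>p. awalk u p v \<and> w = map code (alternating u p)"
  using assms
proof (induct "length w" arbitrary: u w rule: less_induct)
  case less
  then obtain w' where w: "w = u # w'" by (cases w) (auto simp: walk_def)
  show ?case
  proof (cases w')
    case Nil
    then show ?thesis using less w verts_n by (intro exI[of _ "[]"]) (auto simp: walk_def awalk_Nil_iff)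
  next
    case (Cons y w'')
    then have "subdiv_arc n es u y" using less(2) w by (auto simp: walk_def)
    then obtain k where k: "k < length es" "u = fst (es ! k)" "y = n + k"
      using less(3) by (auto simp: subdiv_arc_def)
    have "w'' \<noteq> []" using less(2,4) w Cons k by (auto simp: walk_def)
    then obtain z w3 where w'': "w'' = z # w3" by (cases w'') auto
    then have "subdiv_arc n es y z" using less(2) w Cons by (auto simp: walk_def)
    then obtain k' where "k' < length es"
      "n + k = fst (es ! k') \<and> z = n + k' \<or> n + k = n + k' \<and> z = snd (es ! k')"
      using k by (auto simp: subdiv_arc_def)
    then have z: "z = snd (es ! k)" using ends_less[of k'] by auto
    have walk: "walk (subdiv_arc n es) z w'' v"
      using less(2) unfolding w Cons w'' by (simp add: walk_def)
    have len: "length w'' < length w" unfolding w Cons by simp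
    have "z < n" using z ends_less[OF k(1)] by simp
    from less(1)[OF len walk this less(4)] obtain p where
      p: "awalk z p v" "w'' = map code (alternating z p)" by blast
    have "es ! k \<in> parcs G" using es(2) k(1) nth_mem by blast
    then have "awalk u (es ! k # p) v" unfolding awalk_Cons_iff using p(1) k(2) z by simp
    moreover have "w = map code (alternating u (es ! k # p))"
      using w Cons p(2) k z code_edge[OF k(1)] by (simp del: elem_code.simps(2))
    ultimately show ?thesis by blast
  qed
qed

lemma filter_code:
  assumes "set l \<subseteq> elems G"
  shows "filter (node_visible n es X) (map code l) = map code (filter (\<lambda>x. x \<in> X) l)"
  using assms by (induct l) (auto simp: node_visible_def dec_code code_less)

lemma map_dec_code: "set l \<subseteq> elems G \<Longrightarrow> map dec (map code l) = l"
  by (induct l) (auto simp: dec_code)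

lemma map_code_dec: "\<forall>x\<in>set l. x < N \<Longrightarrow> map code (map dec l) = l"
  by (induct l) (auto simp: code_dec)

lemma sublist_map: "sublist u v \<Longrightarrow> sublist (map f u) (map f v)"
  unfolding sublist_def by (metis map_append)

context
  fixes s t X
  assumes s: "s < n" and t: "t < n" and X: "X \<subseteq> elems G"
begin

abbreviation "nsafe \<equiv> node_safe (subdiv_arc n es) s t (node_visible n es X)"
abbreviation "nmax \<equiv> node_maximal_safe (subdiv_arc n es) s t (node_visible n es X)"

lemma safe_iff: "safe G s t X w \<longleftrightarrow> set w \<subseteq> elems G \<and> nsafe (map code w)"
proof (cases "set w \<subseteq> X")
  case True
  then have wel: "set w \<subseteq> elems G" using X by blast
  have vis: "node_visible n es X y" if "y \<in> set (map code w)" for y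
    using that True X by (auto simp: node_visible_def dec_code code_less subset_iff)
  have "sublist w (subsequence_of X (alternating s p)) \<longleftrightarrow>
    sublist (map code w) (filter (node_visible n es X) (map code (alternating s p)))"
    if "awalk s p t" for p
  proof -
    have el: "set (alternating s p) \<subseteq> elems G" using alternating_elems[OF that] .
    then have fel: "set (filter (\<lambda>x. x \<in> X) (alternating s p)) \<subseteq> elems G" by auto
    show ?thesis unfolding subsequence_of_def filter_code[OF el]
      using sublist_map[of w _ code] sublist_map[of "map code w" _ dec] map_dec_code[OF wel] map_dec_code[OF fel]
      by metis
  qed
  then have "(\<forall>p. awalk s p t \<longrightarrow> sublist w (subsequence_of X (alternating s p))) \<longleftrightarrow>
    (\<forall>q. walk (subdiv_arc n es) s q t \<longrightarrow> sublist (map code w) (filter (node_visible n es X) q))"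
    using walk_of_awalk awalk_of_walk s t by metis
  then show ?thesis using True wel vis unfolding safe_def node_safe_def by auto
next
  case False
  then obtain x where x: "x \<in> set w" "x \<notin> X" by blast
  have "\<not> (set w \<subseteq> elems G \<and> nsafe (map code w))"
  proof
    assume "set w \<subseteq> elems G \<and> nsafe (map code w)"
    then have "node_visible n es X (code x)" "x \<in> elems G" using x by (auto simp: node_safe_def)
    then show False using x by (simp add: node_visible_def dec_code)
  qed
  with False show ?thesis by (auto simp: safe_def)
qed

lemma nsafe_less: "nsafe w \<Longrightarrow> y \<in> set w \<Longrightarrow> y < N"
  by (auto simp: node_safe_def node_visible_def)

lemma maximal_safe_iff: "maximal_safe G s t X w \<longleftrightarrow> set w \<subseteq> elems G \<and> nmax (map code w)"
proof -
  have cons: "(\<exists>x. safe G s t X (x # w)) \<longleftrightarrow> (\<exists>y. nsafe (y # map code w))" if w: "set w \<subseteq> elems G"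
  proof
    assume "\<exists>y. nsafe (y # map code w)"
    then obtain y where y: "nsafe (y # map code w)" by blast
    then have "y < N" using nsafe_less by auto
    then have "safe G s t X (dec y # w)" unfolding safe_iff using y w dec_elems code_dec by simp
    then show "\<exists>x. safe G s t X (x # w)" by blast
  qed (use safe_iff in auto)
  have snoc: "(\<exists>x. safe G s t X (w @ [x])) \<longleftrightarrow> (\<exists>y. nsafe (map code w @ [y]))" if w: "set w \<subseteq> elems G"
  proof
    assume "\<exists>y. nsafe (map code w @ [y])"
    then obtain y where y: "nsafe (map code w @ [y])" by blast
    then have "y < N" using nsafe_less by auto
    then have "safe G s t X (w @ [dec y])" unfolding safe_iff using y w dec_elems code_dec by simp
    then show "\<exists>x. safe G s t X (w @ [x])" by blast
  qed (use safe_iff in auto)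
  show ?thesis unfolding maximal_safe_def node_maximal_safe_def using safe_iff cons snoc by metis
qed

lemma solution_eq: "solution G s t X = map dec ` {w. nmax w}"
proof (intro set_eqI iffI)
  fix w assume "w \<in> solution G s t X"
  then have "set w \<subseteq> elems G" "nmax (map code w)" by (auto simp: solution_def maximal_safe_iff)
  then show "w \<in> map dec ` {w. nmax w}" using map_dec_code by (metis image_eqI mem_Collect_eq)
next
  fix w assume "w \<in> map dec ` {w. nmax w}"
  then obtain y where y: "nmax y" "w = map dec y" by blast
  then have "\<forall>z\<in>set y. z < N" using nsafe_less by (auto simp: node_maximal_safe_def)
  then have "set w \<subseteq> elems G" "map code w = y" using y dec_elems map_code_dec by auto
  then show "w \<in> solution G s t X" using y by (simp add: solution_def maximal_safe_iff)
qed

lemma solution_unreachable: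
  assumes "\<not> (subdiv_arc n es)\<^sup>*\<^sup>* s t"
  shows "solution G s t X = (if \<exists>x<N. node_visible n es X x then {} else {[]})"
proof -
  have no: "\<not> walk (subdiv_arc n es) s w t" for w using assms walk_to_rtranclp by metis
  then have "nsafe w \<longleftrightarrow> (\<forall>x\<in>set w. node_visible n es X x)" for w by (simp add: node_safe_def)
  then have "nmax w \<longleftrightarrow> (\<forall>x. \<not> node_visible n es X x) \<and> w = []" for w
    by (cases w) (auto simp: node_maximal_safe_def)
  moreover have "(\<exists>x<N. node_visible n es X x) \<longleftrightarrow> (\<exists>x. node_visible n es X x)"
    by (auto simp: node_visible_def)
  ultimately show ?thesis unfolding solution_eq by auto
qed

lemma Edge_in_alternating: "Edge e \<in> set (alternating u p) \<longleftrightarrow> e \<in> set p"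
  by (induct p arbitrary: u) auto

lemma Node_in_alternating: "awalk u p v \<Longrightarrow> Node x \<in> set (alternating u p) \<Longrightarrow> x \<in> set (pawalk_verts u p)"
  by (induct p arbitrary: u) (auto simp: awalk_Cons_iff)

lemma cut_elem:
  assumes "x < N" "dec x \<in> X" "\<And>w. walk (subdiv_arc n es) s w t \<Longrightarrow> x \<in> set w"
  shows "dec x \<in> Edge ` bridges G s t \<union> (X \<inter> Node ` articulation_points G s t)"
proof -
  have on: "dec x \<in> set (alternating s p)" if "awalk s p t" for p
  proof -
    have "x \<in> code ` set (alternating s p)" using assms(3)[OF walk_of_awalk[OF that]] by simp
    then show ?thesis using dec_code alternating_elems[OF that] by auto
  qed
  from dec_elems[OF assms(1)] show ?thesis
  proof (cases rule: elems_cases)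
    case (1 v)
    have "v \<in> set (pawalk_verts s p)" if "apath s p t" for p
      using Node_in_alternating[of s p t v] on[of p] that 1 by (auto simp: apath_def)
    then have "v \<in> articulation_points G s t" using 1 verts_n by (auto simp: articulation_points_def)
    then show ?thesis using 1 assms(2) by auto
  next
    case (2 k)
    let ?e = "es ! k"
    have "?e \<in> bridges G s t" unfolding bridges_def
    proof (intro CollectI conjI notI)
      show "?e \<in> parcs G" using 2 es(2) nth_mem by blast
      let ?H = "pre_digraph.del_arc (with_proj G) ?e"
      assume "\<exists>p. pre_digraph.apath ?H s p t"
      then obtain p where p: "pre_digraph.apath ?H s p t" by blast
      interpret H: wf_digraph ?H by (rule wf_digraph_del_arc)
      have cas: "pre_digraph.cas ?H u q v = pcas u q v" for u q v
        by (induct q arbitrary: u) (auto simp: pre_digraph.cas.simps del_arc_def)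
      have "awalk s p t" "?e \<notin> set p"
        using p unfolding H.apath_def H.awalk_def awalk_def cas by (auto simp: del_arc_def)
      with on[of p] 2 show False by (simp add: Edge_in_alternating)
    qed
    then show ?thesis using 2 by auto
  qed
qed

end

end

lemma (in layered_limits) covered:
  assumes "2 \<le> b" "b \<le> K"
  shows "r b \<le> Suc (\<Sum>i\<leftarrow>filter (starts r) [2..<Suc b]. r i + 1 - i)"
  using assms
proof (induct b rule: nat_induct_at_least)
  case base
  then show ?case by (simp add: starts_def)
next
  case (Suc b)
  then show ?case using r_bounds[of b] r_bounds[of "Suc b"] by (auto simp: starts_def)
qed

lemma sum_list_lengths: "distinct ws \<Longrightarrow> total_length (set ws) = (\<Sum>w\<leftarrow>ws. length w)"
  by (simp add: total_length_def sum_list_distinct_conv_sum_set)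

lemma report_trivial:
  assumes "10 < W"
  shows "outputs_within W report [] 100 []" "outputs_within W report [1] 100 [0]"
proof -
  have c: "2 mod W = 2" using assms by simp
  show "outputs_within W report [] 100 []" "outputs_within W report [1] 100 [0]"
    by (rule outputs_withinI; simp add: report_def wp_eqs input_memory_def c)+
qed

lemma representation_memory:
  fixes Y r :: "nat \<Rightarrow> nat" and K :: nat
  defines "R \<equiv> K # map Y [2..<Suc K] @ map r [2..<Suc K]"
  assumes "2 \<le> K" "2 * K + 10 < W" "\<And>b. 2 \<le> b \<Longrightarrow> b \<le> K \<Longrightarrow> b \<le> r b \<and> r b \<le> K"
  shows "representation (input_memory R) K Y r W"
proof
  show "input_memory R 0 0 = K" by (simp add: input_memory_def R_def)
  fix b assume b: "2 \<le> b" "b \<le> K"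
  then have i: "b - 1 = Suc (b - 2)" "K + b - 2 = Suc (K - 1 + (b - 2))" "Suc (Suc (b - 2)) = b" by auto
  have "R ! (b - 1) = Y b" "R ! (K + b - 2) = r b" "b - 1 < length R" "K + b - 2 < length R"
    unfolding i(1,2) using b i(3) by (auto simp: R_def nth_append nth_map_upt simp del: upt_Suc)
  then show "input_memory R 0 (b - 1) = Y b"
    "input_memory R 0 (K + b - 2) = r b \<and> b \<le> r b \<and> r b \<le> K"
    using assms(4)[OF b] by (auto simp: input_memory_def)
qed (use assms in auto)

context encoded_graph
begin

lemma report_represented:
  assumes st: "s < n" "t < n" and X: "X \<subseteq> elems G" and W: "5000 * (length es + n) \<le> W"
    and B: "bridge_sequence G s t B" and R: "represents n es s t X R"
  shows "length R \<le> 5000 * (length B + card (X \<inter> Node ` articulation_points G s t) + 1) \<and>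
    (\<exists>ys. outputs_within W report R (5000 * (total_length (solution G s t X) + 1)) ys \<and>
      reports n es (solution G s t X) ys)"
proof -
  have W10: "10 < W"
  proof (rule less_le_trans[OF _ W])
    have "10 < 5000 * n" using st by simp
    then show "10 < 5000 * (length es + n)" by simp
  qed
  have mono: "outputs_within W report R' T ys \<Longrightarrow> T \<le> T' \<Longrightarrow> outputs_within W report R' T' ys" for R' T T' ys
    unfolding outputs_within_def by (meson order_trans)
  have rep_empty: "reports n es {[]} [0]" unfolding reports_def by (intro exI[of _ "[[]]"]) simp
  have rep_none: "reports n es {} []" unfolding reports_def by (intro exI[of _ "[]"]) simp
  show ?thesis using R unfolding represents_def
  proof (elim disjE conjE exE)
    assume "\<not> (subdiv_arc n es)\<^sup>*\<^sup>* s t"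
      and R': "R = (if \<exists>x<n + length es. node_visible n es X x then [] else [1])"
    note sol = solution_unreachable[OF st X this(1)]
    show ?thesis
    proof (cases "\<exists>x<n + length es. node_visible n es X x")
      case True
      then show ?thesis using R' sol rep_none mono[OF report_trivial(1)[OF W10]] by (auto intro!: exI[of _ "[]"])
    next
      case False
      then show ?thesis using R' sol rep_empty mono[OF report_trivial(2)[OF W10]]
        by (auto intro!: exI[of _ "[0]"])
    qed
  next
    fix L Y K r
    assume lim: "layered_limits (subdiv_arc n es) s t (node_visible n es X) L Y K r"
      and K: "K \<le> n + length es + 1" and R': "R = K # map Y [2..<Suc K] @ map r [2..<Suc K]"
    interpret layered_limits "subdiv_arc n es" s t "node_visible n es X" L Y K r by (fact lim)
    define I where "I = filter (starts r) [2..<Suc K]"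
    have "card (dec ` Y ` {2..K}) \<le> card (Edge ` bridges G s t \<union> (X \<inter> Node ` articulation_points G s t))"
    proof (rule card_mono)
      have "bridges G s t \<subseteq> parcs G" "articulation_points G s t \<subseteq> pverts G"
        by (auto simp: bridges_def articulation_points_def)
      then have "finite (bridges G s t)" "finite (articulation_points G s t)"
        using pair_finite_arcs pair_finite_verts finite_subset by blast+
      then show "finite (Edge ` bridges G s t \<union> (X \<inter> Node ` articulation_points G s t))" by blast
      show "dec ` Y ` {2..K} \<subseteq> Edge ` bridges G s t \<union> (X \<inter> Node ` articulation_points G s t)"
      proof clarify
        fix b assume b: "b \<in> {2..K}" "dec (Y b) \<notin> X \<inter> Node ` articulation_points G s t"
        have "node_visible n es X (Y b)" using vis_Y b by auto
        then show "dec (Y b) \<in> Edge ` bridges G s t"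
          using cut_elem[OF st X, of "Y b"] walk_Y b by (auto simp: node_visible_def)
      qed
    qed
    also have "\<dots> \<le> card (bridges G s t) + card (X \<inter> Node ` articulation_points G s t)"
      by (rule order_trans[OF card_Un_le]) (simp add: card_image_le bridges_def pair_finite_arcs)
    also have "card (bridges G s t) = length B"
      using B by (metis bridge_sequence_def distinct_card)
    also have "card (dec ` Y ` {2..K}) = K - 1"
    proof -
      have "inj_on dec (Y ` {2..K})"
      proof (rule inj_onI)
        fix x y assume "x \<in> Y ` {2..K}" "y \<in> Y ` {2..K}" and eq: "dec x = dec y"
        then have "x < N" "y < N" using vis_Y by (auto simp: node_visible_def)
        then show "x = y" using eq code_dec by metis
      qed
      moreover have "inj_on Y {2..K}" using Y_inj by (auto simp: inj_on_def)
      ultimately show ?thesis by (simp add: card_image)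
    qed
    finally have size: "K - 1 \<le> length B + card (X \<inter> Node ` articulation_points G s t)" .
    have len: "length R \<le> 5000 * (length B + card (X \<inter> Node ` articulation_points G s t) + 1)"
      using size by (simp add: R' del: upt_Suc)
    show ?thesis
    proof (cases "K = 1")
      case True
      then have "solution G s t X = {[]}" unfolding solution_eq[OF st X] node_maximal_safe_iff by auto
      moreover have "R = [1]" using True R' by (simp add: One_nat_def)
      ultimately show ?thesis using len rep_empty mono[OF report_trivial(2)[OF W10]]
        by (auto intro!: exI[of _ "[0]"])
    next
      case False
      then have K2: "2 \<le> K" using K_pos by simp
      define ws where "ws = map (\<lambda>i. map dec (Yseg i (r i))) I"
      have I: "set I = {i. 2 \<le> i \<and> i \<le> K \<and> (i = 2 \<or> r (i - 1) < r i)}"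
        by (auto simp: I_def starts_def)
      have Yless: "Y b < N" if "2 \<le> b" "b \<le> K" for b using vis_Y[OF that] by (simp add: node_visible_def)
      have cd: "map code (map dec (Yseg i (r i))) = Yseg i (r i)" if "i \<in> set I" for i
        using that r_bounds[of i] Yless by (intro map_code_dec) (auto simp: I set_Yseg)
      have sol: "solution G s t X = set ws"
        unfolding solution_eq[OF st X] node_maximal_safe_iff ws_def using False by (auto simp: I)
      have dist: "distinct ws"
      proof -
        have "inj_on (\<lambda>i. map dec (Yseg i (r i))) (set I)"
        proof (rule inj_onI)
          fix i j assume ij: "i \<in> set I" "j \<in> set I" "map dec (Yseg i (r i)) = map dec (Yseg j (r j))"
          then have "Yseg i (r i) = Yseg j (r j)" using cd by metis
          then show "i = j" using ij r_bounds[of i] r_bounds[of j] Yseg_eq(1)[of i "r i" j "r j"] by (auto simp: I)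
        qed
        then show ?thesis by (simp add: ws_def distinct_map I_def)
      qed
      have total: "total_length (solution G s t X) = (\<Sum>i\<leftarrow>I. r i + 1 - i)"
        unfolding sol sum_list_lengths[OF dist] by (simp add: ws_def comp_def length_Yseg Suc_eq_plus1)
      have Kt: "K \<le> Suc (total_length (solution G s t X))"
        using covered[of K] K2 r_K unfolding total I_def by simp
      define ys where "ys = concat (map (\<lambda>i. (r i + 1 - i) # map Y [i..<Suc (r i)]) I)"
      have "map (\<lambda>w. length w # map code w) ws = map (\<lambda>i. (r i + 1 - i) # map Y [i..<Suc (r i)]) I"
        unfolding ws_def map_map comp_def using cd
        by (intro map_cong refl) (simp add: length_Yseg Suc_eq_plus1, simp add: Yseg_def Suc_eq_plus1)
      then have "reports n es (solution G s t X) ys"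
        unfolding reports_def ys_def sol using dist by metis
      moreover have "outputs_within W report R (5000 * (total_length (solution G s t X) + 1)) ys"
      proof (rule outputs_withinI)
        interpret R: representation "input_memory R" K Y r W
          unfolding R' by (rule representation_memory) (use K2 K W r_bounds st in auto)
        show "wp W report (\<lambda>M zs k. zs = ys \<and> k \<le> 5000 * (total_length (solution G s t X) + 1)) (input_memory R) [] 0"
          by (rule R.wp_report) (use Kt in \<open>auto simp: input_memory_def ys_def total I_def simp del: upt_Suc\<close>)
      qed
      ultimately show ?thesis using len by blast
    qed
  qed
qed

end

theorem theorem2:
  shows "\<exists>(build :: com) (report :: com) (c :: nat).
    \<forall>(G :: nat pair_pre_digraph) (n :: nat) (m :: nat) (es :: (nat \<times> nat) list)
      (s :: nat) (t :: nat) (B :: (nat \<times> nat) list) (X :: nat elem set) (W :: nat).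
      pair_fin_digraph G \<longrightarrow>
      pverts G = {0..<n} \<longrightarrow>
      card (parcs G) = m \<longrightarrow>
      distinct es \<longrightarrow> set es = parcs G \<longrightarrow>
      s \<in> pverts G \<longrightarrow> t \<in> pverts G \<longrightarrow>
      bridge_sequence G s t B \<longrightarrow>
      X \<subseteq> elems G \<longrightarrow>
      W \<ge> c * (m + n) \<longrightarrow>
      (\<exists>R. outputs_within W build (encode_instance n es s t X) (c * (m + n)) R \<and>
           length R \<le> c * (length B + card (X \<inter> Node ` articulation_points G s t) + 1) \<and>
           (\<exists>ys. outputs_within W report R (c * (total_length (solution G s t X) + 1)) ys \<and>
                 reports n es (solution G s t X) ys))"
proof (rule exI[of _ build], rule exI[of _ report], rule exI[of _ 5000], intro allI impI)
  fix G :: "nat pair_pre_digraph" and n m s t W :: nat and es B X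
  assume G: "pair_fin_digraph G" and verts: "pverts G = {0..<n}" and m: "card (parcs G) = m"
    and es: "distinct es" "set es = parcs G" and st: "s \<in> pverts G" "t \<in> pverts G"
    and B: "bridge_sequence G s t B" and X: "X \<subseteq> elems G" and W: "5000 * (m + n) \<le> W"
  interpret encoded_graph G n es
    using G verts es by (intro encoded_graph.intro encoded_graph_axioms.intro)
  have len: "m = length es" using m es by (metis distinct_card)
  have st': "s < n" "t < n" using st verts by auto
  have "wp W build (\<lambda>M R k. represents n es s t X R \<and> k \<le> 5000 * (length es + n))
    (input_memory (encode_instance n es s t X)) [] 0"
    by (rule wp_build) (use ends_less st' W len in auto)
  then obtain R where "represents n es s t X R"
    "outputs_within W build (encode_instance n es s t X) (5000 * (m + n)) R"
    unfolding wp_def outputs_within_def len by auto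
  with report_represented[OF st' X _ B] W len
  show "\<exists>R. outputs_within W build (encode_instance n es s t X) (5000 * (m + n)) R \<and>
           length R \<le> 5000 * (length B + card (X \<inter> Node ` articulation_points G s t) + 1) \<and>
           (\<exists>ys. outputs_within W report R (5000 * (total_length (solution G s t X) + 1)) ys \<and>
                 reports n es (solution G s t X) ys)"
    by blast
qed

end
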